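(* Let $G$ be a lacunary hyperbolic group. Then (a) Every finitely presented subgroup of $G$ is (isomorphic to) a subgroup of a hyperbolic group. (b) Every undistorted (i.e. quasi-isometrically embedded) subgroup of $G$ is lacunary hyperbolic. (c) Let $H$ be a (not necessarily finitely generated) bounded torsion subgroup of $G$. Then the growth of $H$ in $G$ is not exponential.
   Context: A finitely generated group $G$ (with the word metric of a finite generating set) is lacunary hyperbolic if at least one of its asymptotic cones is an $\mathbb R$-tree; for a non-principal ultrafilter $\omega$ on $\mathbb N$ and an unbounded non-decreasing sequence $d=(d_n)$ of positive reals, the asymptotic cone $\mathrm{Con}^\omega(G,d)$ is the set of sequences $(g_n)$ in $G$ with $\mathrm{dist}(1,g_n)/d_n$ bounded, modulo $\lim^\omega \mathrm{dist}(g_n,h_n)/d_n=0$, with metric $\lim^\omega \mathrm{dist}(g_n,h_n)/d_n$. Undistorted subgroups are finitely generated by convention. "Hyperbolic group" means Gromov hyperbolic group. $H$ is a bounded torsion subgroup if for some $n\ge1$, $h^n=1$ for all $h\in H$. For a subgroup $H$ of $G=\langle S\rangle$, $S$ finite, the growth function of $H$ relative to $S$ is $f_{H,G}(n)=\#(\mathrm{Ball}_G(n)\cap H)$, where $\mathrm{Ball}_G(n)$ is the ball of radius $n$ around $1$ in $G$ in the word metric of $S$. $H$ has exponential growth in $G$ if $f_{H,G}(n)$ is bounded from below by $d^n$ for some $d>1$. *)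

theory Defs
  imports "HOL-Analysis.Abstract_Metric_Spaces" "HOL-Algebra.Generated_Groups"
begin

section \<open>Metric notions\<close>

definition geodesic_space :: "'a set \<Rightarrow> ('a \<Rightarrow> 'a \<Rightarrow> real) \<Rightarrow> bool" where
  "geodesic_space M d \<longleftrightarrow> Metric_space M d \<and>
     (\<forall>x\<in>M. \<forall>y\<in>M. \<exists>c. c 0 = x \<and> c (d x y) = y \<and> c ` {0..d x y} \<subseteq> M \<and>
        (\<forall>s\<in>{0..d x y}. \<forall>t\<in>{0..d x y}. d (c s) (c t) = \<bar>s - t\<bar>))"

text \<open>A continuous injective map from a compact interval into a (Hausdorff) metric space
  is automatically an embedding.\<close>

definition arc_between ::
    "'a set \<Rightarrow> ('a \<Rightarrow> 'a \<Rightarrow> real) \<Rightarrow> 'a \<Rightarrow> 'a \<Rightarrow> (real \<Rightarrow> 'a) \<Rightarrow> bool" where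
  "arc_between M d x y p \<longleftrightarrow>
     pathin (Metric_space.mtopology M d) p \<and> inj_on p {0..1} \<and> p 0 = x \<and> p 1 = y"

text \<open>An \<open>\<real>\<close>-tree is a geodesic space in which any two distinct points are joined by a unique
  arc.  Existence of the arc follows from geodesicity; uniqueness is that of its image.\<close>

definition R_tree :: "'a set \<Rightarrow> ('a \<Rightarrow> 'a \<Rightarrow> real) \<Rightarrow> bool" where
  "R_tree M d \<longleftrightarrow> geodesic_space M d \<and>
     (\<forall>x\<in>M. \<forall>y\<in>M. \<forall>p q. arc_between M d x y p \<and> arc_between M d x y q \<longrightarrow>
        p ` {0..1} = q ` {0..1})"

definition Gromov_product :: "('a \<Rightarrow> 'a \<Rightarrow> real) \<Rightarrow> 'a \<Rightarrow> 'a \<Rightarrow> 'a \<Rightarrow> real" where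
  "Gromov_product d w x y = (d x w + d y w - d x y) / 2"

definition Gromov_hyperbolic :: "'a set \<Rightarrow> ('a \<Rightarrow> 'a \<Rightarrow> real) \<Rightarrow> bool" where
  "Gromov_hyperbolic M d \<longleftrightarrow> (\<exists>\<delta>\<ge>0. \<forall>w\<in>M. \<forall>x\<in>M. \<forall>y\<in>M. \<forall>z\<in>M.
     Gromov_product d w x z \<ge> min (Gromov_product d w x y) (Gromov_product d w y z) - \<delta>)"

definition quasi_isometric_embedding ::
    "'a set \<Rightarrow> ('a \<Rightarrow> 'a \<Rightarrow> real) \<Rightarrow> 'b set \<Rightarrow> ('b \<Rightarrow> 'b \<Rightarrow> real) \<Rightarrow> ('a \<Rightarrow> 'b) \<Rightarrow> bool" where
  "quasi_isometric_embedding M d M' d' f \<longleftrightarrow> f ` M \<subseteq> M' \<and>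
     (\<exists>L\<ge>1. \<exists>C\<ge>0. \<forall>x\<in>M. \<forall>y\<in>M.
        d x y / L - C \<le> d' (f x) (f y) \<and> d' (f x) (f y) \<le> L * d x y + C)"

section \<open>Word metrics\<close>

definition finite_generating_set :: "('a, 'b) monoid_scheme \<Rightarrow> 'a set \<Rightarrow> bool" where
  "finite_generating_set G S \<longleftrightarrow> finite S \<and> S \<subseteq> carrier G \<and> generate G S = carrier G"

definition word_length :: "('a, 'b) monoid_scheme \<Rightarrow> 'a set \<Rightarrow> 'a \<Rightarrow> nat" where
  "word_length G S g = (LEAST n. \<exists>ws. length ws = n \<and> set ws \<subseteq> S \<union> m_inv G ` S \<and>
     foldr (mult G) ws \<one>\<^bsub>G\<^esub> = g)"

definition word_dist :: "('a, 'b) monoid_scheme \<Rightarrow> 'a set \<Rightarrow> 'a \<Rightarrow> 'a \<Rightarrow> real" where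
  "word_dist G S g h = real (word_length G S (inv\<^bsub>G\<^esub> g \<otimes>\<^bsub>G\<^esub> h))"

definition hyperbolic_group :: "('a, 'b) monoid_scheme \<Rightarrow> bool" where
  "hyperbolic_group G \<longleftrightarrow> group G \<and>
     (\<exists>S. finite_generating_set G S \<and> Gromov_hyperbolic (carrier G) (word_dist G S))"

section \<open>Asymptotic cones and lacunary hyperbolic groups\<close>

definition nonprincipal_ultrafilter :: "'a filter \<Rightarrow> bool" where
  "nonprincipal_ultrafilter \<omega> \<longleftrightarrow> \<omega> \<noteq> bot \<and>
     (\<forall>P. eventually P \<omega> \<or> eventually (\<lambda>x. \<not> P x) \<omega>) \<and>
     (\<forall>a. \<not> eventually (\<lambda>x. x = a) \<omega>)"

definition scaling_sequence :: "(nat \<Rightarrow> real) \<Rightarrow> bool" where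
  "scaling_sequence d \<longleftrightarrow> (\<forall>n. 0 < d n) \<and> mono d \<and> \<not> bdd_above (range d)"

definition admissible_seqs ::
    "('a, 'b) monoid_scheme \<Rightarrow> 'a set \<Rightarrow> (nat \<Rightarrow> real) \<Rightarrow> (nat \<Rightarrow> 'a) set" where
  "admissible_seqs G S d = {g. (\<forall>n. g n \<in> carrier G) \<and>
     (\<exists>C. \<forall>n. word_dist G S \<one>\<^bsub>G\<^esub> (g n) / d n \<le> C)}"

definition cone_rel :: "('a, 'b) monoid_scheme \<Rightarrow> 'a set \<Rightarrow> nat filter \<Rightarrow> (nat \<Rightarrow> real) \<Rightarrow>
    ((nat \<Rightarrow> 'a) \<times> (nat \<Rightarrow> 'a)) set" where
  "cone_rel G S \<omega> d = {(g, h). g \<in> admissible_seqs G S d \<and> h \<in> admissible_seqs G S d \<and>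
     ((\<lambda>n. word_dist G S (g n) (h n) / d n) \<longlongrightarrow> 0) \<omega>}"

definition asymptotic_cone :: "('a, 'b) monoid_scheme \<Rightarrow> 'a set \<Rightarrow> nat filter \<Rightarrow>
    (nat \<Rightarrow> real) \<Rightarrow> (nat \<Rightarrow> 'a) set set" where
  "asymptotic_cone G S \<omega> d = admissible_seqs G S d // cone_rel G S \<omega> d"

text \<open>The value \<open>0\<close> off the cone is only there because \<^locale>\<open>Metric_space\<close> asks for
  symmetry and nonnegativity outside the carrier as well.\<close>

definition cone_dist :: "('a, 'b) monoid_scheme \<Rightarrow> 'a set \<Rightarrow> nat filter \<Rightarrow> (nat \<Rightarrow> real) \<Rightarrow>
    (nat \<Rightarrow> 'a) set \<Rightarrow> (nat \<Rightarrow> 'a) set \<Rightarrow> real" where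
  "cone_dist G S \<omega> d X Y =
     (if X \<in> asymptotic_cone G S \<omega> d \<and> Y \<in> asymptotic_cone G S \<omega> d
      then THE r. \<exists>g\<in>X. \<exists>h\<in>Y. ((\<lambda>n. word_dist G S (g n) (h n) / d n) \<longlongrightarrow> r) \<omega>
      else 0)"

text \<open>Asymptotic cones with respect to two finite generating sets are bi-Lipschitz equivalent
  geodesic spaces, so the choice of \<open>S\<close> is immaterial here.\<close>

definition lacunary_hyperbolic :: "('a, 'b) monoid_scheme \<Rightarrow> bool" where
  "lacunary_hyperbolic G \<longleftrightarrow> group G \<and>
     (\<exists>S \<omega> d. finite_generating_set G S \<and> nonprincipal_ultrafilter \<omega> \<and> scaling_sequence d \<and>
        R_tree (asymptotic_cone G S \<omega> d) (cone_dist G S \<omega> d))"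

section \<open>Finitely presented groups\<close>

text \<open>The letter \<open>(x, True)\<close> stands for the generator \<open>x\<close> and \<open>(x, False)\<close> for its inverse.
  The free group on \<open>X\<close> consists of the reduced words over \<open>X\<close>.\<close>

fun inverse_letter :: "'x \<times> bool \<Rightarrow> 'x \<times> bool" where
  "inverse_letter (x, b) = (x, \<not> b)"

fun reduced :: "('x \<times> bool) list \<Rightarrow> bool" where
  "reduced (a # b # w) \<longleftrightarrow> b \<noteq> inverse_letter a \<and> reduced (b # w)"
| "reduced _ \<longleftrightarrow> True"

fun reduced_cons :: "'x \<times> bool \<Rightarrow> ('x \<times> bool) list \<Rightarrow> ('x \<times> bool) list" where
  "reduced_cons a [] = [a]"
| "reduced_cons a (b # w) = (if b = inverse_letter a then w else a # b # w)"

definition free_group :: "'x set \<Rightarrow> ('x \<times> bool) list monoid" where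
  "free_group X = \<lparr>carrier = {w \<in> lists (X \<times> UNIV). reduced w},
     mult = foldr reduced_cons, one = []\<rparr>"

definition normal_closure :: "('a, 'b) monoid_scheme \<Rightarrow> 'a set \<Rightarrow> 'a set" where
  "normal_closure G R = \<Inter>{N. N \<lhd> G \<and> R \<subseteq> N}"

text \<open>As the generating set is finite, taking it inside \<^typ>\<open>nat\<close> loses no generality.\<close>

definition finitely_presented :: "('a, 'b) monoid_scheme \<Rightarrow> bool" where
  "finitely_presented G \<longleftrightarrow> group G \<and>
     (\<exists>(X :: nat set) R. finite X \<and> finite R \<and> R \<subseteq> carrier (free_group X) \<and>
        G \<cong> free_group X Mod normal_closure (free_group X) R)"

section \<open>Subgroups\<close>

definition undistorted_subgroup :: "'a set \<Rightarrow> ('a, 'b) monoid_scheme \<Rightarrow> bool" where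
  "undistorted_subgroup H G \<longleftrightarrow> subgroup H G \<and>
     (\<exists>S T. finite_generating_set G S \<and> finite_generating_set (G\<lparr>carrier := H\<rparr>) T \<and>
        quasi_isometric_embedding H (word_dist (G\<lparr>carrier := H\<rparr>) T)
          (carrier G) (word_dist G S) (\<lambda>h. h))"

definition bounded_torsion_subgroup :: "'a set \<Rightarrow> ('a, 'b) monoid_scheme \<Rightarrow> bool" where
  "bounded_torsion_subgroup H G \<longleftrightarrow> subgroup H G \<and>
     (\<exists>n::nat. n \<ge> 1 \<and> (\<forall>h\<in>H. h [^]\<^bsub>G\<^esub> n = \<one>\<^bsub>G\<^esub>))"

definition relative_growth :: "'a set \<Rightarrow> ('a, 'b) monoid_scheme \<Rightarrow> 'a set \<Rightarrow> nat \<Rightarrow> nat" where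
  "relative_growth H G S n =
     card ({g \<in> carrier G. word_dist G S \<one>\<^bsub>G\<^esub> g \<le> real n} \<inter> H)"

text \<open>The lower bound is required for all large \<open>n\<close> only: a bound at \<open>n = 1\<close> would
  depend on whether \<open>H\<close> meets the generating set.\<close>

definition exponential_relative_growth ::
    "'a set \<Rightarrow> ('a, 'b) monoid_scheme \<Rightarrow> 'a set \<Rightarrow> bool" where
  "exponential_relative_growth H G S \<longleftrightarrow>
     (\<exists>d>1. \<forall>\<^sub>F n in sequentially. d ^ n \<le> real (relative_growth H G S n))"

end

(*
  All three parts rest on the same local consequence of having an R-tree as asymptotic cone: for
  every k there are arbitrarily large q such that in G the four point condition holds with error q
  on all balls of radius k q.

  (c) At such a scale an element h with h^n = 1 satisfies |h^2| <= |h| + q, since otherwise the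
  lengths of its powers would increase.  Applying this to g, h and g^-1 h one sees that torsion
  elements g, h of about the same length in a torsion subgroup almost fix a common midpoint p, so
  p^-1 h p has length O(q).  Hence a ball of radius k q contains at most O(k) exp(O(q)) elements
  of the subgroup, and k is arbitrary.

  (a) Instead of quoting a local-to-global theorem for hyperbolicity, a hyperbolic group is built by
  developing G at a scale q exceeding the lengths of the relators of H.  Its elements are words that
  are shortlex minimal among the words with the same end point that stay close to them.  The
  local four point condition shows that close words of this kind are in fact very close, so that
  the letters act on the set of these words, and words of length O(q) that are trivial in G act
  trivially.  The words themselves form a combing of the resulting group by geodesics that fellow
  travel, from which the four point condition follows at all scales.  The relators of H are
  trivial in the new group, so H maps to it, injectively because the new group maps to G.

  (b) The cone of H is a geodesic space, and the inclusion induces an injective Lipschitz map into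
  the cone of G, which carries arcs to arcs.
*)

theory Submission
  imports Defs
begin

section \<open>Local geodesics in locally hyperbolic spaces\<close>

text \<open>The obstacle in (a) is a circle. Normal forms are well defined only if close words with
  the same end point coincide; this needs the normal forms to be local geodesics; and a shortcut
  contradicts minimality only if it can itself be brought into normal form. The circle is broken by
  restricting all three statements to words below a length bound and inducting on that bound. Points
  close in G may be far apart in the new group, so closeness always means closeness of whole paths
  at equal times. Errors would grow with every letter; they stay bounded because hyperbolicity
  improves a rough bound for a pair of paths to a finer one. In effect the new group is given by the
  letters of G and its relations of length O(q). All constants are multiples of q and only the ratio
  N / q has to be large: the estimates use points within about 21000 q of a centre. A cone that is
  an R-tree gives the local condition because failures with error about d_n for all large d_n would
  rescale to four points of the cone that violate the four point condition by 1.\<close>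

locale local_four_point =
  fixes d :: "'p \<Rightarrow> 'p \<Rightarrow> nat" and q N :: nat
  assumes d_self [simp]: "d x x = 0"
    and d_sym: "d x y = d y x"
    and d_tri: "d x z \<le> d x y + d y z"
    and four: "\<lbrakk>d c x \<le> N; d c y \<le> N; d c z \<le> N; d c w \<le> N\<rbrakk> \<Longrightarrow>
      d x y + d z w \<le> d x z + d y w + q \<or> d x y + d z w \<le> d x w + d y z + q"
    and q_pos: "1 \<le> q"
begin

text \<open>The four point condition is applied to \<open>p 0\<close>, \<open>p i\<close>,
  \<open>p (i - h)\<close>, \<open>p (i + h)\<close>. By the induction hypothesis one alternative
  would give \<open>2 * h \<le> 2 * q\<close>; the other is the claim. The error \<open>q\<close>
  does not grow with \<open>i\<close>.\<close>

lemma local_geodesic_step: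
  assumes geo: "\<And>i j. i \<le> j \<Longrightarrow> j \<le> n \<Longrightarrow> j - i \<le> 2 * h \<Longrightarrow> d (p i) (p j) = j - i"
    and h: "2 * q \<le> h" and N: "\<And>i. i \<le> n \<Longrightarrow> d c (p i) \<le> N"
    and "i + h \<le> n"
  shows "d (p 0) (p i) + h \<le> d (p 0) (p (i + h)) + q"
  using \<open>i + h \<le> n\<close>
proof (induction i rule: less_induct)
  case (less i)
  show ?case
  proof (cases "i < h")
    case True
    then show ?thesis using geo[of 0 i] geo[of 0 "i + h"] less.prems by auto
  next
    case False
    define k where "k = i - h"
    have k: "i = k + h" "k < i" using False k_def h q_pos by auto
    have IH: "d (p 0) (p k) + h \<le> d (p 0) (p i) + q"
      using less.IH[of k] k less.prems by auto
    have "d (p k) (p i) = h" "d (p i) (p (i+h)) = h" "d (p k) (p (i+h)) = 2*h"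
      using geo[of k i] geo[of i "i+h"] geo[of k "i+h"] k less.prems by auto
    then show ?thesis
      using four[of c "p 0" "p i" "p k" "p (i+h)"] N less.prems k IH h q_pos
        d_sym[of "p i" "p k"] by auto
  qed
qed

text \<open>A window of \<open>h\<close> steps gains at least \<open>h - q\<close>, hence at least
  half of its length.\<close>

lemma local_geodesic_length:
  assumes geo: "\<And>i j. i \<le> j \<Longrightarrow> j \<le> n \<Longrightarrow> j - i \<le> 2 * h \<Longrightarrow> d (p i) (p j) = j - i"
    and h: "2 * q \<le> h" and N: "\<And>i. i \<le> n \<Longrightarrow> d c (p i) \<le> N"
  shows "n \<le> 2 * d (p 0) (p n)"
proof -
  have "i \<le> n \<Longrightarrow> i \<le> 2 * d (p 0) (p i)" for i
  proof (induction i rule: less_induct)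
    case (less i)
    show ?case
    proof (cases "i < h")
      case True
      then show ?thesis using geo[of 0 i] less.prems by auto
    next
      case False
      define k where "k = i - h"
      have k: "i = k + h" "k < i" using False k_def h q_pos by auto
      show ?thesis
        using less.IH[of k] k local_geodesic_step[of n h p c k, OF geo h N] less.prems h by auto
    qed
  qed
  then show ?thesis by simp
qed

text \<open>\<open>local_geodesic_step\<close>, used also for the reversed path, shows that passing
  from \<open>p i\<close> to \<open>p (i + h)\<close> changes the distances to both ends by at least
  \<open>h - q\<close>. This excludes one alternative for \<open>p 0\<close>, \<open>p i\<close>,
  \<open>p (i + h)\<close>, \<open>p n\<close>, and the other is the claim. Near the end a window to
  the left is used; if \<open>i\<close> is within \<open>h\<close> of both ends, the path is a
  single window.\<close>

lemma local_geodesic_product: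
  assumes geo: "\<And>i j. i \<le> j \<Longrightarrow> j \<le> n \<Longrightarrow> j - i \<le> 2 * h \<Longrightarrow> d (p i) (p j) = j - i"
    and h: "2 * q \<le> h" and N: "\<And>i. i \<le> n \<Longrightarrow> d c (p i) \<le> N" and "i \<le> n"
  shows "d (p 0) (p i) + d (p i) (p n) \<le> d (p 0) (p n) + 2 * q"
proof -
  have geo': "d (p (n - i)) (p (n - j)) = j - i" if "i \<le> j" "j \<le> n" "j - i \<le> 2 * h" for i j
    using that geo[of "n - j" "n - i"] d_sym[of "p (n - i)" "p (n - j)"] by auto
  have N': "d c (p (n - i)) \<le> N" for i using N[of "n - i"] by auto
  have rstep: "d (p n) (p (i + h)) + h \<le> d (p n) (p i) + q" if "i + h \<le> n" for i
  proof -
    have "n - (n - (i + h)) = i + h" "n - (n - i) = i" "n - (i + h) + h = n - i" using that by auto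
    then show ?thesis
    using local_geodesic_step[of n h "\<lambda>i. p (n - i)" c "n - (i + h)", OF geo' h N'] that
    by (auto simp only: diff_zero)
  qed
  have fstep: "d (p 0) (p i) + h \<le> d (p 0) (p (i + h)) + q" if "i + h \<le> n" for i
    using local_geodesic_step[OF geo h N that] .
  consider "i + h \<le> n" | "h \<le> i" | "n < i + h" "i < h" by linarith
  then show ?thesis
  proof cases
    case 1
    show ?thesis
      using four[of c "p 0" "p (i+h)" "p i" "p n"] N 1 fstep[of i] rstep[of i] h q_pos geo[of i "i+h"]
        d_sym[of "p i" "p n"] d_sym[of "p n" "p (i+h)"] d_sym[of "p (i+h)" "p i"] by auto
  next
    case 2
    define k where "k = i - h"
    have k: "i = k + h" using 2 k_def by auto
    show ?thesis
      using four[of c "p n" "p k" "p i" "p 0"] N k fstep[of k] rstep[of k] h q_pos geo[of k i] \<open>i \<le> n\<close>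
        d_sym[of "p i" "p n"] d_sym[of "p n" "p k"] d_sym[of "p 0" "p i"] d_sym[of "p 0" "p n"] 
        d_sym[of "p 0" "p k"] d_sym[of "p i" "p k"] by auto
  next
    case 3
    then show ?thesis using geo[of 0 i] geo[of i n] geo[of 0 n] \<open>i \<le> n\<close> by auto
  qed
qed

text \<open>The Gromov product of \<open>a\<close> and \<open>b\<close> at \<open>p\<close> is at
  most \<open>c / 2\<close>. As \<open>a'\<close> is closer to \<open>a\<close> than
  \<open>p\<close> is, by \<open>c\<close>, the paths from \<open>a\<close> and \<open>a'\<close>
  reach \<open>p\<close> from the same side, so \<open>a'\<close> may replace \<open>a\<close> at
  the cost of \<open>q\<close>.\<close>

lemma perturb_endpoint:
  assumes ab: "d a p + d p b \<le> d a b + c" and far: "d a a' + c \<le> d a p"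
    and N: "d p a \<le> N" "d p b \<le> N" "d p a' \<le> N" and "q < c"
  shows "d a' p + d p b \<le> d a' b + c + q"
proof -
  have "d p p \<le> N" by simp
  from four[OF N(1,2,3) this]
  have "d a b + d a' p \<le> d a a' + d b p + q \<or> d a b + d a' p \<le> d a p + d b a' + q" .
  moreover have "d a p \<le> d a a' + d a' p" by (rule d_tri)
  ultimately show ?thesis using assms d_sym[of b p] d_sym[of b a'] by linarith
qed

lemma discrete_intermediate_value:
  fixes f :: "nat \<Rightarrow> nat"
  assumes "\<And>i. i < n \<Longrightarrow> f (Suc i) \<le> f i + 1" "f 0 \<le> r" "r \<le> f n"
  shows "\<exists>j\<le>n. f j = r"
  using assms
proof (induction n)
  case (Suc n)
  show ?case
  proof (cases "r \<le> f n")
    case True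
    then show ?thesis using Suc.IH Suc.prems le_SucI by (metis less_SucI)
  next
    case False
    then have "f (Suc n) = r" using Suc.prems(1)[of n] Suc.prems(3) by auto
    then show ?thesis by auto
  qed
qed auto

text \<open>Compare \<open>x\<close> with the point \<open>p j\<close> at the same distance from
  \<open>p 0\<close>. The defects \<open>4 * q\<close> of \<open>x\<close> and \<open>2 * q\<close>
  of \<open>p j\<close> bound the two alternatives by \<open>5 * q\<close> and
  \<open>3 * q\<close>.\<close>

lemma near_local_geodesic:
  assumes geo: "\<And>i j. i \<le> j \<Longrightarrow> j \<le> n \<Longrightarrow> j - i \<le> 2 * h \<Longrightarrow> d (p i) (p j) = j - i"
    and h: "2 * q \<le> h" and N: "\<And>i. i \<le> n \<Longrightarrow> d x (p i) \<le> N"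
    and x: "d (p 0) x + d x (p n) \<le> d (p 0) (p n) + 4 * q"
  shows "\<exists>j\<le>n. d x (p j) \<le> 5 * q"
proof (cases "d (p 0) (p n) \<le> d (p 0) x")
  case True
  then show ?thesis using x by (intro exI[of _ n]) auto
next
  case False
  have "d (p 0) (p (Suc i)) \<le> d (p 0) (p i) + 1" if "i < n" for i
    using d_tri[of "p 0" "p (Suc i)" "p i"] geo[of i "Suc i"] that h q_pos by auto
  then obtain j where j: "j \<le> n" "d (p 0) (p j) = d (p 0) x"
    using discrete_intermediate_value[of n "\<lambda>i. d (p 0) (p i)" "d (p 0) x"] False by auto
  have pr: "d (p 0) (p j) + d (p j) (p n) \<le> d (p 0) (p n) + 2 * q"
    using local_geodesic_product[OF geo h N j(1)] by auto
  have "d x x \<le> N" by simp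
  from four[OF this N[OF j(1)] N[of 0] N[of n]]
  have "d x (p j) + d (p 0) (p n) \<le> d x (p 0) + d (p j) (p n) + q \<or>
        d x (p j) + d (p 0) (p n) \<le> d x (p n) + d (p j) (p 0) + q" by simp
  then have "d x (p j) \<le> 5 * q"
    using pr x j(2) d_sym[of x "p 0"] d_sym[of "p j" "p 0"] by linarith
  then show ?thesis using j(1) by auto
qed

end

section \<open>A development of a locally hyperbolic group\<close>

text \<open>Words stand for elements of a group: \<open>D u v\<close> is the distance between the end points of the paths
  from \<open>1\<close> labelled \<open>u\<close> and \<open>v\<close>, so that no carrier sets occur; it is only a pseudometric on words.\<close>

locale local_hyperbolic_words = local_four_point D q N
  for D :: "nat list \<Rightarrow> nat list \<Rightarrow> nat" and q N :: nat +
  assumes D_snoc: "D u (u @ [s]) \<le> 1"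
    and geodesic_word: "\<exists>g. length g = D u v \<and> D (u @ g) v = 0"
    and D_left: "D (w @ u) (w @ v) = D u v"
    and D_right: "D u v = 0 \<Longrightarrow> D (u @ g) (v @ g) = 0"
    and inverse_word: "\<exists>s'. D [s, s'] [] = 0"
    and N_large: "100000 * q \<le> N"
begin

section \<open>Words as paths, and fellow travelling\<close>

lemma D_zero_cong: "D u v = 0 \<Longrightarrow> D u x = D v x" "D u v = 0 \<Longrightarrow> D x u = D x v"
  using d_tri[of u x v] d_tri[of v x u] d_sym[of u v] d_sym[of x u] d_sym[of x v] by auto

lemma D_zero_trans: "D u v = 0 \<Longrightarrow> D v w = 0 \<Longrightarrow> D u w = 0"
  using d_tri[of u w v] by auto

lemma D_append: "D u (u @ g) \<le> length g"
proof (induction g rule: rev_induct)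
  case (snoc s g)
  then show ?case using d_tri[of u "u @ g @ [s]" "u @ g"] D_snoc[of "u @ g" s] by auto
qed auto

lemma D_take: "i \<le> j \<Longrightarrow> D (take i w) (take j w) \<le> j - i"
  using D_append[of "take i w" "take (j - i) (drop i w)"]
  by (metis (no_types, lifting) le_add_diff_inverse length_take min.cobounded2 order_trans take_add)

text \<open>As \<open>take t u = u\<close> for \<open>t \<ge> length u\<close>, a path waits at its end point; words of different lengths
  are compared in this way.\<close>

definition fellow :: "nat \<Rightarrow> nat list \<Rightarrow> nat list \<Rightarrow> bool" where
  "fellow k u v \<longleftrightarrow> (\<forall>t. D (take t u) (take t v) \<le> k)"

lemma fellow_refl [simp]: "fellow k u u" by (simp add: fellow_def)

lemma fellow_sym: "fellow k u v \<Longrightarrow> fellow k v u"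
  by (simp add: fellow_def d_sym)

lemma fellow_mono: "fellow k u v \<Longrightarrow> k \<le> l \<Longrightarrow> fellow l u v"
  unfolding fellow_def using order_trans by blast

lemma fellow_trans: "fellow k u v \<Longrightarrow> fellow l v w \<Longrightarrow> fellow (k + l) u w"
  unfolding fellow_def by (meson add_mono d_tri order_trans)

lemma fellow_end: "fellow k u v \<Longrightarrow> D u v \<le> k"
  unfolding fellow_def by (metis nle_le take_all)

lemma fellow_prefixes: "i \<le> j \<Longrightarrow> fellow (j - i) (take i w) (take j w)"
  unfolding fellow_def
proof
  fix t assume "i \<le> j"
  then have "D (take (min t i) w) (take (min t j) w) \<le> min t j - min t i"
    by (intro D_take) auto
  then show "D (take t (take i w)) (take t (take j w)) \<le> j - i" by (auto simp: min_def split: if_splits)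
qed

lemma fellow_snoc: "fellow 1 u (u @ [s])"
  using fellow_prefixes[of "length u" "Suc (length u)" "u @ [s]"] by simp

text \<open>The words that represent the points of the development.  The competitors \<open>v\<close> of \<open>w\<close> are required to
  be in \<open>Lam\<close> themselves (hence the recursion along \<open>lenlex\<close>): if \<open>u \<in> Lam\<close> but \<open>u @ [s] \<notin> Lam\<close> there
  is then, by definition, a word in \<open>Lam\<close> close to \<open>u @ [s]\<close> with the same end point.  What needs
  proof is that it is unique.\<close>

definition Lam :: "nat list set" where
  "Lam = {w. wfrec (lenlex less_than) (\<lambda>L w. (w = [] \<or> L (butlast w)) \<and>
     \<not> (\<exists>v. (v, w) \<in> lenlex less_than \<and> fellow (600 * q) v w \<and> D v w = 0 \<and> L v)) w}"

lemma butlast_lenlex: "w \<noteq> [] \<Longrightarrow> (butlast w, w) \<in> lenlex less_than"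
  by (auto simp: lenlex_conv)

text \<open>The prefix and the competitors precede \<open>w\<close> in \<open>lenlex\<close>, so the
  truncation made by \<open>wfrec\<close> has no effect.\<close>

lemma Lam_iff:
  "w \<in> Lam \<longleftrightarrow> (w = [] \<or> butlast w \<in> Lam) \<and>
     (\<forall>v\<in>Lam. (v, w) \<in> lenlex less_than \<longrightarrow> fellow (600 * q) v w \<longrightarrow> D v w \<noteq> 0)"
proof -
  have "wf (lenlex less_than)" by (rule wf_lenlex[OF wf_less_than])
  then show ?thesis
    unfolding Lam_def mem_Collect_eq
    by (subst wfrec; cases "w = []") (auto simp: cut_apply[OF butlast_lenlex] cut_apply)
qed

lemma Nil_Lam: "[] \<in> Lam"
  by (subst Lam_iff) (auto simp: Nil_lenlex_iff1)

lemma Lam_take: "w \<in> Lam \<Longrightarrow> take t w \<in> Lam"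
proof (induction w rule: rev_induct)
  case (snoc s w)
  then have "w \<in> Lam" using Lam_iff[of "w @ [s]"] by simp
  then show ?case using snoc by (cases "t \<le> length w") auto
qed (simp add: Nil_Lam)

lemma Lam_minimal:
  "w \<in> Lam \<Longrightarrow> v \<in> Lam \<Longrightarrow> fellow (600 * q) v w \<Longrightarrow> D v w = 0 \<Longrightarrow> length w \<le> length v"
  using Lam_iff[of w] by (auto simp: lenlex_conv not_less[symmetric])

lemma Lam_unique:
  assumes "w \<in> Lam" "v \<in> Lam" "fellow (600 * q) v w" "D v w = 0"
  shows "v = w"
proof -
  have "(v, w) \<notin> lenlex less_than" using Lam_iff[of w] assms by auto
  moreover have "(w, v) \<notin> lenlex less_than"
    using Lam_iff[of v] assms fellow_sym[of _ v w] d_sym[of v w] by auto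
  moreover have "total (lenlex less_than)" by (simp add: total_lenlex total_less_than)
  ultimately show ?thesis by (auto simp: total_on_def)
qed

lemma Lam_snoc_cases:
  assumes "u \<in> Lam"
  shows "\<exists>v\<in>Lam. D v (u @ [s]) = 0 \<and> fellow (600 * q) v (u @ [s]) \<and> length v \<le> Suc (length u)"
proof (cases "u @ [s] \<in> Lam")
  case True
  then show ?thesis by (intro bexI[of _ "u @ [s]"]) auto
next
  case False
  then show ?thesis using Lam_iff[of "u @ [s]"] assms by (auto simp: lenlex_conv)
qed

text \<open>The improvement of a rough bound on the distance of two words in \<open>Lam\<close>, proved by induction on the
  length bound \<open>R\<close>.  All constants are multiples of \<open>q\<close>: short words have length at most \<open>60 q\<close>,
  the improved bound for end points at distance \<open>60 q\<close> is \<open>8 * 60 q + 48 q = 528 q\<close>, the tolerance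
  \<open>600 q\<close> in \<open>Lam\<close> exceeds it by at least \<open>60 q\<close>, and the rough bound \<open>1200 q\<close> exceeds their sum.\<close>

definition closing :: "nat \<Rightarrow> bool" where
  "closing R \<longleftrightarrow> (\<forall>u\<in>Lam. \<forall>v\<in>Lam. length u < R \<longrightarrow> length v < R \<longrightarrow> fellow (1200 * q) u v \<longrightarrow>
     D u v \<le> 60 * q \<longrightarrow> fellow (8 * D u v + 48 * q) u v)"

text \<open>\<open>g\<close> is read letter by letter. A letter costs at most
  \<open>600 * q + 1\<close>, which together with the \<open>528 * q\<close> accumulated before
  stays below \<open>1200 * q\<close>; as the end points are within \<open>60 * q\<close>,
  \<open>closing\<close> resets the bound to \<open>528 * q\<close>. So the error does not grow with
  the length of \<open>g\<close>.\<close>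

lemma closing_extend:
  assumes "closing R" "u \<in> Lam" "length g \<le> 60 * q" "length u + length g < R"
  shows "\<exists>p\<in>Lam. D p (u @ g) = 0 \<and> fellow (528 * q) u p \<and> length p \<le> length u + length g"
  using assms(3,4)
proof (induction g rule: rev_induct)
  case Nil
  then show ?case using assms by (intro bexI[of _ u]) auto
next
  case (snoc s g)
  then obtain p where p: "p \<in> Lam" "D p (u @ g) = 0" "fellow (528 * q) u p"
    "length p \<le> length u + length g" by auto
  obtain v where v: "v \<in> Lam" "D v (p @ [s]) = 0" "fellow (600 * q) v (p @ [s])"
    "length v \<le> Suc (length p)" using Lam_snoc_cases[OF p(1)] by blast
  have "fellow (528 * q + 1 + 600 * q) u v"
    using fellow_trans[OF fellow_trans[OF p(3) fellow_snoc] fellow_sym[OF v(3)]] .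
  then have F: "fellow (1200 * q) u v" by (rule fellow_mono) (use q_pos in auto)
  have v0: "D v (u @ g @ [s]) = 0"
    using D_zero_trans[OF v(2) D_right[OF p(2), of "[s]"]] by simp
  then have Duv: "D u v \<le> 60 * q"
    using D_append[of u "g @ [s]"] D_zero_cong(2)[OF v0, of u] snoc.prems by simp
  have "fellow (8 * D u v + 48 * q) u v"
    using assms(1,2) v(1,4) p(4) snoc.prems F Duv unfolding closing_def by auto
  then have "fellow (528 * q) u v" by (rule fellow_mono) (use Duv in auto)
  then show ?case using v v0 p(4) by (intro bexI[of _ v]) auto
qed

text \<open>A shorter path between the two prefixes could be followed inside \<open>Lam\<close> by
  \<open>closing_extend\<close>. The result would be shorter than \<open>take j w\<close>, with the
  same end point and within \<open>528 * q + 60 * q\<close> of it at all times, against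
  minimality.\<close>

lemma closing_local_geodesic:
  assumes "closing R" "w \<in> Lam" "length w \<le> R" "i \<le> j" "j \<le> length w" "j - i \<le> 60 * q"
  shows "D (take i w) (take j w) = j - i"
proof (rule ccontr)
  assume "\<not> ?thesis"
  then have less: "D (take i w) (take j w) < j - i" using D_take[OF assms(4), of w] by auto
  obtain g where g: "length g = D (take i w) (take j w)" "D (take i w @ g) (take j w) = 0"
    using geodesic_word by blast
  \<comment> \<open>The shortcut ends strictly before length \<open>j \<le> R\<close>. So
    \<open>closing R\<close>, which speaks of words shorter than \<open>R\<close>, also controls a
    word \<open>w\<close> of length \<open>R\<close>; this is the gain that drives the induction on
    \<open>R\<close>.\<close>
  have "length g \<le> 60 * q" "length (take i w) + length g < R" "length (take i w) = i"
    using less g(1) assms by auto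
  then obtain p where p: "p \<in> Lam" "D p (take i w @ g) = 0" "fellow (528 * q) (take i w) p"
    "length p \<le> i + length g"
    using closing_extend[OF assms(1) Lam_take[OF assms(2)]] by metis
  have "fellow (528 * q + (j - i)) p (take j w)"
    using fellow_trans[OF fellow_sym[OF p(3)] fellow_prefixes[OF assms(4)]] .
  then have "fellow (600 * q) p (take j w)" by (rule fellow_mono) (use assms(6) in auto)
  then have "length (take j w) \<le> length p"
    using Lam_minimal[OF Lam_take[OF assms(2)] p(1)] D_zero_trans[OF p(2) g(2)] by blast
  then show False using p(4) less g(1) assms(5) by auto
qed

text \<open>Subpaths are local geodesics at the scale \<open>60 * q\<close>, so the local theory
  applies with \<open>h = 30 * q\<close>. The bound \<open>N\<close> on their length puts them into
  a ball where the four point condition is available, wherever in the word they lie.\<close>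

lemma closing_window:
  assumes "closing R" "w \<in> Lam" "length w \<le> R" "i \<le> j" "j \<le> length w" "j - i \<le> N"
  shows closing_window_length: "j - i \<le> 2 * D (take i w) (take j w)"
    and closing_window_product: "\<And>k. i \<le> k \<Longrightarrow> k \<le> j \<Longrightarrow>
      D (take i w) (take k w) + D (take k w) (take j w) \<le> D (take i w) (take j w) + 2 * q"
    and closing_window_near: "\<And>x. (\<And>k. i \<le> k \<Longrightarrow> k \<le> j \<Longrightarrow> D x (take k w) \<le> N) \<Longrightarrow>
      D (take i w) x + D x (take j w) \<le> D (take i w) (take j w) + 4 * q \<Longrightarrow>
      \<exists>k. i \<le> k \<and> k \<le> j \<and> D x (take k w) \<le> 5 * q"
proof -
  define p where "p k = take (i + k) w" for k
  have geo: "D (p a) (p b) = b - a" if "a \<le> b" "b \<le> j - i" "b - a \<le> 2 * (30 * q)" for a b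
    using closing_local_geodesic[OF assms(1-3), of "i + a" "i + b"] that assms by (auto simp: p_def)
  have h: "2 * q \<le> 30 * q" by simp
  have N: "D (p 0) (p a) \<le> N" if "a \<le> j - i" for a
    using D_take[of i "i + a" w] that assms unfolding p_def by simp
  have e: "p 0 = take i w" "p (j - i) = take j w" using assms by (auto simp: p_def)
  show "j - i \<le> 2 * D (take i w) (take j w)"
    using local_geodesic_length[of "j - i" "30 * q" p "p 0", OF geo h N] e by simp
  show "D (take i w) (take k w) + D (take k w) (take j w) \<le> D (take i w) (take j w) + 2 * q"
    if "i \<le> k" "k \<le> j" for k
  proof -
    have "p (k - i) = take k w" using that by (simp add: p_def)
    then show ?thesis
      using local_geodesic_product[of "j - i" "30 * q" p "p 0" "k - i", OF geo h N] e that by simp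
  qed
  show "\<exists>k. i \<le> k \<and> k \<le> j \<and> D x (take k w) \<le> 5 * q"
    if x: "\<And>k. i \<le> k \<Longrightarrow> k \<le> j \<Longrightarrow> D x (take k w) \<le> N"
      "D (take i w) x + D x (take j w) \<le> D (take i w) (take j w) + 4 * q" for x
  proof -
    have "D x (p k) \<le> N" if "k \<le> j - i" for k
      using x(1)[of "i + k"] that assms by (auto simp: p_def)
    then have "\<exists>k\<le>j - i. D x (p k) \<le> 5 * q"
      using near_local_geodesic[of "j - i" "30 * q" p x, OF geo h] e x(2) by simp
    then obtain k where "k \<le> j - i" "D x (p k) \<le> 5 * q" by blast
    then show ?thesis using assms by (intro exI[of _ "i + k"]) (auto simp: p_def)
  qed
qed

text \<open>Otherwise \<open>take t u\<close>, continued along a geodesic to the end point of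
  \<open>take j v\<close>, would give a shorter competitor. The constant \<open>72 * q\<close> is
  what the drift \<open>528 * q\<close> of \<open>closing_extend\<close> leaves of the tolerance
  \<open>600 * q\<close>.\<close>

lemma closing_catch_up:
  assumes "closing R" "u \<in> Lam" "v \<in> Lam" "t \<le> length u" "j \<le> length v" "j \<le> R"
    "fellow (72 * q) (take t u) (take j v)" "D (take t u) (take j v) \<le> 60 * q"
  shows "j \<le> t + D (take t u) (take j v)"
proof (rule ccontr)
  assume less: "\<not> ?thesis"
  obtain g where g: "length g = D (take t u) (take j v)" "D (take t u @ g) (take j v) = 0"
    using geodesic_word by blast
  have "length g \<le> 60 * q" "length (take t u) + length g < R" "length (take t u) = t"
    using less g(1) assms by auto
  then obtain p where p: "p \<in> Lam" "D p (take t u @ g) = 0" "fellow (528 * q) (take t u) p"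
    "length p \<le> t + length g"
    using closing_extend[OF assms(1) Lam_take[OF assms(2)]] by metis
  have "fellow (528 * q + 72 * q) p (take j v)"
    using fellow_trans[OF fellow_sym[OF p(3)] assms(7)] .
  then have "fellow (600 * q) p (take j v)" by simp
  then have "length (take j v) \<le> length p"
    using Lam_minimal[OF Lam_take[OF assms(3)] p(1)] D_zero_trans[OF p(2) g(2)] by blast
  then show False using p(4) less g(1) assms(5) by auto
qed

text \<open>By hyperbolicity some \<open>take j v\<close> is within \<open>5 q\<close> of \<open>take t u\<close>.  The shift \<open>\<bar>j - t\<bar>\<close> cannot exceed
  \<open>5 q\<close>, because switching from the path that is behind to the one that is ahead would give a shorter
  competitor in \<open>Lam\<close>.  This competitor stays close only because \<open>u\<close> and \<open>v\<close> are already known to be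
  \<open>10 q\<close>-close before time \<open>t\<close>.\<close>

lemma closing_synchronous_step:
  assumes R: "closing R" and u: "u \<in> Lam" "length u \<le> R" and v: "v \<in> Lam" "length v \<le> R"
    and t: "t \<le> length u" "t \<le> length v"
    and close: "\<And>s. s < t \<Longrightarrow> D (take s u) (take s v) \<le> 10 * q"
    and iu: "t \<le> iu" "iu \<le> length u" "iu - t \<le> 20000 * q"
    and iv: "t \<le> iv" "iv \<le> length v" "iv - t \<le> 20000 * q"
    and far: "D (take iu u) (take iv v) + 3 * q \<le> D (take t u) (take iu u)"
  shows "D (take t u) (take t v) \<le> 10 * q"
proof -
  define x where "x = take t u"
  \<comment> \<open>At \<open>12 * q\<close> steps back the paths are \<open>10 * q\<close>-close,
    which leaves the margin \<open>2 * q\<close> required by \<open>perturb_endpoint\<close>. For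
    \<open>t < 12 * q\<close> both paths are traced back to \<open>[]\<close>, where
    \<open>a\<close> and \<open>a'\<close> coincide.\<close>
  define l where "l = min t (12 * q)"
  have l: "l \<le> t" "l \<le> 12 * q" by (auto simp: l_def)
  have xv: "D x (take t v) \<le> 10 * q + 2"
  proof (cases t)
    case (Suc s)
    have "D (take s u) (take s v) \<le> 10 * q" using close[of s] Suc by auto
    moreover have "D (take s u) x \<le> 1" using D_take[of s t u] Suc by (simp add: x_def)
    moreover have "D (take s v) (take t v) \<le> 1" using D_take[of s t v] Suc by simp
    ultimately show ?thesis
      using d_tri[of x "take t v" "take s u"] d_tri[of "take s u" "take t v" "take s v"]
        d_sym[of x "take s u"] by linarith
  qed (simp add: x_def)
  show ?thesis
  proof (cases "t < 2 * q")
    case True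
    then show ?thesis
      using D_take[of 0 t u] D_take[of 0 t v] d_tri[of "take t u" "take t v" "[]"]
        d_sym[of "take t u" "[]"] by (simp add: x_def)
  next
    case False
    define a a' where "a = take (t - l) u" and "a' = take (t - l) v"
    define b b' where "b = take iu u" and "b' = take iv v"
    have aa': "D a a' + 2 * q \<le> D a x"
    proof -
      have "D a x = l"
        using closing_local_geodesic[OF R u, of "t - l" t] t l q_pos by (simp add: a_def x_def)
      moreover have "D a a' \<le> 10 * q" if "12 * q \<le> t"
        using close[of "t - l"] that q_pos by (auto simp: l_def a_def a'_def)
      moreover have "D a a' = 0" if "t < 12 * q"
        using that by (simp add: l_def a_def a'_def)
      ultimately show ?thesis using False by (cases "12 * q \<le> t") (auto simp: l_def)
    qed
    have "D a x + D x b \<le> D a b + 2 * q"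
      unfolding a_def x_def b_def
      by (rule closing_window_product[OF R u]) (use iu l N_large in auto)
    \<comment> \<open>Exchanging \<open>a\<close> for \<open>a'\<close> and then \<open>b\<close>
      for \<open>b'\<close> raises the defect at \<open>x\<close> from \<open>2 * q\<close> to
      \<open>4 * q\<close>, the tolerance of \<open>closing_window_near\<close>.\<close>
    note 1 = perturb_endpoint[OF this aa']
    have Dxa: "D x a \<le> 12 * q" "D x b \<le> 20000 * q" 
      using D_take[of "t - l" t u] D_take[of t iu u] iu l d_sym[of x a]
      by (auto simp: a_def x_def b_def)
    have Dxv: "D x (take k v) \<le> 21000 * q" if "t - l \<le> k" "k \<le> iv" for k
    proof (cases "k \<le> t")
      case True
      then have "D (take t v) (take k v) \<le> 12 * q"
        using D_take[of k t v] d_sym[of "take t v" "take k v"] that l by simp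
      then show ?thesis using d_tri[of x "take k v" "take t v"] xv q_pos by linarith
    next
      case False
      then have "D (take t v) (take k v) \<le> 20000 * q"
        using D_take[of t k v] that iv by simp
      then show ?thesis using d_tri[of x "take k v" "take t v"] xv q_pos by linarith
    qed
    have Dxa': "D x a' \<le> 21000 * q" "D x b' \<le> 21000 * q"
      using Dxv[of "t - l"] Dxv[of iv] iv(1) l by (auto simp: a'_def b'_def)
    have "D a' x + D x b \<le> D a' b + 2 * q + q" using 1 Dxa Dxa' N_large q_pos by linarith
    then have "D b x + D x a' \<le> D b a' + 3 * q" using d_sym by (simp add: d_sym)
    note 2 = perturb_endpoint[OF this, of b']
    have "D b b' + 3 * q \<le> D b x" using far by (simp add: b_def b'_def x_def d_sym)
    then have "D b' x + D x a' \<le> D b' a' + 3 * q + q" using 2 Dxa Dxa' N_large q_pos by linarith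
    then have "D a' x + D x b' \<le> D a' b' + 4 * q" by (simp add: d_sym)
    then obtain j where j: "t - l \<le> j" "j \<le> iv" "D x (take j v) \<le> 5 * q"
      using closing_window_near[OF R v, of "t - l" iv x] iv l N_large Dxv
      by (force simp: a'_def b'_def)
    show ?thesis
    proof (cases "t \<le> j")
      case True
      have "j - t \<le> 2 * D (take t v) (take j v)"
        by (rule closing_window_length[OF R v]) (use True j iv N_large in auto)
      moreover have "D (take t v) (take j v) \<le> D (take t v) x + D x (take j v)" by (rule d_tri)
      ultimately have jt: "j - t \<le> 34 * q" using xv j(3) q_pos d_sym[of "take t v" x] by linarith
      have "fellow (10 * q + 2) (take t u) (take t v)"
        unfolding fellow_def
      proof
        fix s show "D (take s (take t u)) (take s (take t v)) \<le> 10 * q + 2"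
          using close[of s] xv by (cases "s < t") (auto simp: x_def)
      qed
      from fellow_trans[OF this fellow_prefixes[OF True]]
      have "fellow (72 * q) (take t u) (take j v)"
        by (rule fellow_mono) (use jt q_pos in linarith)
      then have "j \<le> t + D x (take j v)"
        unfolding x_def
        by (intro closing_catch_up[OF R u(1) v(1) t(1)]) (use j iv v x_def in auto)
      then have "D (take t v) (take j v) \<le> 5 * q" using D_take[OF True, of v] j(3) by linarith
      then show ?thesis
        using d_tri[of x "take t v" "take j v"] j(3) d_sym[of "take j v" "take t v"]
        by (simp add: x_def)
    next
      case False
      have "fellow (10 * q) (take j v) (take j u)"
        unfolding fellow_def
      proof
        fix s show "D (take s (take j v)) (take s (take j u)) \<le> 10 * q"
          using close[of "min s j"] False d_sym[of "take (min s j) v" "take (min s j) u"] by auto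
      qed
      from fellow_trans[OF this fellow_prefixes[of j t]] False
      have "fellow (10 * q + (t - j)) (take j v) (take t u)" by simp
      then have "fellow (72 * q) (take j v) (take t u)"
        by (rule fellow_mono) (use j l in linarith)
      then have "t \<le> j + D (take j v) x"
        unfolding x_def
        by (intro closing_catch_up[OF R v(1) u(1)])
          (use j t iv u d_sym[of "take j v" x] x_def in auto)
      then have "D (take t v) (take j v) \<le> 5 * q"
        using D_take[of j t v] False j(3) d_sym[of "take j v"] by (metis (no_types, lifting) diff_le_mono le_trans linorder_le_cases add_diff_cancel_left')
      then show ?thesis
        using d_tri[of x "take t v" "take j v"] j(3) d_sym[of "take j v" "take t v"]
        by (simp add: x_def)
    qed
  qed
qed

text \<open>After its end \<open>u\<close> waits, so the rest of \<open>v\<close> stays within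
  \<open>1200 * q\<close> of one point and has diameter at most \<open>2400 * q\<close>. A subpath
  of length \<open>4801 * q\<close> would have end points farther apart than that.\<close>

lemma closing_length_diff:
  assumes R: "closing R" and v: "v \<in> Lam" "length v \<le> R" and "fellow (1200 * q) u v"
  shows "length v \<le> length u + 4801 * q"
proof (rule ccontr)
  assume *: "\<not> ?thesis"
  define s where "s = length u + 4801 * q"
  have s: "s \<le> length v" "length u \<le> s" using * by (auto simp: s_def)
  have c: "D u (take t v) \<le> 1200 * q" if "length u \<le> t" for t
    using assms(4) that unfolding fellow_def by (metis take_all)
  have "4801 * q \<le> 2 * D (take (length u) v) (take s v)"
    using closing_window_length[OF R v, of "length u" s] s N_large by (simp add: s_def)
  then show False
    using c[of "length u"] c[OF s(2)] d_tri[of "take (length u) v" "take s v" u] q_pos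
      d_sym[of u "take (length u) v"] by simp
qed

text \<open>\<open>closing_synchronous_step\<close> needs points ahead of \<open>t\<close> that are
  closer to each other, by \<open>3 * q\<close>, than the one on \<open>u\<close> is to
  \<open>take t u\<close>. Away from the ends \<open>2406 * q\<close> steps suffice: they cover at
  least \<open>1203 * q\<close>, against the rough bound \<open>1200 * q\<close>. Otherwise the end
  points serve, as \<open>2 * (D u v + 3 * q)\<close> steps cover at least
  \<open>D u v + 3 * q\<close>.\<close>

lemma closing_deep:
  assumes R: "closing R" and u: "u \<in> Lam" "length u \<le> R" and v: "v \<in> Lam" "length v \<le> R"
    and uv: "fellow (1200 * q) u v" "D u v \<le> 60 * q"
    and "t + 2 * (D u v + 3 * q) \<le> length u" "t \<le> length v"
  shows "D (take t u) (take t v) \<le> 10 * q"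
  using assms(8,9)
proof (induction t rule: less_induct)
  case (less t)
  have close: "D (take s u) (take s v) \<le> 10 * q" if "s < t" for s
    using less that by auto
  have lv: "length v \<le> length u + 4801 * q" "length u \<le> length v + 4801 * q"
    using closing_length_diff[OF R v uv(1)] closing_length_diff[OF R u fellow_sym[OF uv(1)]] by auto
  show ?case
  proof (cases "t + 2406 * q \<le> length u \<and> t + 2406 * q \<le> length v")
    case True
    define i where "i = t + 2406 * q"
    have "D (take i u) (take i v) \<le> 1200 * q" using uv(1) by (simp add: fellow_def)
    moreover have "2406 * q \<le> 2 * D (take t u) (take i u)"
      using closing_window_length[OF R u, of t i] True N_large by (simp add: i_def)
    ultimately show ?thesis
      by (intro closing_synchronous_step[OF R u v _ _ close, of t i i]) (use True i_def in auto)
  next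
    case False
    have "length u - t \<le> 2 * D (take t u) (take (length u) u)"
      by (rule closing_window_length[OF R u]) (use less.prems False lv N_large in auto)
    then show ?thesis
      by (intro closing_synchronous_step[OF R u v _ _ close, of t "length u" "length v"])
        (use less.prems False lv in auto)
  qed
qed

text \<open>Up to \<open>t1\<close> the paths are \<open>10 * q\<close>-close. Beyond it
  \<open>u\<close> has at most \<open>2 * D u v + 6 * q\<close> steps, so \<open>take t1 v\<close>
  is within \<open>3 * D u v + 16 * q\<close> of the end of \<open>v\<close>, and \<open>v\<close>
  has at most twice that many steps left. Adding up gives \<open>8 * D u v + 48 * q\<close>.\<close>

lemma closing_fellow:
  assumes R: "closing R" and u: "u \<in> Lam" "length u \<le> R" and v: "v \<in> Lam" "length v \<le> R"
    and uv: "fellow (1200 * q) u v" "D u v \<le> 60 * q" and le: "length u \<le> length v"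
  shows "fellow (8 * D u v + 48 * q) u v"
proof -
  define t1 where "t1 = length u - 2 * (D u v + 3 * q)"
  have t1: "D (take t u) (take t v) \<le> 10 * q" if "t \<le> t1" for t
  proof (cases "2 * (D u v + 3 * q) \<le> length u")
    case True
    then show ?thesis
      using closing_deep[OF R u v uv, of t] that le by (auto simp: t1_def)
  qed (use that t1_def in simp)
  have len: "length v - t1 \<le> 2 * D (take t1 v) (take (length v) v)"
    by (rule closing_window_length[OF R v])
      (use le closing_length_diff[OF R v uv(1)] uv(2) N_large t1_def in auto)
  have Du: "D (take t u) (take t1 u) \<le> 2 * D u v + 6 * q" if "t1 \<le> t" for t
  proof -
    have "D (take (min t (length u)) u) (take t1 u) \<le> min t (length u) - t1"
      using D_take[of t1 "min t (length u)" u] that d_sym t1_def by simp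
    then show ?thesis by (simp add: t1_def min_def split: if_splits)
  qed
  have "D (take t1 v) v \<le> D (take t1 v) (take t1 u) + D (take t1 u) u + D u v"
    using d_tri[of "take t1 v" v "take t1 u"] d_tri[of "take t1 u" v u] by linarith
  then have lenv: "length v - t1 \<le> 6 * D u v + 32 * q"
    using len t1[of t1] Du[of "length u"] d_sym[of "take t1 v" "take t1 u"] d_sym[of "take t1 u" u]
    by (simp add: t1_def)
  have Dv: "D (take t1 v) (take t v) \<le> 6 * D u v + 32 * q" if "t1 \<le> t" for t
  proof -
    have "D (take t1 v) (take (min t (length v)) v) \<le> min t (length v) - t1"
      using that le t1_def by (intro D_take) auto
    then show ?thesis using lenv by (simp add: min_def split: if_splits)
  qed
  show ?thesis
    unfolding fellow_def
  proof
    fix t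
    show "D (take t u) (take t v) \<le> 8 * D u v + 48 * q"
    proof (cases "t \<le> t1")
      case False
      then show ?thesis
        using Du[of t] Dv[of t] t1[of t1] d_tri[of "take t u" "take t v" "take t1 u"]
          d_tri[of "take t1 u" "take t v" "take t1 v"] by linarith
    qed (use t1[of t] in auto)
  qed
qed

lemma closing_all: "closing R"
proof (induction R)
  case (Suc R)
  show ?case
    unfolding closing_def
  proof (intro ballI impI)
    fix u v
    assume *: "u \<in> Lam" "v \<in> Lam" "length u < Suc R" "length v < Suc R" "fellow (1200 * q) u v"
      "D u v \<le> 60 * q"
    show "fellow (8 * D u v + 48 * q) u v"
    proof (cases "length u \<le> length v")
      case True
      then show ?thesis using closing_fellow[OF Suc, of u v] * by auto
    next
      case False
      then show ?thesis
        using closing_fellow[OF Suc, of v u] * fellow_sym d_sym[of u v] by auto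
    qed
  qed
qed (simp add: closing_def)


section \<open>Fellow travelling of normal forms without a length bound\<close>

lemma fellow_improve:
  assumes "u \<in> Lam" "v \<in> Lam" "fellow (1200 * q) u v" "D u v \<le> 60 * q"
  shows "fellow (8 * D u v + 48 * q) u v"
  using closing_all[of "Suc (max (length u) (length v))"] assms unfolding closing_def by auto

lemma Lam_deep:
  assumes "u \<in> Lam" "v \<in> Lam" "fellow (1200 * q) u v" "D u v \<le> 60 * q"
    "t + 2 * (D u v + 3 * q) \<le> length u" "t \<le> length v"
  shows "D (take t u) (take t v) \<le> 10 * q"
  using closing_deep[OF closing_all[of "max (length u) (length v)"]] assms by auto

text \<open>For equal end points the rough bound improves to \<open>48 * q\<close>, which is within
  the tolerance of \<open>Lam_unique\<close>.\<close>

lemma Lam_eq: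
  assumes "u \<in> Lam" "v \<in> Lam" "fellow (1200 * q) u v" "D u v = 0"
  shows "u = v"
proof -
  have "fellow (600 * q) u v"
    using fellow_improve[OF assms(1-3)] assms(4) by (auto elim: fellow_mono)
  then show ?thesis using Lam_unique assms by blast
qed

section \<open>The action of the letters on the normal forms\<close>

definition act :: "nat list \<Rightarrow> nat \<Rightarrow> nat list" where
  "act u s = (THE v. v \<in> Lam \<and> D v (u @ [s]) = 0 \<and> fellow (600 * q) u v)"

lemma act_ex:
  assumes "u \<in> Lam"
  shows "\<exists>v\<in>Lam. D v (u @ [s]) = 0 \<and> fellow (56 * q) u v \<and> length v \<le> Suc (length u)"
proof -
  obtain v where v: "v \<in> Lam" "D v (u @ [s]) = 0" "fellow (600 * q) v (u @ [s])"
    "length v \<le> Suc (length u)" using Lam_snoc_cases[OF assms] by blast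
  have "fellow (1 + 600 * q) u v" using fellow_trans[OF fellow_snoc fellow_sym[OF v(3)]] .
  then have F: "fellow (1200 * q) u v" by (rule fellow_mono) (use q_pos in auto)
  have "D u v \<le> 1" using D_snoc[of u s] D_zero_cong(2)[OF v(2)] by simp
  then have "fellow (56 * q) u v"
    using fellow_improve[OF assms v(1) F] q_pos by (auto elim!: fellow_mono)
  then show ?thesis using v by blast
qed

text \<open>Two candidates are \<open>1200 * q\<close>-fellow travellers of each other, by way of
  \<open>u\<close>, so \<open>Lam_eq\<close> identifies them.\<close>

lemma act_eqI:
  assumes "u \<in> Lam" "v \<in> Lam" "D v (u @ [s]) = 0" "fellow (600 * q) u v"
  shows "act u s = v"
  unfolding act_def
proof (rule the_equality)
  fix v' assume v': "v' \<in> Lam \<and> D v' (u @ [s]) = 0 \<and> fellow (600 * q) u v'"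
  then have "fellow (1200 * q) v' v"
    using fellow_trans[OF fellow_sym assms(4), of "600 * q" v'] by simp
  moreover have "D v' v = 0" using v' assms(3) D_zero_trans d_sym by metis
  ultimately show "v' = v" using Lam_eq v' assms(2) by blast
qed (use assms in auto)

lemma act:
  assumes "u \<in> Lam"
  shows act_Lam: "act u s \<in> Lam" and D_act: "D (act u s) (u @ [s]) = 0"
    and fellow_act: "fellow (56 * q) u (act u s)" and length_act: "length (act u s) \<le> Suc (length u)"
proof -
  obtain v where v: "v \<in> Lam" "D v (u @ [s]) = 0" "fellow (56 * q) u v" "length v \<le> Suc (length u)"
    using act_ex[OF assms] by blast
  have "act u s = v"
    by (rule act_eqI[OF assms v(1,2)]) (rule fellow_mono[OF v(3)], simp)
  then show "act u s \<in> Lam" "D (act u s) (u @ [s]) = 0" "fellow (56 * q) u (act u s)"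
    "length (act u s) \<le> Suc (length u)" using v by auto
qed

abbreviation acts :: "nat list \<Rightarrow> nat list \<Rightarrow> nat list" where
  "acts \<equiv> foldl act"

lemma acts_Lam: "u \<in> Lam \<Longrightarrow> acts u g \<in> Lam"
  by (induction g arbitrary: u) (auto simp: act_Lam)

lemma D_acts: "u \<in> Lam \<Longrightarrow> D (acts u g) (u @ g) = 0"
proof (induction g rule: rev_induct)
  case (snoc s g)
  then show ?case
    using D_zero_trans[OF D_act[of "acts u g" s] D_right[of "acts u g" "u @ g" "[s]"]] acts_Lam
    by simp
qed simp

lemma length_acts: "u \<in> Lam \<Longrightarrow> length (acts u g) \<le> length u + length g"
proof (induction g rule: rev_induct)
  case (snoc s g)
  then show ?case using length_act[of "acts u g" s] acts_Lam[of u g] by simp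
qed simp

lemma D_acts_le: "u \<in> Lam \<Longrightarrow> D u (acts u g) \<le> length g"
  using D_append[of u g] D_zero_cong(2)[OF D_acts, of u u g] by simp

text \<open>As in \<open>closing_extend\<close>, improving the bound after every letter prevents
  accumulation: \<open>528 = 8 * 60 + 48\<close>.\<close>

lemma fellow_acts: "u \<in> Lam \<Longrightarrow> length g \<le> 60 * q \<Longrightarrow> fellow (528 * q) u (acts u g)"
proof (induction g rule: rev_induct)
  case (snoc s g)
  have "fellow (528 * q + 56 * q) u (acts u (g @ [s]))"
    using fellow_trans[OF snoc.IH fellow_act[of "acts u g" s]] acts_Lam snoc.prems by simp
  then have "fellow (1200 * q) u (acts u (g @ [s]))" by (rule fellow_mono) simp
  moreover have "D u (acts u (g @ [s])) \<le> 60 * q"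
    using D_acts_le[of u "g @ [s]"] snoc.prems by simp
  ultimately have "fellow (8 * D u (acts u (g @ [s])) + 48 * q) u (acts u (g @ [s]))"
    using fellow_improve acts_Lam snoc.prems by blast
  then show ?case
    by (rule fellow_mono) (use \<open>D u (acts u (g @ [s])) \<le> 60 * q\<close> in simp)
qed simp

lemma acts_eqI:
  assumes "u \<in> Lam" "v \<in> Lam" "length g \<le> 60 * q" "D v (u @ g) = 0" "fellow (600 * q) u v"
  shows "acts u g = v"
proof (rule Lam_eq[OF acts_Lam[OF assms(1)] assms(2)])
  have "fellow (528 * q + 600 * q) (acts u g) v"
    using fellow_trans[OF fellow_sym[OF fellow_acts] assms(5)] assms by blast
  then show "fellow (1200 * q) (acts u g) v" by (rule fellow_mono) simp
  show "D (acts u g) v = 0" using D_zero_trans[OF D_acts] assms d_sym by metis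
qed

text \<open>This is where the short relations of the underlying group enter the new one: both
  results have the same end point and stay within \<open>528 * q\<close> of \<open>u\<close>, hence
  they coincide.\<close>

lemma acts_short:
  assumes "u \<in> Lam" "length g \<le> 60 * q" "length g' \<le> 60 * q" "D g g' = 0"
  shows "acts u g = acts u g'"
proof (rule acts_eqI[OF assms(1) acts_Lam[OF assms(1)] assms(2)])
  have "D (u @ g') (u @ g) = 0" using D_left assms(4) d_sym by metis
  then show "D (acts u g') (u @ g) = 0" using D_zero_trans[OF D_acts] assms(1) by blast
  show "fellow (600 * q) u (acts u g')"
    by (rule fellow_mono[OF fellow_acts]) (use assms in auto)
qed

text \<open>All prefixes of \<open>u\<close> lie in \<open>Lam\<close>, and there the next letter
  acts by being appended.\<close>

lemma acts_Nil_Lam: "u \<in> Lam \<Longrightarrow> acts [] u = u"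
proof (induction u rule: rev_induct)
  case (snoc s u)
  then have "u \<in> Lam" using Lam_take[of "u @ [s]" "length u"] by simp
  moreover from this have "act u s = u @ [s]"
    by (intro act_eqI) (use snoc.prems fellow_mono[OF fellow_snoc, of "600 * q"] q_pos in auto)
  ultimately show ?case using snoc.IH by simp
qed simp

text \<open>The words \<open>v\<close> and \<open>v'\<close> are the sides of a ladder whose cells are relations between short words.\<close>

lemma acts_fellow_words:
  assumes "u \<in> Lam" "fellow (57 * q) v v'" "D v v' = 0"
  shows "acts u v = acts u v'"
proof -
  \<comment> \<open>Induction along the ladder with an arbitrary rung: \<open>g\<close> is any short
    word joining the two prefixes. Around one cell both ways have length at most
    \<open>57 * q + 1\<close>, short enough for \<open>acts_short\<close>.\<close>
  have "length g \<le> 57 * q \<Longrightarrow> D (take t v @ g) (take t v') = 0 \<Longrightarrow>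
    acts u (take t v @ g) = acts u (take t v')" for t g
  proof (induction t arbitrary: g)
    case 0
    then show ?case using acts_short[OF assms(1), of g "[]"] by simp
  next
    case (Suc t)
    obtain x where x: "take (Suc t) v = take t v @ x" "length x \<le> 1"
      using take_add[of t 1 v] by simp
    obtain x' where x': "take (Suc t) v' = take t v' @ x'" "length x' \<le> 1"
      using take_add[of t 1 v'] by simp
    obtain g0 where g0: "length g0 = D (take t v) (take t v')" "D (take t v @ g0) (take t v') = 0"
      using geodesic_word by blast
    have lg0: "length g0 \<le> 57 * q" using assms(2) g0(1) by (simp add: fellow_def)
    have "D (take t v @ x @ g) (take t v @ g0 @ x') = 0"
      using D_zero_trans[of "take t v @ x @ g" "take t v' @ x'" "take t v @ g0 @ x'"]
        D_right[OF g0(2), of x'] Suc.prems(2) x(1) x'(1) d_sym by simp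
    then have "D (x @ g) (g0 @ x') = 0" by (simp add: D_left)
    then have "acts (acts u (take t v)) (x @ g) = acts (acts u (take t v)) (g0 @ x')"
      by (intro acts_short[OF acts_Lam[OF assms(1)]]) (use Suc.prems(1) x(2) x'(2) lg0 q_pos in auto)
    then show ?case using Suc.IH[OF lg0 g0(2)] x(1) x'(1) by simp
  qed
  from this[of "[]" "max (length v) (length v')"] show ?thesis using assms(3) by simp
qed

text \<open>One step of normalisation replaces \<open>v @ [s]\<close> by \<open>act v s\<close>, a
  \<open>57 * q\<close>-fellow traveller with the same end point, and such words act alike. The
  associativity of the product \<open>acts u v\<close> on \<open>Lam\<close> rests on this.\<close>

lemma acts_acts_Nil:
  assumes "u \<in> Lam"
  shows "acts u (acts [] w) = acts u w"
proof (induction w rule: rev_induct)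
  case (snoc s w)
  define v where "v = acts [] w"
  have v: "v \<in> Lam" by (simp add: v_def acts_Lam Nil_Lam)
  have "fellow (1 + 56 * q) (v @ [s]) (act v s)"
    using fellow_trans[OF fellow_sym[OF fellow_snoc] fellow_act[OF v]] .
  then have "fellow (57 * q) (v @ [s]) (act v s)" by (rule fellow_mono) (use q_pos in simp)
  moreover have "D (v @ [s]) (act v s) = 0" using D_act[OF v] d_sym by metis
  ultimately have "acts u (v @ [s]) = acts u (act v s)"
    using acts_fellow_words[OF assms] by blast
  then show ?case using snoc.IH by (simp add: v_def)
qed simp

lemma acts_assoc:
  assumes "u \<in> Lam" "v \<in> Lam"
  shows "acts (acts u v) w = acts u (acts v w)"
  using acts_acts_Nil[OF assms(1), of "v @ w"] acts_Nil_Lam[OF assms(2)] by simp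

lemma inverse_word_both: "\<exists>s'. D [s, s'] [] = 0 \<and> D [s', s] [] = 0"
proof -
  obtain s' where s': "D [s, s'] [] = 0" using inverse_word by blast
  have "D ([s] @ [s', s]) ([s] @ []) = 0" using D_right[OF s', of "[s]"] by simp
  then show ?thesis using s' by (auto simp only: D_left)
qed

lemma acts_inverse:
  "\<exists>g'. length g' = length g \<and> (\<forall>w\<in>Lam. acts w (g @ g') = w \<and> acts w (g' @ g) = w)"
proof (induction g)
  case (Cons s g)
  then obtain g' where g': "length g' = length g"
    "\<And>w. w \<in> Lam \<Longrightarrow> acts w (g @ g') = w" "\<And>w. w \<in> Lam \<Longrightarrow> acts w (g' @ g) = w" by blast
  obtain s' where s': "D [s, s'] [] = 0" "D [s', s] [] = 0" using inverse_word_both by blast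
  have "act (act w s) s' = w" "act (act w s') s = w" if "w \<in> Lam" for w
    using acts_short[OF that _ _ s'(1)] acts_short[OF that _ _ s'(2)] q_pos by auto
  then show ?case
    using g'(1) g'(2)[OF act_Lam] g'(3) acts_Lam
    by (intro exI[of _ "g' @ [s']"]) (auto simp flip: append_assoc)
qed simp

section \<open>The graph metric of the action and its hyperbolicity\<close>

definition dev_dist :: "nat list \<Rightarrow> nat list \<Rightarrow> nat" where
  "dev_dist u v = (LEAST n. \<exists>g. length g = n \<and> acts u g = v)"

lemma dev_dist_le: "acts u g = v \<Longrightarrow> dev_dist u v \<le> length g"
  unfolding dev_dist_def by (intro Least_le) blast

text \<open>The action is transitive: undo \<open>u\<close>, then read \<open>v\<close>. So the
  \<open>LEAST\<close> in \<open>dev_dist\<close> is attained.\<close>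

lemma dev_geodesic:
  assumes "u \<in> Lam" "v \<in> Lam"
  shows "\<exists>g. length g = dev_dist u v \<and> acts u g = v"
proof -
  obtain g' where "\<forall>w\<in>Lam. acts w (u @ g') = w" using acts_inverse[of u] by blast
  then have "acts u g' = []" using Nil_Lam acts_Nil_Lam[OF assms(1)] by (metis foldl_append)
  then have "acts u (g' @ v) = v" using acts_Nil_Lam[OF assms(2)] by simp
  then have "\<exists>n. \<exists>g. length g = n \<and> acts u g = v" by blast
  from LeastI_ex[OF this] show ?thesis unfolding dev_dist_def .
qed

lemma dev_dist_sym_le:
  assumes "u \<in> Lam" "v \<in> Lam" shows "dev_dist v u \<le> dev_dist u v"
proof -
  obtain g where g: "length g = dev_dist u v" "acts u g = v" using dev_geodesic[OF assms] by blast
  obtain g' where "length g' = length g" "\<forall>w\<in>Lam. acts w (g @ g') = w" using acts_inverse[of g] by blast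
  then show ?thesis using dev_dist_le[of v g' u] g assms(1) by auto
qed

lemma dev_dist_tri:
  assumes "u \<in> Lam" "v \<in> Lam" "w \<in> Lam" shows "dev_dist u w \<le> dev_dist u v + dev_dist v w"
proof -
  obtain g where g: "length g = dev_dist u v" "acts u g = v" using dev_geodesic assms by blast
  obtain h where h: "length h = dev_dist v w" "acts v h = w" using dev_geodesic assms by blast
  show ?thesis using dev_dist_le[of u "g @ h" w] g h by simp
qed

lemma dev_dist_take: "u \<in> Lam \<Longrightarrow> t \<le> length u \<Longrightarrow> dev_dist (take t u) u \<le> length u - t"
  using dev_dist_le[of "take t u" "drop t u" u] acts_Nil_Lam[of u] acts_Nil_Lam[OF Lam_take, of u t]
  by (metis append_take_drop_id foldl_append length_drop)

text \<open>A letter lengthens a normal form by at most one, so no word shorter than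
  \<open>u\<close> leads to \<open>u\<close>. This makes the normal forms a combing by
  geodesics.\<close>

lemma dev_dist_Nil: assumes "u \<in> Lam" shows "dev_dist [] u = length u"
proof (rule antisym)
  show "dev_dist [] u \<le> length u" using dev_dist_le acts_Nil_Lam assms by blast
  obtain g where "length g = dev_dist [] u" "acts [] g = u" using dev_geodesic[OF Nil_Lam assms] by blast
  then show "length u \<le> dev_dist [] u" using length_acts[OF Nil_Lam, of g] by auto
qed

lemma dev_dist_fellow:
  assumes "u \<in> Lam" "v \<in> Lam" "fellow (60 * q) u v"
  shows "dev_dist u v \<le> D u v"
proof -
  obtain g where g: "length g = D u v" "D (u @ g) v = 0" using geodesic_word by blast
  have "acts u g = v"
    by (rule acts_eqI) (use assms g fellow_end[OF assms(3)] d_sym[of v] in \<open>auto elim: fellow_mono\<close>)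
  then show ?thesis using dev_dist_le g(1) by metis
qed

text \<open>Improving the bound by \<open>Lam_deep\<close> costs some depth; along a path that moves away from the origin
  this depth is regained every \<open>50 q\<close> steps, so the bound does not deteriorate with the length of the path.\<close>

lemma escaping_path_fellow:
  assumes y: "\<And>i. i \<le> k \<Longrightarrow> y i \<in> Lam" "\<And>i. i < k \<Longrightarrow> \<exists>s. act (y i) s = y (Suc i)"
    and len: "\<And>i. i \<le> k \<Longrightarrow> T + i \<le> length (y i)"
    and "i \<le> k" "t + 152 * q \<le> T + i"
  shows "D (take t (y i)) (take t (y k)) \<le> 10 * q"
  using assms(4,5)
proof (induction "k - i" arbitrary: i t rule: less_induct)
  case less
  have path: "\<exists>g. length g = j \<and> acts (y i) g = y (i + j)" if "i + j \<le> k" for j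
    using that
  proof (induction j)
    case (Suc j)
    then obtain g s where "length g = j" "acts (y i) g = y (i + j)" "act (y (i + j)) s = y (Suc (i + j))"
      using y(2)[of "i + j"] by auto
    then show ?case by (intro exI[of _ "g @ [s]"]) auto
  qed simp
  have short: "D (take t (y i)) (take t (y (i + j))) \<le> 10 * q"
    if "i + j \<le> k" "j \<le> 50 * q" "t + 106 * q \<le> T + i" for j t
  proof -
    obtain g where g: "length g = j" "acts (y i) g = y (i + j)" using path[OF \<open>i + j \<le> k\<close>] by blast
    have "fellow (1200 * q) (y i) (y (i + j))"
      using fellow_mono[OF fellow_acts[of "y i" g], of "1200 * q"] g y(1)[of i] that less.prems by simp
    moreover have "D (y i) (y (i + j)) \<le> j" using D_acts_le[of "y i" g] g y(1)[of i] less.prems by simp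
    ultimately show ?thesis
      using y(1)[of i] y(1)[of "i + j"] len[of i] len[of "i + j"] that less.prems
      by (intro Lam_deep) auto
  qed
  show ?case
  proof (cases "k - i \<le> 50 * q")
    case True
    then show ?thesis using short[of "k - i" t] less.prems by simp
  next
    case False
    define i' where "i' = i + 50 * q"
    \<comment> \<open>Over \<open>50 * q\<close> steps \<open>Lam_deep\<close> consumes the depth
      \<open>2 * (50 * q + 3 * q) = 106 * q\<close>. Two comparisons give \<open>20 * q\<close> up
      to time \<tau>; a second use of \<open>Lam_deep\<close> restores \<open>10 * q\<close> at the
      cost of \<open>2 * (20 * q + 3 * q) = 46 * q\<close>, whence \<open>152 * q\<close>. The
      \<open>50 * q\<close> levels gained between \<open>i\<close> and \<open>i'\<close> exceed the
      \<open>46 * q\<close> that the induction hypothesis needs in addition.\<close>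
    define \<tau> where "\<tau> = T + i - 106 * q"
    have "D (take s (y i)) (take s (y k)) \<le> 20 * q" if "s \<le> \<tau>" for s
    proof -
      have "D (take s (y i)) (take s (y i')) \<le> 10 * q"
        using short[of "50 * q" s] that False less.prems by (simp add: i'_def \<tau>_def)
      moreover have "D (take s (y i')) (take s (y k)) \<le> 10 * q"
        using less.hyps[of i' s] that False less.prems q_pos by (simp add: i'_def \<tau>_def)
      ultimately show ?thesis using d_tri[of "take s (y i)" "take s (y k)" "take s (y i')"] by linarith
    qed
    then have F: "fellow (20 * q) (take \<tau> (y i)) (take \<tau> (y k))"
      unfolding fellow_def by simp
    have l: "length (take \<tau> (y i)) = \<tau>" "length (take \<tau> (y k)) = \<tau>" "t + 46 * q \<le> \<tau>"
      using len[of i] len[of k] less.prems by (auto simp: \<tau>_def)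
    have "D (take t (take \<tau> (y i))) (take t (take \<tau> (y k))) \<le> 10 * q"
      by (rule Lam_deep)
        (use l fellow_end[OF F] fellow_mono[OF F] Lam_take y(1) less.prems in auto)
    then show ?thesis using l by simp
  qed
qed

text \<open>A geodesic from \<open>u\<close> to \<open>v\<close> stays outside the ball whose radius is the Gromov product of \<open>u\<close> and \<open>v\<close>,
  and both halves of it escape from this ball at unit speed.\<close>

lemma product_fellow:
  assumes u: "u \<in> Lam" and v: "v \<in> Lam" and T: "2 * T + dev_dist u v \<le> length u + length v"
    and "t + 152 * q \<le> T"
  shows "D (take t u) (take t v) \<le> 20 * q"
proof -
  define m where "m = dev_dist u v"
  obtain g where g: "length g = m" "acts u g = v" using dev_geodesic[OF u v] m_def by blast
  define z where "z i = acts u (take i g)" for i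
  have z: "z i \<in> Lam" for i using acts_Lam[OF u] by (simp add: z_def)
  have z0: "z 0 = u" "z m = v" using g by (auto simp: z_def)
  have step: "\<exists>s. act (z i) s = z (Suc i)" if "i < m" for i
    using that g(1) by (auto simp: z_def take_Suc_conv_app_nth)
  have backstep: "\<exists>s. act (z (Suc i)) s = z i" if "i < m" for i
  proof -
    obtain s where s: "act (z i) s = z (Suc i)" using step[OF \<open>i < m\<close>] by blast
    obtain s' where "D [s, s'] [] = 0" using inverse_word by blast
    then have "acts (z i) [s, s'] = z i" using acts_short[OF z, of "[s, s']" "[]"] q_pos by simp
    then show ?thesis using s by auto
  qed
  have up: "length v \<le> length (z i) + (m - i)" for i
  proof -
    have "acts (z i) (drop i g) = v" using g(2) by (simp add: z_def flip: foldl_append)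
    then show ?thesis using length_acts[OF z, of i "drop i g"] g(1) by simp
  qed
  have down: "i \<le> m \<Longrightarrow> length u \<le> length (z i) + i" for i
  proof (induction i)
    case (Suc i)
    then obtain s where "act (z (Suc i)) s = z i" using backstep[of i] by auto
    then show ?case using length_act[OF z, of "Suc i" s] Suc by simp
  qed (simp add: z0)
  have Tu: "T \<le> length u" using up[of 0] T z0 by (simp add: m_def)
  \<comment> \<open>Before time \<open>i0\<close> the estimate \<open>down\<close> keeps the path
    above level \<open>T\<close>, afterwards \<open>up\<close> does, and both bounds rise at unit
    speed away from \<open>i0\<close>. The minimum with \<open>m\<close> covers paths that end
    before \<open>down\<close> has sunk to \<open>T\<close>; their second part is empty.\<close>
  define i0 where "i0 = min (length u - T) m"
  have i0: "i0 \<le> m" by (simp add: i0_def)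
  have 1: "D (take t (z i0)) (take t u) \<le> 10 * q"
  proof -
    have "D (take t (z (i0 - 0))) (take t (z (i0 - i0))) \<le> 10 * q"
    proof (rule escaping_path_fellow[where y = "\<lambda>i. z (i0 - i)" and k = i0 and T = T and i = 0])
      fix i assume i: "i < i0"
      then have "i0 - i = Suc (i0 - Suc i)" by simp
      then show "\<exists>s. act (z (i0 - i)) s = z (i0 - Suc i)" using backstep[of "i0 - Suc i"] i i0 by simp
    next
      fix i assume "i \<le> i0"
      moreover have "i0 \<le> length u - T" by (simp add: i0_def)
      ultimately show "T + i \<le> length (z (i0 - i))" using down[of "i0 - i"] i0 Tu by linarith
    qed (use z assms in auto)
    then show ?thesis by (simp add: z0)
  qed
  have 2: "D (take t (z i0)) (take t v) \<le> 10 * q"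
  proof -
    have "D (take t (z (i0 + 0))) (take t (z (i0 + (m - i0)))) \<le> 10 * q"
    proof (rule escaping_path_fellow[where y = "\<lambda>i. z (i0 + i)" and k = "m - i0" and T = T and i = 0])
      fix i assume i: "i \<le> m - i0"
      show "T + i \<le> length (z (i0 + i))"
      proof (cases "length u - T \<le> m")
        case True
        then show ?thesis using up[of "i0 + i"] i T Tu by (simp add: i0_def m_def)
      next
        case False
        then show ?thesis using down[of m] i Tu by (simp add: i0_def)
      qed
    qed (use z assms step i0 in auto)
    then show ?thesis using i0 by (simp add: z0)
  qed
  show ?thesis
    using 1 2 d_tri[of "take t u" "take t v" "take t (z i0)"] d_sym[of "take t u" "take t (z i0)"]
    by linarith
qed

text \<open>\<open>T\<close> is an integral lower bound for two Gromov products at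
  \<open>[]\<close>. At time \<open>T - 152 * q\<close> the paths to \<open>u\<close> and
  \<open>w\<close> are both within \<open>20 * q\<close> of the path to \<open>v\<close>. Going back
  from \<open>u\<close> to this time, across at most \<open>40 * q\<close> steps, and on to
  \<open>w\<close> gives the error \<open>2 * 152 * q + 40 * q\<close>.\<close>

lemma dev_hyperbolic:
  assumes "u \<in> Lam" "v \<in> Lam" "w \<in> Lam"
    and uv: "2 * T + dev_dist u v \<le> length u + length v"
    and vw: "2 * T + dev_dist v w \<le> length v + length w"
  shows "2 * T + dev_dist u w \<le> length u + length w + 344 * q"
proof (cases "152 * q \<le> T")
  case True
  define t where "t = T - 152 * q"
  have "length v \<le> length u + dev_dist u v"
    using dev_dist_tri[OF Nil_Lam assms(1,2)] by (simp add: dev_dist_Nil assms)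
  then have tu: "t \<le> length u" using uv by (simp add: t_def)
  have "length v \<le> length w + dev_dist v w"
    using dev_dist_tri[OF Nil_Lam assms(3,2)] dev_dist_sym_le[OF assms(2,3)]
    by (simp add: dev_dist_Nil assms)
  then have tw: "t \<le> length w" using vw by (simp add: t_def)
  have "D (take s u) (take s w) \<le> 40 * q" if "s \<le> t" for s
  proof -
    have "s + 152 * q \<le> T" using that True by (simp add: t_def)
    then show ?thesis
      using product_fellow[OF assms(1,2) uv, of s] product_fellow[OF assms(2,3) vw, of s]
        d_tri[of "take s u" "take s w" "take s v"] by linarith
  qed
  then have F: "fellow (40 * q) (take t u) (take t w)" unfolding fellow_def by simp
  have "dev_dist (take t u) (take t w) \<le> 40 * q"
    using dev_dist_fellow[OF Lam_take Lam_take, of u w t t] fellow_end[OF F] fellow_mono[OF F] assms by auto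
  moreover have "dev_dist u (take t u) \<le> length u - t"
    using dev_dist_sym_le[OF Lam_take, of u u t] dev_dist_take[OF assms(1) tu] assms by auto
  moreover have "dev_dist (take t w) w \<le> length w - t" using dev_dist_take[OF assms(3) tw] .
  moreover have "dev_dist u w \<le> dev_dist u (take t u) + dev_dist (take t u) (take t w) + dev_dist (take t w) w"
    using dev_dist_tri[of u "take t u" w] dev_dist_tri[of "take t u" "take t w" w] assms Lam_take
    by fastforce
  moreover have "t + 152 * q = T" using True by (simp add: t_def)
  ultimately show ?thesis using tu tw by linarith
next
  case False
  have "dev_dist u w \<le> dev_dist u [] + dev_dist [] w"
    using dev_dist_tri[OF assms(1) Nil_Lam assms(3)] .
  then show ?thesis
    using dev_dist_sym_le[OF assms(1) Nil_Lam] dev_dist_sym_le[OF Nil_Lam assms(1)] False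
    by (simp add: dev_dist_Nil assms)
qed


text \<open>Left multiplication by \<open>w\<close> commutes with reading letters on the right, by
  \<open>acts_assoc\<close>, and it has an inverse.\<close>

lemma dev_dist_left:
  assumes "w \<in> Lam" "u \<in> Lam" "v \<in> Lam"
  shows "dev_dist (acts w u) (acts w v) = dev_dist u v"
proof -
  have le: "dev_dist (acts w u) (acts w v) \<le> dev_dist u v"
    if "w \<in> Lam" "u \<in> Lam" "v \<in> Lam" for w u v
  proof -
    obtain g where "length g = dev_dist u v" "acts u g = v" using dev_geodesic \<open>u \<in> Lam\<close> \<open>v \<in> Lam\<close> by blast
    then show ?thesis using dev_dist_le[of "acts w u" g] acts_assoc that by metis
  qed
  obtain g where g: "\<forall>x\<in>Lam. acts x (g @ w) = x" using acts_inverse[of w] by blast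
  define w' where "w' = acts [] g"
  have w': "w' \<in> Lam" "acts w' w = []" using g Nil_Lam acts_Lam by (auto simp: w'_def)
  have "acts w' (acts w x) = x" if "x \<in> Lam" for x
    using acts_assoc[OF w'(1) assms(1), of x] w'(2) acts_Nil_Lam[OF that] by simp
  then show ?thesis
    using le[OF assms] le[OF w'(1), of "acts w u" "acts w v"] acts_Lam assms by (metis le_antisym)
qed

lemma dev_hyperbolic_base:
  assumes "x \<in> Lam" "u \<in> Lam" "v \<in> Lam" "w \<in> Lam"
    and uv: "2 * T + dev_dist u v \<le> dev_dist u x + dev_dist v x"
    and vw: "2 * T + dev_dist v w \<le> dev_dist v x + dev_dist w x"
  shows "2 * T + dev_dist u w \<le> dev_dist u x + dev_dist w x + 344 * q"
proof -
  obtain g where g: "\<forall>w\<in>Lam. acts w (g @ x) = w" using acts_inverse[of x] by blast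
  define x' where "x' = acts [] g"
  have x': "x' \<in> Lam" "acts x' x = []" using g Nil_Lam acts_Lam by (auto simp: x'_def)
  have len: "dev_dist y x = length (acts x' y)" if "y \<in> Lam" for y
    using dev_dist_left[OF x'(1) assms(1) that] dev_dist_sym_le[OF that assms(1)]
      dev_dist_sym_le[OF assms(1) that] dev_dist_Nil[OF acts_Lam[OF x'(1)], of y] x'(2) by simp
  show ?thesis
    using dev_hyperbolic[of "acts x' u" "acts x' v" "acts x' w" T] acts_Lam[OF x'(1)]
      dev_dist_left[OF x'(1)] assms len by simp
qed

text \<open>Words are coded by \<open>to_nat\<close> so that the group has the type
  \<open>nat monoid\<close> demanded of the hyperbolic overgroup.\<close>

definition dev_group :: "nat monoid" where
  "dev_group = \<lparr>carrier = to_nat ` Lam, mult = (\<lambda>x y. to_nat (acts (from_nat x) (from_nat y))),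
     one = to_nat ([] :: nat list)\<rparr>"

lemma dev_group_simps:
  "carrier dev_group = to_nat ` Lam"
  "to_nat u \<otimes>\<^bsub>dev_group\<^esub> to_nat v = to_nat (acts u v)"
  "\<one>\<^bsub>dev_group\<^esub> = to_nat ([] :: nat list)"
  by (simp_all add: dev_group_def)

lemma group_dev_group: "group dev_group"
proof (rule groupI)
  fix x assume "x \<in> carrier dev_group"
  then obtain u where u: "u \<in> Lam" "x = to_nat u" by (auto simp: dev_group_simps)
  obtain g where "\<forall>w\<in>Lam. acts w (g @ u) = w" using acts_inverse[of u] by blast
  then have "acts (acts [] g) u = []" using Nil_Lam by simp
  then show "\<exists>y\<in>carrier dev_group. y \<otimes>\<^bsub>dev_group\<^esub> x = \<one>\<^bsub>dev_group\<^esub>"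
    by (intro bexI[of _ "to_nat (acts [] g)"]) (auto simp: dev_group_simps u acts_Lam Nil_Lam)
qed (auto simp: dev_group_simps acts_Lam Nil_Lam acts_assoc acts_Nil_Lam)

definition dev_gens :: "nat set" where
  "dev_gens = range (\<lambda>s. to_nat (act [] s))"

lemma dev_gens_carrier: "dev_gens \<subseteq> carrier dev_group"
  by (auto simp: dev_gens_def dev_group_simps act_Lam Nil_Lam)

lemma dev_gens_inverse: "m_inv dev_group ` dev_gens \<subseteq> dev_gens"
proof
  interpret K: group dev_group by (rule group_dev_group)
  fix x assume "x \<in> m_inv dev_group ` dev_gens"
  then obtain s where s: "x = inv\<^bsub>dev_group\<^esub> to_nat (act [] s)" by (auto simp: dev_gens_def)
  obtain s' where s': "D [s, s'] [] = 0" "D [s', s] [] = 0" using inverse_word_both by blast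
  have "acts [] (acts (act [] s') [s]) = []"
    using acts_short[OF Nil_Lam _ _ s'(2)] q_pos acts_Nil_Lam Nil_Lam by simp
  then have "acts (act [] s') (act [] s) = []"
    using acts_acts_Nil[OF act_Lam[OF Nil_Lam], of s' "[s]"] acts_short[OF Nil_Lam _ _ s'(2)] q_pos
    by simp
  then have "to_nat (act [] s') \<otimes>\<^bsub>dev_group\<^esub> to_nat (act [] s) = \<one>\<^bsub>dev_group\<^esub>"
    by (simp add: dev_group_simps)
  then have "x = to_nat (act [] s')"
    using K.inv_equality[of "to_nat (act [] s')" "to_nat (act [] s)"] s act_Lam Nil_Lam
    by (simp add: dev_group_simps)
  then show "x \<in> dev_gens" by (auto simp: dev_gens_def)
qed

lemma dev_foldr:
  "foldr (mult dev_group) (map (\<lambda>s. to_nat (act [] s)) g) \<one>\<^bsub>dev_group\<^esub> = to_nat (acts [] g)"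
proof (induction g)
  case (Cons s g)
  then show ?case using acts_acts_Nil[OF act_Lam[OF Nil_Lam], of s g] by (simp add: dev_group_simps)
qed (simp add: dev_group_simps)

lemma dev_words:
  "(\<exists>ws. length ws = n \<and> set ws \<subseteq> dev_gens \<union> m_inv dev_group ` dev_gens \<and>
     foldr (mult dev_group) ws \<one>\<^bsub>dev_group\<^esub> = x) \<longleftrightarrow> (\<exists>g. length g = n \<and> to_nat (acts [] g) = x)"
proof
  assume "\<exists>ws. length ws = n \<and> set ws \<subseteq> dev_gens \<union> m_inv dev_group ` dev_gens \<and>
     foldr (mult dev_group) ws \<one>\<^bsub>dev_group\<^esub> = x"
  then obtain ws where ws: "length ws = n" "set ws \<subseteq> dev_gens"
     "foldr (mult dev_group) ws \<one>\<^bsub>dev_group\<^esub> = x" using dev_gens_inverse by blast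
  obtain g where "ws = map (\<lambda>s. to_nat (act [] s)) g"
    using ws(2) unfolding dev_gens_def by (metis (no_types, lifting) ex_map_conv rangeE subset_eq)
  then show "\<exists>g. length g = n \<and> to_nat (acts [] g) = x" using ws dev_foldr by auto
next
  assume "\<exists>g. length g = n \<and> to_nat (acts [] g) = x"
  then show "\<exists>ws. length ws = n \<and> set ws \<subseteq> dev_gens \<union> m_inv dev_group ` dev_gens \<and>
     foldr (mult dev_group) ws \<one>\<^bsub>dev_group\<^esub> = x"
    using dev_foldr by (metis (no_types, lifting) Un_upper1 dev_gens_def image_mono length_map
      list.set_map subset_UNIV subset_trans)
qed

lemma dev_word_length:
  assumes "u \<in> Lam" shows "word_length dev_group dev_gens (to_nat u) = length u"
  unfolding word_length_def dev_words dev_dist_Nil[OF assms, symmetric] dev_dist_def by simp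

lemma dev_word_dist:
  assumes "u \<in> Lam" "v \<in> Lam"
  shows "word_dist dev_group dev_gens (to_nat u) (to_nat v) = dev_dist u v"
proof -
  interpret K: group dev_group by (rule group_dev_group)
  have uv: "to_nat u \<in> carrier dev_group" "to_nat v \<in> carrier dev_group"
    using assms by (auto simp: dev_group_simps)
  then obtain w where w: "w \<in> Lam" "inv\<^bsub>dev_group\<^esub> to_nat u \<otimes>\<^bsub>dev_group\<^esub> to_nat v = to_nat w"
    by (metis (no_types, lifting) K.inv_closed K.m_closed dev_group_simps(1) imageE)
  have "to_nat u \<otimes>\<^bsub>dev_group\<^esub> to_nat w = to_nat v"
    using uv by (simp add: K.inv_solve_left flip: w(2) K.m_assoc)
  then have "acts u w = v" by (simp add: dev_group_simps)
  then have "dev_dist u v = length w"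
    using dev_dist_left[OF assms(1) Nil_Lam w(1)] dev_dist_Nil[OF w(1)] by simp
  then show ?thesis by (simp add: word_dist_def w dev_word_length)
qed

text \<open>Every natural number is a letter; those from \<open>m\<close> on represent the identity
  and act trivially, which leaves finitely many generators.\<close>

lemma dev_finite_generating_set:
  assumes "\<And>s. m \<le> s \<Longrightarrow> D [s] [] = 0"
  shows "finite_generating_set dev_group dev_gens"
  unfolding finite_generating_set_def
proof (intro conjI)
  interpret K: group dev_group by (rule group_dev_group)
  have "act [] s = []" if "m \<le> s" for s
    using acts_short[OF Nil_Lam _ _ assms[OF that]] q_pos by simp
  then have "dev_gens \<subseteq> insert (to_nat ([] :: nat list)) ((\<lambda>s. to_nat (act [] s)) ` {..<m})"
    unfolding dev_gens_def by (metis (mono_tags, lifting) image_eqI image_subsetI insert_iff lessThan_iff not_le)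
  then show "finite dev_gens" by (rule finite_subset) simp
  show "dev_gens \<subseteq> carrier dev_group" by (rule dev_gens_carrier)
  show "generate dev_group dev_gens = carrier dev_group"
  proof
    show "generate dev_group dev_gens \<subseteq> carrier dev_group"
      using K.generate_incl[OF dev_gens_carrier] .
    have "to_nat (acts [] g) \<in> generate dev_group dev_gens" for g
    proof (induction g)
      case (Cons s g)
      have "to_nat (act [] s) \<in> generate dev_group dev_gens" by (rule generate.incl) (simp add: dev_gens_def)
      then show ?case
        using generate.eng[OF _ Cons] acts_acts_Nil[OF act_Lam[OF Nil_Lam], of s g]
        by (fastforce simp: dev_group_simps)
    qed (metis dev_group_simps(3) foldl_Nil generate.one)
    then show "carrier dev_group \<subseteq> generate dev_group dev_gens"
      unfolding dev_group_simps(1) using acts_Nil_Lam by (metis image_subsetI)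
  qed
qed

text \<open>\<open>172 * q\<close> is half of the error in \<open>dev_hyperbolic_base\<close>, and
  the additional 1 pays for rounding the minimum of the Gromov products down to the integer
  \<open>T\<close>.\<close>

lemma hyperbolic_dev_group:
  assumes "\<And>s. m \<le> s \<Longrightarrow> D [s] [] = 0"
  shows "hyperbolic_group dev_group"
  unfolding hyperbolic_group_def Gromov_hyperbolic_def
proof (intro conjI exI[of _ dev_gens] exI[of _ "1 + 172 * real q"] ballI)
  show "group dev_group" by (rule group_dev_group)
  show "finite_generating_set dev_group dev_gens" using dev_finite_generating_set assms .
  fix w' x' y' z'
  let ?P = "Gromov_product (word_dist dev_group dev_gens)"
  assume "w' \<in> carrier dev_group" "x' \<in> carrier dev_group" "y' \<in> carrier dev_group" "z' \<in> carrier dev_group"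
  then obtain w x y z where L: "w \<in> Lam" "x \<in> Lam" "y \<in> Lam" "z \<in> Lam"
    and e: "w' = to_nat w" "x' = to_nat x" "y' = to_nat y" "z' = to_nat z"
    by (auto simp: dev_group_simps)
  have P: "?P (to_nat w) (to_nat u) (to_nat v) = (real (dev_dist u w) + dev_dist v w - dev_dist u v) / 2"
    if "u \<in> Lam" "v \<in> Lam" for u v
    unfolding Gromov_product_def using that L by (simp add: dev_word_dist)
  define T where "T = nat \<lfloor>min (?P w' x' y') (?P w' y' z')\<rfloor>"
  have "0 \<le> ?P w' x' y'" "0 \<le> ?P w' y' z'"
    using dev_dist_tri[of x w y] dev_dist_tri[of y w z] dev_dist_sym_le L
    unfolding e P[OF L(2,3)] P[OF L(3,4)] by (smt (verit, best) divide_nonneg_pos le_antisym of_nat_add of_nat_le_iff)+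
  then have T: "real T \<le> min (?P w' x' y') (?P w' y' z')" "min (?P w' x' y') (?P w' y' z') \<le> real T + 1"
    unfolding T_def by linarith+
  have "real (2 * T + dev_dist x y) \<le> real (dev_dist x w + dev_dist y w)"
    "real (2 * T + dev_dist y z) \<le> real (dev_dist y w + dev_dist z w)"
    using T(1) unfolding e P[OF L(2,3)] P[OF L(3,4)] by auto
  then have "2 * T + dev_dist x y \<le> dev_dist x w + dev_dist y w"
    "2 * T + dev_dist y z \<le> dev_dist y w + dev_dist z w"
    unfolding of_nat_le_iff .
  from dev_hyperbolic_base[OF L this]
  have "real (2 * T + dev_dist x z) \<le> real (dev_dist x w + dev_dist z w + 344 * q)"
    using of_nat_le_iff by blast
  then have "real T \<le> ?P w' x' z' + 172 * real q" unfolding e P[OF L(2,4)] by (simp add: field_simps)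
  then show "min (?P w' x' y') (?P w' y' z') - (1 + 172 * real q) \<le> ?P w' x' z'" using T(2) by linarith
qed simp

end

section \<open>Homomorphisms out of finitely presented groups\<close>

lemma inverse_letter_inverse [simp]: "inverse_letter (inverse_letter a) = a"
  by (cases a) simp

lemma inverse_letter_neq [simp]: "inverse_letter a \<noteq> a" "a \<noteq> inverse_letter a"
  by (cases a; simp)+

lemma reduced_ConsD: "reduced (a # w) \<Longrightarrow> reduced w"
  by (cases w) auto

lemma reduced_reduced_cons: "reduced w \<Longrightarrow> reduced (reduced_cons a w)"
  by (cases w) (auto dest: reduced_ConsD)

lemma reduced_cons_cancel: "reduced w \<Longrightarrow> reduced_cons a (reduced_cons (inverse_letter a) w) = w"
proof (cases w)
  case (Cons b w')
  assume "reduced w"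
  then show ?thesis using Cons by (cases w') auto
qed simp

lemma reduced_foldr: "reduced w \<Longrightarrow> reduced (foldr reduced_cons u w)"
  by (induction u) (auto intro: reduced_reduced_cons)

text \<open>A letter and its inverse act on reduced words as inverse maps, which settles the case
  where \<open>a\<close> cancels the first letter of \<open>v\<close>. This is van der Waerden's
  route to associativity, by letters acting on reduced words.\<close>

lemma foldr_reduced_cons:
  assumes "reduced v" "reduced w"
  shows "foldr reduced_cons (reduced_cons a v) w = reduced_cons a (foldr reduced_cons v w)"
proof (cases v)
  case (Cons b v')
  then show ?thesis using reduced_cons_cancel[OF reduced_foldr[OF assms(2)], of a v'] by auto
qed simp

lemma foldr_reduced_assoc:
  "reduced v \<Longrightarrow> reduced w \<Longrightarrow>
    foldr reduced_cons (foldr reduced_cons u v) w = foldr reduced_cons u (foldr reduced_cons v w)"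
  by (induction u) (auto simp: foldr_reduced_cons reduced_foldr)

lemma letters_reduced_cons:
  "a \<in> A \<Longrightarrow> w \<in> lists A \<Longrightarrow> reduced_cons a w \<in> lists A"
  by (cases w) auto

lemma letters_foldr_reduced_cons:
  "u \<in> lists A \<Longrightarrow> w \<in> lists A \<Longrightarrow> foldr reduced_cons u w \<in> lists A"
  by (induction u) (simp_all add: letters_reduced_cons del: in_lists_conv_set)

lemma free_group_simps:
  "carrier (free_group X) = {w \<in> lists (X \<times> UNIV). reduced w}"
  "u \<otimes>\<^bsub>free_group X\<^esub> v = foldr reduced_cons u v"
  "\<one>\<^bsub>free_group X\<^esub> = []"
  by (simp_all add: free_group_def)

lemma letter_in_free_group: "fst a \<in> X \<Longrightarrow> [a] \<in> carrier (free_group X)"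
  by (cases a) (auto simp: free_group_simps)

lemma group_free_group: "group (free_group X)"
proof (rule groupI)
  fix x y assume "x \<in> carrier (free_group X)" "y \<in> carrier (free_group X)"
  then show "x \<otimes>\<^bsub>free_group X\<^esub> y \<in> carrier (free_group X)"
    using letters_foldr_reduced_cons[of x "X \<times> UNIV" y] reduced_foldr[of y x]
    by (simp add: free_group_simps)
next
  show "\<one>\<^bsub>free_group X\<^esub> \<in> carrier (free_group X)" by (simp add: free_group_simps)
next
  fix x y z
  assume "x \<in> carrier (free_group X)" "y \<in> carrier (free_group X)" "z \<in> carrier (free_group X)"
  then show "x \<otimes>\<^bsub>free_group X\<^esub> y \<otimes>\<^bsub>free_group X\<^esub> z = x \<otimes>\<^bsub>free_group X\<^esub> (y \<otimes>\<^bsub>free_group X\<^esub> z)"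
    by (simp add: free_group_simps foldr_reduced_assoc)
next
  fix x assume "x \<in> carrier (free_group X)"
  then show "\<one>\<^bsub>free_group X\<^esub> \<otimes>\<^bsub>free_group X\<^esub> x = x" by (simp add: free_group_simps)
next
  fix x assume "x \<in> carrier (free_group X)"
  then have "x \<in> lists (X \<times> UNIV)" "reduced x" by (auto simp: free_group_simps)
  then have "\<exists>y\<in>lists (X \<times> UNIV). reduced y \<and> foldr reduced_cons y x = []"
  proof (induction rule: lists.induct)
    case (Cons a x)
    then obtain y where y: "y \<in> lists (X \<times> UNIV)" "reduced y" "foldr reduced_cons y x = []"
      using reduced_ConsD[of a x] by (auto simp del: in_lists_conv_set)
    have a: "[inverse_letter a] \<in> lists (X \<times> UNIV)" using Cons.hyps(1) by (cases a) auto
    have "foldr reduced_cons (foldr reduced_cons y [inverse_letter a]) (a # x) = []"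
      using foldr_reduced_assoc[of "[inverse_letter a]" "a # x" y] Cons.prems y(3) by simp
    then show ?case
      using letters_foldr_reduced_cons[OF y(1) a] reduced_foldr[of "[inverse_letter a]" y] by auto
  qed (auto intro!: bexI[of _ "[]"])
  then show "\<exists>y\<in>carrier (free_group X). y \<otimes>\<^bsub>free_group X\<^esub> x = \<one>\<^bsub>free_group X\<^esub>"
    by (auto simp: free_group_simps)
qed

text \<open>The product in the free group differs from concatenation only by the cancellation of
  adjacent inverse letters, which \<theta> sends to factors with product \<one>.\<close>

lemma foldr_reduced_cons_hom:
  assumes "monoid K" "\<And>a. a \<in> A \<Longrightarrow> \<theta> a \<in> carrier K"
    and "\<And>a. a \<in> A \<Longrightarrow> \<theta> a \<otimes>\<^bsub>K\<^esub> \<theta> (inverse_letter a) = \<one>\<^bsub>K\<^esub>"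
    and "u \<in> lists A" "v \<in> lists A"
  defines "\<Theta> \<equiv> \<lambda>w. foldr (\<otimes>\<^bsub>K\<^esub>) (map \<theta> w) \<one>\<^bsub>K\<^esub>"
  shows "\<Theta> (foldr reduced_cons u v) = \<Theta> u \<otimes>\<^bsub>K\<^esub> \<Theta> v"
proof -
  interpret monoid K by fact
  have carr: "w \<in> lists A \<Longrightarrow> \<Theta> w \<in> carrier K" for w
    by (induction w) (auto simp: \<Theta>_def assms(2))
  have step: "\<Theta> (reduced_cons a w) = \<theta> a \<otimes>\<^bsub>K\<^esub> \<Theta> w" if "a \<in> A" "w \<in> lists A" for a w
  proof (cases w)
    case (Cons b w')
    then have "\<Theta> w = \<theta> b \<otimes>\<^bsub>K\<^esub> \<Theta> w'" by (simp add: \<Theta>_def)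
    moreover have "\<theta> a \<otimes>\<^bsub>K\<^esub> (\<theta> b \<otimes>\<^bsub>K\<^esub> \<Theta> w') = \<Theta> w'" if "b = inverse_letter a"
      using m_assoc[of "\<theta> a" "\<theta> b" "\<Theta> w'"] assms(2,3) that \<open>a \<in> A\<close> \<open>w \<in> lists A\<close> Cons carr[of w']
      by auto
    ultimately show ?thesis using Cons by (simp add: \<Theta>_def)
  qed (simp add: \<Theta>_def)
  show ?thesis using \<open>u \<in> lists A\<close>
  proof (induction u rule: lists.induct)
    case Nil
    then show ?case using carr[OF \<open>v \<in> lists A\<close>] by (simp add: \<Theta>_def)
  next
    case (Cons a u)
    then have "\<Theta> (foldr reduced_cons (a # u) v) = \<theta> a \<otimes>\<^bsub>K\<^esub> (\<Theta> u \<otimes>\<^bsub>K\<^esub> \<Theta> v)"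
      using step[of a "foldr reduced_cons u v"] letters_foldr_reduced_cons[of u A v] \<open>v \<in> lists A\<close> by auto
    also have "\<dots> = \<Theta> (a # u) \<otimes>\<^bsub>K\<^esub> \<Theta> v"
      using m_assoc[of "\<theta> a" "\<Theta> u" "\<Theta> v"] Cons.hyps assms(2) carr[of u] carr[OF \<open>v \<in> lists A\<close>]
      by (simp add: \<Theta>_def)
    finally show ?case .
  qed
qed

lemma normal_closure_normal: "N \<lhd> G \<Longrightarrow> R \<subseteq> N \<Longrightarrow> normal_closure G R \<subseteq> N"
  by (auto simp: normal_closure_def)

lemma normal_closure_is_normal:
  assumes "group G" "R \<subseteq> carrier G" shows "normal_closure G R \<lhd> G"
proof -
  interpret group G by fact
  have G: "carrier G \<lhd> G" by (rule normal_invI) (auto simp: subgroup_self)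
  show ?thesis
    unfolding normal_closure_def
  proof (rule normal_invI)
    show "subgroup (\<Inter>{N. N \<lhd> G \<and> R \<subseteq> N}) G"
      by (rule subgroups_Inter) (use G assms in \<open>auto dest: normal_imp_subgroup\<close>)
    fix x h assume "x \<in> carrier G" "h \<in> \<Inter>{N. N \<lhd> G \<and> R \<subseteq> N}"
    then show "x \<otimes>\<^bsub>G\<^esub> h \<otimes>\<^bsub>G\<^esub> inv\<^bsub>G\<^esub> x \<in> \<Inter>{N. N \<lhd> G \<and> R \<subseteq> N}"
      by (auto intro: normal.inv_op_closed2)
  qed
qed

text \<open>The bound \<open>n\<close> is fixed before \<open>K\<close>, because \<open>K\<close>
  will be built at a scale exceeding \<open>n\<close>. As \<open>ev\<close> is a left inverse of the
  homomorphism obtained, the latter is injective.\<close>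

lemma finitely_presented_lift:
  fixes G :: "('a, 'b) monoid_scheme" and val :: "'c list \<Rightarrow> 'a"
  assumes "group G" "subgroup H G" "finitely_presented (G\<lparr>carrier := H\<rparr>)"
    and val: "val [] = \<one>\<^bsub>G\<^esub>" "\<And>u v. val (u @ v) = val u \<otimes>\<^bsub>G\<^esub> val v" "range val = carrier G"
  shows "\<exists>n. \<forall>(K :: 'k monoid) \<pi> ev. group K \<longrightarrow> (\<forall>w. \<pi> w \<in> carrier K) \<longrightarrow>
    (\<forall>u v. \<pi> (u @ v) = \<pi> u \<otimes>\<^bsub>K\<^esub> \<pi> v) \<longrightarrow> ev \<in> hom K G \<longrightarrow> (\<forall>w. ev (\<pi> w) = val w) \<longrightarrow>
    (\<forall>r. length r \<le> n \<longrightarrow> val r = \<one>\<^bsub>G\<^esub> \<longrightarrow> \<pi> r = \<one>\<^bsub>K\<^esub>) \<longrightarrow>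
    (\<exists>\<phi>\<in>hom (G\<lparr>carrier := H\<rparr>) K. \<forall>h\<in>H. ev (\<phi> h) = h)"
proof -
  interpret G: group G by fact
  interpret H: group "G\<lparr>carrier := H\<rparr>" using G.subgroup_imp_group[OF assms(2)] .
  obtain X :: "nat set" and R where X: "finite X" "finite R" "R \<subseteq> carrier (free_group X)"
    "G\<lparr>carrier := H\<rparr> \<cong> free_group X Mod normal_closure (free_group X) R"
    using assms(3) unfolding finitely_presented_def by blast
  define F where "F = free_group X"
  define N where "N = normal_closure F R"
  interpret F: group F unfolding F_def by (rule group_free_group)
  interpret N: normal N F
    unfolding N_def by (rule normal_closure_is_normal[OF F.group_axioms]) (use X F_def in simp)
  obtain \<psi> where \<psi>: "\<psi> \<in> iso (G\<lparr>carrier := H\<rparr>) (F Mod N)"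
    using X(4) unfolding is_iso_def F_def N_def by blast
  have \<psi>_inj: "inj_on \<psi> H" and \<psi>_surj: "\<psi> ` H = carrier (F Mod N)" and \<psi>_hom: "\<psi> \<in> hom (G\<lparr>carrier := H\<rparr>) (F Mod N)"
    using \<psi> by (auto simp: iso_def bij_betw_def)
  interpret \<psi>: group_hom "G\<lparr>carrier := H\<rparr>" "F Mod N" \<psi>
    by (intro group_hom.intro group_hom_axioms.intro H.group_axioms N.factorgroup_is_group \<psi>_hom)
  define A where "A = X \<times> (UNIV :: bool set)"
  have inv_A: "inverse_letter a \<in> A" if "a \<in> A" for a using that by (cases a) (auto simp: A_def)
  have lA: "[a] \<in> carrier F" if "a \<in> A" for a
    using that unfolding F_def A_def by (intro letter_in_free_group) auto
  have "\<exists>h w. h \<in> H \<and> \<psi> h = N #>\<^bsub>F\<^esub> [a] \<and> val w = h" if "a \<in> A" for a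
  proof -
    have "N #>\<^bsub>F\<^esub> [a] \<in> \<psi> ` H" using lA[OF that] unfolding \<psi>_surj carrier_FactGroup by blast
    then obtain h where h: "h \<in> H" "\<psi> h = N #>\<^bsub>F\<^esub> [a]" by auto
    then have "h \<in> range val" using val(3) subgroup.subset[OF assms(2)] by auto
    then show ?thesis using h by blast
  qed
  then obtain h wd where h: "\<And>a. a \<in> A \<Longrightarrow> h a \<in> H" "\<And>a. a \<in> A \<Longrightarrow> \<psi> (h a) = N #>\<^bsub>F\<^esub> [a]"
    "\<And>a. a \<in> A \<Longrightarrow> val (wd a) = h a" by metis
  have F_lists: "w \<in> lists A \<and> reduced w" if "w \<in> carrier F" for w
    using that by (simp add: F_def A_def free_group_simps)
  have Fmult: "u \<otimes>\<^bsub>F\<^esub> v = foldr reduced_cons u v" "\<one>\<^bsub>F\<^esub> = []" for u v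
    by (simp_all add: F_def free_group_simps)
  have \<psi>val: "val (concat (map wd w)) \<in> H \<and> \<psi> (val (concat (map wd w))) = N #>\<^bsub>F\<^esub> w"
    if "w \<in> lists A" "reduced w" for w
    using that
  proof (induction w)
    case Nil
    have "\<psi> \<one>\<^bsub>G\<^esub> = N" using \<psi>.hom_one by simp
    then show ?case using val(1) subgroup.one_closed[OF assms(2)]
      F.coset_mult_one[OF N.subset] Fmult(2) by simp
  next
    case (Cons a w)
    then have w: "w \<in> lists A" "reduced w" "a \<in> A" using reduced_ConsD[of a w] by (auto simp del: in_lists_conv_set)
    note IH = Cons.IH[OF w(2)]
    have wF: "w \<in> carrier F" using w by (simp add: F_def A_def free_group_simps)
    have "\<psi> (h a \<otimes>\<^bsub>G\<^esub> val (concat (map wd w))) = (N #>\<^bsub>F\<^esub> [a]) <#>\<^bsub>F\<^esub> (N #>\<^bsub>F\<^esub> w)"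
      using \<psi>.hom_mult[of "h a" "val (concat (map wd w))"] h(1,2)[OF w(3)] IH by simp
    also have "\<dots> = N #>\<^bsub>F\<^esub> ([a] \<otimes>\<^bsub>F\<^esub> w)" using N.rcos_sum[OF lA[OF w(3)] wF] .
    also have "[a] \<otimes>\<^bsub>F\<^esub> w = a # w" using Cons.prems by (cases w) (auto simp: Fmult)
    finally show ?case
      using IH h(1,3)[OF w(3)] val(2) subgroup.m_closed[OF assms(2)] by simp
  qed
  have h_inv: "val (wd a @ wd (inverse_letter a)) = \<one>\<^bsub>G\<^esub>" if "a \<in> A" for a
  proof -
    have "\<psi> (h a \<otimes>\<^bsub>G\<^esub> h (inverse_letter a)) = (N #>\<^bsub>F\<^esub> [a]) <#>\<^bsub>F\<^esub> (N #>\<^bsub>F\<^esub> [inverse_letter a])"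
      using \<psi>.hom_mult[of "h a" "h (inverse_letter a)"] h(1,2) inv_A that by simp
    also have "\<dots> = N #>\<^bsub>F\<^esub> ([a] \<otimes>\<^bsub>F\<^esub> [inverse_letter a])" using N.rcos_sum lA inv_A that by simp
    also have "[a] \<otimes>\<^bsub>F\<^esub> [inverse_letter a] = \<one>\<^bsub>F\<^esub>" by (simp add: Fmult)
    also have "N #>\<^bsub>F\<^esub> \<one>\<^bsub>F\<^esub> = \<psi> \<one>\<^bsub>G\<^esub>"
      using \<psi>.hom_one F.coset_mult_one[OF N.subset] by simp
    finally have "h a \<otimes>\<^bsub>G\<^esub> h (inverse_letter a) = \<one>\<^bsub>G\<^esub>"
      by (rule inj_onD[OF \<psi>_inj]) (intro subgroup.m_closed[OF assms(2)] subgroup.one_closed[OF assms(2)] h(1) inv_A that)+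
    then show ?thesis using val(2) h(3) inv_A that by simp
  qed
  have relator: "val (concat (map wd r)) = \<one>\<^bsub>G\<^esub>" if "r \<in> R" for r
  proof -
    have rF: "r \<in> carrier F" using that X(3) by (auto simp: F_def)
    have "r \<in> N" using that by (auto simp: N_def normal_closure_def)
    then have "N #>\<^bsub>F\<^esub> r = N" using F.coset_join2[OF rF N.is_subgroup] by simp
    also have "N = \<psi> \<one>\<^bsub>G\<^esub>" using \<psi>.hom_one by simp
    finally have "\<psi> (val (concat (map wd r))) = \<psi> \<one>\<^bsub>G\<^esub>" using \<psi>val F_lists[OF rF] by metis
    then show ?thesis
      by (rule inj_onD[OF \<psi>_inj])
        (use \<psi>val F_lists[OF rF] subgroup.one_closed[OF assms(2)] in blast)+
  qed
  have fA: "finite A" using X(1) by (simp add: A_def)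
  \<comment> \<open>Words for a letter and for its inverse were chosen independently; that they are
    inverse to each other is therefore a further relation to be respected by \<open>K\<close>,
    besides the relators. A sum bounds each of its terms.\<close>
  define n where "n = (\<Sum>a\<in>A. length (wd a @ wd (inverse_letter a))) + (\<Sum>r\<in>R. length (concat (map wd r)))"
  have n: "a \<in> A \<Longrightarrow> length (wd a @ wd (inverse_letter a)) \<le> n" "r \<in> R \<Longrightarrow> length (concat (map wd r)) \<le> n"
    for a r
    using member_le_sum[of a A "\<lambda>a. length (wd a @ wd (inverse_letter a))"] fA
      member_le_sum[of r R "\<lambda>r. length (concat (map wd r))"] X(2) by (auto simp: n_def)
  show ?thesis
  proof (intro exI[of _ n] allI impI)
    fix K :: "'k monoid" and \<pi> ev
    assume "group K" and \<pi>: "\<forall>w. \<pi> w \<in> carrier K" "\<forall>u v. \<pi> (u @ v) = \<pi> u \<otimes>\<^bsub>K\<^esub> \<pi> v"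
      and ev: "ev \<in> hom K G" "\<forall>w. ev (\<pi> w) = val w"
      and rel: "\<forall>r. length r \<le> n \<longrightarrow> val r = \<one>\<^bsub>G\<^esub> \<longrightarrow> \<pi> r = \<one>\<^bsub>K\<^esub>"
    interpret K: group K by fact
    have pi_Nil: "\<pi> [] = \<one>\<^bsub>K\<^esub>" using rel val(1) by simp
    have pi_foldr: "foldr (\<otimes>\<^bsub>K\<^esub>) (map (\<lambda>a. \<pi> (wd a)) w) \<one>\<^bsub>K\<^esub> = \<pi> (concat (map wd w))" for w
      by (induction w) (auto simp: pi_Nil \<pi>(2))
    define \<Theta> where "\<Theta> w = \<pi> (concat (map wd w))" for w
    have \<Theta>_hom: "\<Theta> \<in> hom F K"
    proof (rule homI)
      fix u v assume uv: "u \<in> carrier F" "v \<in> carrier F"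
      have "foldr (\<otimes>\<^bsub>K\<^esub>) (map (\<lambda>a. \<pi> (wd a)) (foldr reduced_cons u v)) \<one>\<^bsub>K\<^esub> =
        foldr (\<otimes>\<^bsub>K\<^esub>) (map (\<lambda>a. \<pi> (wd a)) u) \<one>\<^bsub>K\<^esub> \<otimes>\<^bsub>K\<^esub> foldr (\<otimes>\<^bsub>K\<^esub>) (map (\<lambda>a. \<pi> (wd a)) v) \<one>\<^bsub>K\<^esub>"
      proof (rule foldr_reduced_cons_hom[where A = A])
        show "monoid K" by (rule K.monoid_axioms)
        show "\<pi> (wd a) \<otimes>\<^bsub>K\<^esub> \<pi> (wd (inverse_letter a)) = \<one>\<^bsub>K\<^esub>" if "a \<in> A" for a
          using rel h_inv[OF that] n(1)[OF that] \<pi>(2) by metis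
      qed (use \<pi>(1) F_lists uv in auto)
      then show "\<Theta> (u \<otimes>\<^bsub>F\<^esub> v) = \<Theta> u \<otimes>\<^bsub>K\<^esub> \<Theta> v" by (simp only: pi_foldr \<Theta>_def Fmult)
    qed (use \<pi>(1) \<Theta>_def in auto)
    interpret \<Theta>: group_hom F K \<Theta>
      by (intro group_hom.intro group_hom_axioms.intro F.group_axioms K.group_axioms \<Theta>_hom)
    have "R \<subseteq> kernel F K \<Theta>"
      using X(3) rel relator n(2) by (auto simp: kernel_def F_def \<Theta>_def)
    then have N_ker: "N \<subseteq> kernel F K \<Theta>"
      unfolding N_def by (intro normal_closure_normal \<Theta>.normal_kernel)
    obtain g where g: "g \<in> hom (F Mod N) K" "\<And>w. w \<in> carrier F \<Longrightarrow> g (N #>\<^bsub>F\<^esub> w) = \<Theta> w"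
      using \<Theta>.FactGroup_universal_kernel[OF N.normal_axioms N_ker] by blast
    show "\<exists>\<phi>\<in>hom (G\<lparr>carrier := H\<rparr>) K. \<forall>h\<in>H. ev (\<phi> h) = h"
    proof (intro bexI[of _ "g \<circ> \<psi>"] ballI)
      show "g \<circ> \<psi> \<in> hom (G\<lparr>carrier := H\<rparr>) K" by (rule Group.hom_compose[OF \<psi>_hom g(1)])
      fix x assume "x \<in> H"
      then have "\<psi> x \<in> carrier (F Mod N)" using \<psi>_surj by auto
      then obtain w where w: "w \<in> carrier F" "\<psi> x = N #>\<^bsub>F\<^esub> w" by (auto simp: carrier_FactGroup)
      \<comment> \<open>The word substituted for \<open>w\<close> has a value in \<open>H\<close>
        with the same image under \<psi> as \<open>x\<close>, hence the value
        \<open>x\<close>.\<close>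
      have "ev ((g \<circ> \<psi>) x) = val (concat (map wd w))" using w g(2) ev(2) by (simp add: \<Theta>_def)
      moreover have "val (concat (map wd w)) \<in> H" "\<psi> (val (concat (map wd w))) = \<psi> x"
        using \<psi>val F_lists[OF w(1)] w(2) by metis+
      ultimately show "ev ((g \<circ> \<psi>) x) = x" using \<psi>_inj \<open>x \<in> H\<close> inj_onD by metis
    qed
  qed
qed

section \<open>Word metrics\<close>

locale word_metric_group = group G for G :: "('a, 'b) monoid_scheme" (structure) +
  fixes S :: "'a set"
  assumes gens: "finite_generating_set G S"
begin

definition letters :: "'a set" where "letters = S \<union> m_inv G ` S"

abbreviation wl :: "'a \<Rightarrow> nat" where "wl \<equiv> word_length G S"

abbreviation word_val :: "'a list \<Rightarrow> 'a" where "word_val ws \<equiv> foldr (\<otimes>) ws \<one>"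

text \<open>The word metric with values in the natural numbers, as the local theory expects
  it.\<close>

definition nd :: "'a \<Rightarrow> 'a \<Rightarrow> nat" where "nd x y = wl (inv x \<otimes> y)"

lemma word_dist_nd: "word_dist G S x y = real (nd x y)"
  by (simp add: word_dist_def nd_def)

lemma finite_letters: "finite letters"
  using gens by (simp add: letters_def finite_generating_set_def)

lemma letters_carrier: "letters \<subseteq> carrier G"
  using gens by (auto simp: letters_def finite_generating_set_def)

lemma letters_inv: "x \<in> letters \<Longrightarrow> inv x \<in> letters"
  using gens by (auto simp: letters_def finite_generating_set_def)

lemma word_val_closed: "set ws \<subseteq> carrier G \<Longrightarrow> word_val ws \<in> carrier G"
  by (induction ws) auto

lemma word_val_append:
  "set us \<subseteq> carrier G \<Longrightarrow> set vs \<subseteq> carrier G \<Longrightarrow> word_val (us @ vs) = word_val us \<otimes> word_val vs"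
  by (induction us) (auto simp: m_assoc word_val_closed)

lemma ex_word:
  assumes "x \<in> carrier G" shows "\<exists>ws. set ws \<subseteq> letters \<and> word_val ws = x"
proof -
  have "x \<in> generate G S" using assms gens by (simp add: finite_generating_set_def)
  then show ?thesis
  proof induction
    case one
    then show ?case by (intro exI[of _ "[]"]) auto
  next
    case (incl h)
    then show ?case using letters_carrier by (intro exI[of _ "[h]"]) (auto simp: letters_def)
  next
    case (inv h)
    then show ?case using letters_carrier by (intro exI[of _ "[inv h]"]) (auto simp: letters_def)
  next
    case (eng h1 h2)
    then obtain us vs where "set us \<subseteq> letters" "word_val us = h1" "set vs \<subseteq> letters" "word_val vs = h2"
      by blast
    then show ?case using letters_carrier word_val_append[of us vs] by (intro exI[of _ "us @ vs"]) auto
  qed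
qed

lemma wl_word:
  assumes "x \<in> carrier G" shows "\<exists>ws. length ws = wl x \<and> set ws \<subseteq> letters \<and> word_val ws = x"
proof -
  have "\<exists>n ws. length ws = n \<and> set ws \<subseteq> letters \<and> word_val ws = x" using ex_word[OF assms] by blast
  from LeastI_ex[OF this] show ?thesis unfolding word_length_def letters_def .
qed

lemma wl_le: "set ws \<subseteq> letters \<Longrightarrow> wl (word_val ws) \<le> length ws"
  unfolding word_length_def letters_def by (intro Least_le) blast

lemma wl_one [simp]: "wl \<one> = 0"
  using wl_le[of "[]"] by simp

lemma wl_eq_0: "x \<in> carrier G \<Longrightarrow> wl x = 0 \<longleftrightarrow> x = \<one>"
  using wl_word[of x] by auto

lemma wl_mult:
  assumes "x \<in> carrier G" "y \<in> carrier G" shows "wl (x \<otimes> y) \<le> wl x + wl y"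
proof -
  obtain us vs where "length us = wl x" "set us \<subseteq> letters" "word_val us = x"
    "length vs = wl y" "set vs \<subseteq> letters" "word_val vs = y" using wl_word assms by metis
  then show ?thesis using wl_le[of "us @ vs"] word_val_append[of us vs] letters_carrier by auto
qed

lemma word_val_rev_inv:
  "set ws \<subseteq> carrier G \<Longrightarrow> word_val (rev (map (m_inv G) ws)) = inv (word_val ws)"
proof (induction ws)
  case (Cons a ws)
  then have "word_val (rev (map (m_inv G) (a # ws))) = word_val (rev (map (m_inv G) ws)) \<otimes> inv a"
    using word_val_append[of "rev (map (m_inv G) ws)" "[inv a]"] by auto
  then show ?case using Cons by (simp add: inv_mult_group word_val_closed)
qed simp

lemma wl_inv [simp]:
  assumes "x \<in> carrier G" shows "wl (inv x) = wl x"
proof -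
  have le: "wl (inv x) \<le> wl x" if "x \<in> carrier G" for x
  proof -
    obtain ws where "length ws = wl x" "set ws \<subseteq> letters" "word_val ws = x" using wl_word \<open>x \<in> carrier G\<close> by metis
    then show ?thesis
      using wl_le[of "rev (map (m_inv G) ws)"] word_val_rev_inv[of ws] letters_inv letters_carrier by auto
  qed
  show ?thesis using le[of x] le[of "inv x"] assms by simp
qed

lemma nd_self [simp]: "x \<in> carrier G \<Longrightarrow> nd x x = 0" by (simp add: nd_def)

lemma nd_eq_0: "x \<in> carrier G \<Longrightarrow> y \<in> carrier G \<Longrightarrow> nd x y = 0 \<longleftrightarrow> x = y"
  by (metis inv_closed inv_solve_left m_closed nd_def one_closed r_one wl_eq_0)

lemma nd_sym: "x \<in> carrier G \<Longrightarrow> y \<in> carrier G \<Longrightarrow> nd x y = nd y x"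
  using wl_inv[of "inv x \<otimes> y"] by (simp add: nd_def inv_mult_group)

lemma nd_tri:
  assumes "x \<in> carrier G" "y \<in> carrier G" "z \<in> carrier G" shows "nd x z \<le> nd x y + nd y z"
proof -
  have "inv x \<otimes> z = (inv x \<otimes> y) \<otimes> (inv y \<otimes> z)"
    using assms by (simp add: m_assoc inv_solve_left) (metis inv_closed m_assoc m_closed r_inv l_one)
  then show ?thesis using wl_mult[of "inv x \<otimes> y" "inv y \<otimes> z"] assms by (simp add: nd_def)
qed

lemma nd_left [simp]:
  assumes "g \<in> carrier G" "x \<in> carrier G" "y \<in> carrier G" shows "nd (g \<otimes> x) (g \<otimes> y) = nd x y"
proof -
  have "inv (g \<otimes> x) \<otimes> (g \<otimes> y) = inv x \<otimes> y"
    using assms by (simp add: inv_mult_group m_assoc) (metis inv_closed l_inv l_one m_assoc)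
  then show ?thesis by (simp add: nd_def)
qed

lemma nd_one: "x \<in> carrier G \<Longrightarrow> nd \<one> x = wl x" by (simp add: nd_def)

lemma nd_mult: "x \<in> carrier G \<Longrightarrow> y \<in> carrier G \<Longrightarrow> nd x (x \<otimes> y) = wl y"
  using nd_left[of x \<one> y] by (simp add: nd_one)

definition four_point_below :: "nat \<Rightarrow> nat \<Rightarrow> bool" where
  "four_point_below q N \<longleftrightarrow> (\<forall>c\<in>carrier G. \<forall>x\<in>carrier G. \<forall>y\<in>carrier G. \<forall>z\<in>carrier G. \<forall>w\<in>carrier G.
     nd c x \<le> N \<longrightarrow> nd c y \<le> N \<longrightarrow> nd c z \<le> N \<longrightarrow> nd c w \<le> N \<longrightarrow>
     nd x y + nd z w \<le> nd x z + nd y w + q \<or> nd x y + nd z w \<le> nd x w + nd y z + q)"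

lemma four_point_belowD:
  assumes "four_point_below q N" "x \<in> carrier G" "y \<in> carrier G" "z \<in> carrier G" "w \<in> carrier G"
    "c \<in> carrier G" "nd c x \<le> N" "nd c y \<le> N" "nd c z \<le> N" "nd c w \<le> N"
  shows "nd x y + nd z w \<le> nd x z + nd y w + q \<or> nd x y + nd z w \<le> nd x w + nd y z + q"
  using assms unfolding four_point_below_def by blast

end

section \<open>Finitely presented subgroups\<close>

context word_metric_group
begin

text \<open>Natural numbers name the letters, possibly several times, and \<one> as well. Every word
  over \<open>letters\<close>, in particular a geodesic one, is thus \<open>map f\<close> of a list
  of numbers.\<close>

lemma local_hyperbolic_words_val:
  assumes f: "range f = insert \<one> letters" and q: "1 \<le> q" and four: "four_point_below q (100000 * q)"
  defines "val \<equiv> \<lambda>w. word_val (map f w)"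
  shows "local_hyperbolic_words (\<lambda>u v. nd (val u) (val v)) q (100000 * q)"
proof -
  have fc: "f s \<in> carrier G" for s
    using letters_carrier f by (metis insert_iff one_closed rangeI subsetD)
  have vc [simp]: "val w \<in> carrier G" for w
    unfolding val_def by (rule word_val_closed) (use fc in auto)
  have va: "val (u @ v) = val u \<otimes> val v" for u v
    unfolding val_def map_append by (rule word_val_append) (use fc in auto)
  have fl: "wl (f s) \<le> 1" for s
  proof (cases "f s = \<one>")
    case False
    then have "f s \<in> letters" using f by blast
    then show ?thesis using wl_le[of "[f s]"] fc[of s] by simp
  qed simp
  show ?thesis
  proof unfold_locales
    show "nd (val u) (val u) = 0" for u by simp
    show "nd (val u) (val v) = nd (val v) (val u)" for u v by (rule nd_sym) simp_all
    show "nd (val u) (val w) \<le> nd (val u) (val v) + nd (val v) (val w)" for u v w by (rule nd_tri) simp_all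
    show "nd (val x) (val y) + nd (val z) (val w) \<le> nd (val x) (val z) + nd (val y) (val w) + q \<or>
      nd (val x) (val y) + nd (val z) (val w) \<le> nd (val x) (val w) + nd (val y) (val z) + q"
      if "nd (val c) (val x) \<le> 100000 * q" "nd (val c) (val y) \<le> 100000 * q"
        "nd (val c) (val z) \<le> 100000 * q" "nd (val c) (val w) \<le> 100000 * q" for c x y z w
      using four_point_belowD[OF four] that vc by blast
    show "1 \<le> q" by fact
    show "nd (val u) (val (u @ [s])) \<le> 1" for u s
    proof -
      have "val [s] = f s" using fc by (simp add: val_def)
      then show ?thesis using fl[of s] fc by (simp add: va nd_mult)
    qed
    show "nd (val (w @ u)) (val (w @ v)) = nd (val u) (val v)" for u v w by (simp add: va)
    show "nd (val (u @ g)) (val (v @ g)) = 0" if "nd (val u) (val v) = 0" for u v g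
      using that by (simp add: va nd_eq_0)
    show "\<exists>g. length g = nd (val u) (val v) \<and> nd (val (u @ g)) (val v) = 0" for u v
    proof -
      obtain ws where ws: "length ws = nd (val u) (val v)" "set ws \<subseteq> letters"
        "word_val ws = inv (val u) \<otimes> val v"
        using wl_word[of "inv (val u) \<otimes> val v"] by (auto simp: nd_def)
      have "\<exists>g. ws = map f g"
        using ws(2) f by (metis (no_types, lifting) ex_map_conv insert_iff rangeE subset_iff)
      then obtain g where g: "ws = map f g" by blast
      have "val g = inv (val u) \<otimes> val v" using ws(3) unfolding g val_def .
      then have "val (u @ g) = val u \<otimes> (inv (val u) \<otimes> val v)" by (simp add: va)
      also have "\<dots> = val v" using m_assoc[of "val u" "inv (val u)" "val v"] by simp
      finally show ?thesis using ws(1) g by auto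
    qed
    show "\<exists>s'. nd (val [s, s']) (val []) = 0" for s
    proof -
      have "inv (f s) \<in> insert \<one> letters"
        using f letters_inv by (metis insert_iff inv_one rangeI)
      then obtain s' where "f s' = inv (f s)" using f by (metis rangeE)
      then have "val [s, s'] = val []" using fc by (simp add: val_def)
      then show ?thesis by (intro exI[of _ s']) simp
    qed
    show "100000 * q \<le> 100000 * q" by simp
  qed
qed

text \<open>The order of choices matters: the presentation of \<open>H\<close> fixes
  \<open>n\<close>, then a scale \<open>q \<ge> n\<close> is taken at which \<open>G\<close> looks
  hyperbolic. Relations of length at most \<open>n\<close> are then short enough for
  \<open>acts_short\<close>.\<close>

lemma hyperbolic_overgroup:
  assumes four: "\<And>k Q. \<exists>q\<ge>Q. four_point_below q (k * q)"
    and H: "subgroup H G" "finitely_presented (G\<lparr>carrier := H\<rparr>)"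
  shows "\<exists>(K :: nat monoid) L. hyperbolic_group K \<and> subgroup L K \<and> G\<lparr>carrier := H\<rparr> \<cong> K\<lparr>carrier := L\<rparr>"
proof -
  obtain ls where ls: "set ls = letters" using finite_list[OF finite_letters] by blast
  \<comment> \<open>The default \<one> makes all but finitely many letters trivial, as
    \<open>hyperbolic_dev_group\<close> asks.\<close>
  define f where "f i = (if i < length ls then ls ! i else \<one>)" for i
  have f: "range f = insert \<one> letters"
  proof
    show "range f \<subseteq> insert \<one> letters" using ls by (auto simp: f_def)
    show "insert \<one> letters \<subseteq> range f"
    proof
      fix x assume "x \<in> insert \<one> letters"
      moreover have "\<one> = f (length ls)" by (simp add: f_def)
      moreover have "\<exists>i. x = f i" if "x \<in> set ls" for x
        using that unfolding in_set_conv_nth f_def by force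
      ultimately show "x \<in> range f" using ls by blast
    qed
  qed
  have fc: "f s \<in> carrier G" for s
    using letters_carrier f by (metis insert_iff one_closed rangeI subsetD)
  define val where "val w = word_val (map f w)" for w
  have vc [simp]: "val w \<in> carrier G" for w
    unfolding val_def by (rule word_val_closed) (use fc in auto)
  have va: "val (u @ v) = val u \<otimes> val v" for u v
    unfolding val_def map_append by (rule word_val_append) (use fc in auto)
  have v0: "val [] = \<one>" by (simp add: val_def)
  have vr: "range val = carrier G"
  proof
    show "carrier G \<subseteq> range val"
    proof
      fix x assume "x \<in> carrier G"
      then obtain ws where ws: "set ws \<subseteq> letters" "word_val ws = x" using ex_word by blast
      have "\<exists>g. ws = map f g"
        using ws(1) f by (metis (no_types, lifting) ex_map_conv insert_iff rangeE subset_iff)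
      then show "x \<in> range val" using ws(2) by (auto simp: val_def)
    qed
  qed auto
  obtain n where n: "\<forall>(K :: nat monoid) \<pi> ev. group K \<longrightarrow> (\<forall>w. \<pi> w \<in> carrier K) \<longrightarrow>
    (\<forall>u v. \<pi> (u @ v) = \<pi> u \<otimes>\<^bsub>K\<^esub> \<pi> v) \<longrightarrow> ev \<in> hom K G \<longrightarrow> (\<forall>w. ev (\<pi> w) = val w) \<longrightarrow>
    (\<forall>r. length r \<le> n \<longrightarrow> val r = \<one> \<longrightarrow> \<pi> r = \<one>\<^bsub>K\<^esub>) \<longrightarrow>
    (\<exists>\<phi>\<in>hom (G\<lparr>carrier := H\<rparr>) K. \<forall>h\<in>H. ev (\<phi> h) = h)"
    using finitely_presented_lift[OF group_axioms H v0 va vr] by blast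
  obtain q where q: "max 1 n \<le> q" "four_point_below q (100000 * q)" using four by blast
  interpret L: local_hyperbolic_words "\<lambda>u v. nd (val u) (val v)" q "100000 * q"
    unfolding val_def by (rule local_hyperbolic_words_val[OF f]) (use q in auto)
  define K where "K = L.dev_group"
  have "hyperbolic_group K"
    unfolding K_def
  proof (rule L.hyperbolic_dev_group)
    show "nd (val [s]) (val []) = 0" if "length ls \<le> s" for s using that by (simp add: val_def f_def)
  qed
  interpret K: group K unfolding K_def by (rule L.group_dev_group)
  interpret H: group "G\<lparr>carrier := H\<rparr>" using subgroup_imp_group[OF H(1)] .
  define \<pi> where "\<pi> w = to_nat (L.acts [] w)" for w :: "nat list"
  define ev where "ev x = val (from_nat x)" for x :: nat
  have va': "val (L.acts u v) = val u \<otimes> val v" if "u \<in> L.Lam" for u v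
    using L.D_acts[OF that, of v] by (simp add: nd_eq_0 va)
  have "\<exists>\<phi>\<in>hom (G\<lparr>carrier := H\<rparr>) K. \<forall>h\<in>H. ev (\<phi> h) = h"
  proof (rule n[rule_format, of K \<pi> ev])
    show "group K" ..
    show "\<pi> w \<in> carrier K" for w
      using L.acts_Lam[OF L.Nil_Lam] by (simp add: \<pi>_def K_def L.dev_group_simps)
    show "\<pi> (u @ v) = \<pi> u \<otimes>\<^bsub>K\<^esub> \<pi> v" for u v
      using L.acts_acts_Nil[OF L.acts_Lam[OF L.Nil_Lam], of u v]
      by (simp add: \<pi>_def K_def L.dev_group_simps)
    show "ev \<in> hom K G"
      by (rule homI) (auto simp: K_def L.dev_group_simps ev_def va')
    show "ev (\<pi> w) = val w" for w
      using va'[OF L.Nil_Lam, of w] by (simp add: ev_def \<pi>_def v0)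
    show "\<pi> r = \<one>\<^bsub>K\<^esub>" if "length r \<le> n" "val r = \<one>" for r
      using L.acts_short[OF L.Nil_Lam, of r "[]"] that q(1) v0
      by (simp add: \<pi>_def K_def L.dev_group_simps)
  qed
  then obtain \<phi> where \<phi>: "\<phi> \<in> hom (G\<lparr>carrier := H\<rparr>) K" "\<And>h. h \<in> H \<Longrightarrow> ev (\<phi> h) = h" by blast
  interpret \<phi>: group_hom "G\<lparr>carrier := H\<rparr>" K \<phi>
    by (intro group_hom.intro group_hom_axioms.intro H.group_axioms K.group_axioms \<phi>(1))
  have "subgroup (\<phi> ` H) K" using \<phi>.img_is_subgroup by simp
  moreover have "\<phi> \<in> iso (G\<lparr>carrier := H\<rparr>) (K\<lparr>carrier := \<phi> ` H\<rparr>)"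
    using \<phi>(1) inj_on_inverseI[of H ev \<phi>] \<phi>(2) by (auto simp: iso_def bij_betw_def hom_def)
  ultimately show ?thesis using \<open>hyperbolic_group K\<close> by (auto simp: is_iso_def)
qed

end

section \<open>Bounded torsion subgroups\<close>

context word_metric_group
begin

lemma wl_pow: "x \<in> carrier G \<Longrightarrow> wl (x [^] (i::nat)) \<le> i * wl x"
proof (induction i)
  case (Suc i)
  then show ?case using wl_mult[of "x [^] i" x] by simp
qed simp

lemma nd_pow:
  assumes "x \<in> carrier G" "i \<le> j" shows "nd (x [^] (i::nat)) (x [^] (j::nat)) = wl (x [^] (j - i))"
  using nd_mult[of "x [^] i" "x [^] (j - i)"] assms by (simp add: nat_pow_mult)

text \<open>For \<open>\<one>\<close>, \<open>x\<close>, \<open>x [^] 2\<close> and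
  \<open>x [^] (k + 2)\<close> a long square excludes one alternative of the four point condition if
  \<open>x [^] (k + 1)\<close> is longer than \<open>x [^] k\<close>; the other then makes
  \<open>x [^] (k + 2)\<close> longer still. Such growth cannot end at
  \<open>x [^] n = \<one>\<close>.\<close>

lemma torsion_square_length:
  assumes four: "four_point_below q N" and x: "x \<in> carrier G" "x [^] (n::nat) = \<one>" "1 \<le> n"
    and N: "n * wl x \<le> N"
  shows "wl (x [^] (2::nat)) \<le> wl x + q"
proof (rule ccontr)
  assume big: "\<not> ?thesis"
  define a where "a k = wl (x [^] (k::nat))" for k
  have a1: "a 1 = wl x" "a 1 + q < a 2" using x big by (auto simp: a_def)
  have N': "nd \<one> (x [^] i) \<le> N" if "i \<le> n" for i
  proof -
    have "wl (x [^] i) \<le> i * wl x" using wl_pow[OF x(1)] .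
    also have "\<dots> \<le> n * wl x" using that by simp
    finally show ?thesis using N x(1) by (simp add: nd_one)
  qed
  have c: "x [^] i \<in> carrier G" for i :: nat using x(1) by simp
  have "1 \<le> k \<Longrightarrow> k < n \<Longrightarrow> a k < a (Suc k)" for k
  proof (induction k)
    case (Suc k)
    show ?case
    proof (cases "k = 0")
      case True
      then show ?thesis using a1 by (simp add: numeral_2_eq_2)
    next
      case False
      then have IH: "a k < a (Suc k)" using Suc by auto
      have "nd (x [^] (0::nat)) (x [^] (2::nat)) + nd (x [^] (1::nat)) (x [^] Suc (Suc k)) \<le>
          nd (x [^] (0::nat)) (x [^] (1::nat)) + nd (x [^] (2::nat)) (x [^] Suc (Suc k)) + q \<or>
        nd (x [^] (0::nat)) (x [^] (2::nat)) + nd (x [^] (1::nat)) (x [^] Suc (Suc k)) \<le>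
          nd (x [^] (0::nat)) (x [^] Suc (Suc k)) + nd (x [^] (2::nat)) (x [^] (1::nat)) + q"
        by (rule four_point_belowD[OF four c c c c one_closed N' N' N' N']) (use Suc.prems False in linarith)+
      then have "a 2 + a (Suc k) \<le> a 1 + a k + q \<or> a 2 + a (Suc k) \<le> a (Suc (Suc k)) + a 1 + q"
        using nd_pow[OF x(1), of 0 2] nd_pow[OF x(1), of 1 "Suc (Suc k)"] nd_pow[OF x(1), of 0 1]
          nd_pow[OF x(1), of 2 "Suc (Suc k)"] nd_pow[OF x(1), of 0 "Suc (Suc k)"] False
          nd_pow[OF x(1), of 1 2] nd_sym[of "x [^] (2::nat)" "x [^] (1::nat)"] x(1)
        by (simp add: a_def del: nat_pow_Suc nat_pow_0)
      then show ?thesis using IH a1 by auto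
    qed
  qed simp
  moreover have "n \<noteq> 1" using big x by auto
  then have "1 \<le> n - 1" "n - 1 < n" "Suc (n - 1) = n" using x(3) by auto
  ultimately have "a (n - 1) < a n" by metis
  then show False using x(2) by (simp add: a_def)
qed

text \<open>Let \<open>x = inv g \<otimes> h\<close>. The bound on \<open>x \<otimes> x\<close>
  gives \<open>wl (x \<otimes> inv g) \<le> wl g + 2 * q\<close>, whence
  \<open>nd g h + nd (inv g) (inv h) \<le> 2 * wl g + 4 * q\<close>. The bounds on the squares of
  \<open>g\<close> and \<open>h\<close> show that \<open>nd g h\<close> is at most
  \<open>wl g + 4 * q\<close> or at most \<open>nd (inv g) (inv h) + 2 * q\<close>; in the second
  case the sum gives the claim.\<close>

lemma torsion_pair_close:
  assumes four: "four_point_below q N" and gh: "g \<in> carrier G" "h \<in> carrier G"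
    and sq: "\<And>x. x \<in> {g, h, inv g \<otimes> h} \<Longrightarrow> wl (x \<otimes> x) \<le> wl x + q"
    and diff: "wl g \<le> wl h + q" "wl h \<le> wl g + q" and N: "3 * wl g + 3 * wl h \<le> N"
  shows "nd g h \<le> wl g + 4 * q"
proof -
  define x where "x = inv g \<otimes> h"
  have x: "x \<in> carrier G" using gh by (simp add: x_def)
  have lx: "wl x = nd g h" by (simp add: x_def nd_def)
  have xh: "x = inv g \<otimes> h" "x \<otimes> x = x \<otimes> inv g \<otimes> h" "h \<otimes> inv g = inv (inv g) \<otimes> (x \<otimes> inv g)"
    using gh by (simp_all add: x_def m_assoc flip: m_assoc[of g "inv g"])
  have D: "nd \<one> x = nd g h" "nd \<one> (inv g) = wl g" "nd x (x \<otimes> inv g) = wl g" "nd x (inv g) = wl h"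
    "nd (inv g) x = wl h" "nd x (x \<otimes> x) = nd g h" "nd (x \<otimes> inv g) (x \<otimes> x) = wl h"
    "nd (x \<otimes> inv g) x = wl g" "nd (inv g) (x \<otimes> inv g) = nd (inv g) (inv h)"
    "nd \<one> g = wl g" "nd \<one> h = wl h" "nd \<one> (inv h) = wl h"
  proof -
    show "nd \<one> x = nd g h" "nd \<one> (inv g) = wl g" "nd x (x \<otimes> inv g) = wl g" "nd x (x \<otimes> x) = nd g h"
      "nd \<one> g = wl g" "nd \<one> h = wl h" "nd \<one> (inv h) = wl h"
      using x gh by (simp_all add: nd_one nd_mult lx)
    show "nd (inv g) x = wl h" using gh by (simp add: x_def nd_mult)
    then show "nd x (inv g) = wl h" using nd_sym[of x "inv g"] x gh by simp
    show "nd (x \<otimes> inv g) (x \<otimes> x) = wl h" unfolding xh(2) by (rule nd_mult) (use x gh in auto)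
    show "nd (x \<otimes> inv g) x = wl g" using nd_sym[of "x \<otimes> inv g" x] x gh by (simp add: nd_mult)
    have "nd (inv g) (x \<otimes> inv g) = wl (h \<otimes> inv g)" unfolding nd_def xh(3) ..
    also have "\<dots> = wl (inv (h \<otimes> inv g))" using gh by simp
    also have "inv (h \<otimes> inv g) = inv (inv g) \<otimes> inv h" using gh by (simp add: inv_mult_group)
    finally show "nd (inv g) (x \<otimes> inv g) = nd (inv g) (inv h)" by (simp add: nd_def)
  qed
  have gg: "nd (inv g) g \<le> wl g + q" "nd (inv h) h \<le> wl h + q"
    using sq[of g] sq[of h] gh by (auto simp: nd_def)
  have "wl (x \<otimes> x) \<le> wl x + q" by (rule sq) (simp add: x_def)
  then have xx: "nd \<one> (x \<otimes> x) \<le> nd g h + q" using x by (simp add: nd_one lx)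
  have tri: "nd g h \<le> wl g + wl h" using nd_tri[of g \<one> h] gh D nd_sym[of g \<one>] by simp
  have tri2: "nd \<one> (x \<otimes> inv g) \<le> 2 * wl g + wl h" "nd \<one> (x \<otimes> x) \<le> 2 * wl g + 2 * wl h"
    using nd_tri[of \<one> x "x \<otimes> inv g"] nd_tri[of \<one> x "x \<otimes> x"] D tri x gh by auto
  have carr: "\<one> \<in> carrier G" "x \<in> carrier G" "inv g \<in> carrier G" "x \<otimes> inv g \<in> carrier G" "x \<otimes> x \<in> carrier G"
    "inv h \<in> carrier G" using x gh by auto
  have one: "nd \<one> \<one> = 0" by simp
  note four1 = four_point_belowD[OF four carr(1,2,3,4,1)]
  note four2 = four_point_belowD[OF four carr(1,4,2,5,1)]
  note four3 = four_point_belowD[OF four carr(1,3) gh(1) carr(6,1)]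
  note four4 = four_point_belowD[OF four carr(1,6) gh carr(1)]
  have 1: "nd g h + nd (inv g) (inv h) \<le> 2 * wl g + q \<or>
      nd g h + nd (inv g) (inv h) \<le> nd \<one> (x \<otimes> inv g) + wl h + q"
    using four1 D tri tri2 N one by auto
  have 2: "nd \<one> (x \<otimes> inv g) + nd g h \<le> nd g h + wl h + q \<or>
      nd \<one> (x \<otimes> inv g) + nd g h \<le> nd \<one> (x \<otimes> x) + wl g + q"
    using four2 D tri tri2 N one by auto
  have 3: "wl g + nd g (inv h) \<le> wl g + nd (inv g) (inv h) + q \<or>
      wl g + nd g (inv h) \<le> wl h + nd (inv g) g + q"
    using four3 D N one by auto
  have 4: "wl h + nd g h \<le> wl g + nd (inv h) h + q \<or> wl h + nd g h \<le> wl h + nd g (inv h) + q"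
    using four4 D N one nd_sym[of "inv h" g] gh by auto
  show ?thesis using 1 2 3 4 gg xx diff by linarith
qed

text \<open>Since \<open>h\<close> and \<open>inv h\<close> are not much farther from
  \<open>g\<close> than \<open>wl g\<close>, the midpoint \<open>p\<close> of a geodesic to
  \<open>g\<close> is within \<open>wl p + 6 * q\<close> of both. So \<open>p\<close> is nearly
  halfway between \<open>\<one>\<close> and \<open>h\<close>, and so is
  \<open>h \<otimes> p\<close>, whose distance to \<open>\<one>\<close> is that of \<open>p\<close>
  to \<open>inv h\<close>. The four point condition brings the two together.\<close>

lemma torsion_pair_midpoint:
  assumes four: "four_point_below q N" and gh: "g \<in> carrier G" "h \<in> carrier G" and p: "p \<in> carrier G"
    and mid: "wl p = wl g div 2" "nd p g = wl g - wl g div 2"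
    and close: "nd g h \<le> wl g + 4 * q" "nd g (inv h) \<le> wl g + 4 * q"
    and diff: "wl g \<le> wl h + q" "wl h \<le> wl g + q" and N: "3 * wl g + 3 * wl h \<le> N" and "1 \<le> q"
  shows "nd p (h \<otimes> p) \<le> 14 * q"
proof -
  have one: "nd \<one> \<one> = 0" by simp
  have pk: "nd p k \<le> wl p + 6 * q"
    if k: "k \<in> carrier G" "wl k = wl h" "nd g k \<le> wl g + 4 * q" for k
  proof -
    have "nd \<one> g + nd p k \<le> nd \<one> p + nd g k + q \<or> nd \<one> g + nd p k \<le> nd \<one> k + nd g p + q"
      by (rule four_point_belowD[OF four _ gh(1) p k(1) one_closed])
        (use gh p k N mid in \<open>auto simp: nd_one\<close>)
    then show ?thesis using gh p k mid diff nd_sym[of g p] \<open>1 \<le> q\<close> by (auto simp: nd_one)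
  qed
  have ph: "nd p h \<le> wl p + 6 * q" using pk[of h] gh close by auto
  have "nd (h \<otimes> p) \<one> = nd p (inv h)"
    using nd_left[of "inv h" "h \<otimes> p" \<one>] gh p by (simp flip: m_assoc)
  then have php: "nd \<one> (h \<otimes> p) \<le> wl p + 6 * q"
    using pk[of "inv h"] gh p close nd_sym[of "h \<otimes> p" \<one>] by auto
  have hp: "wl (h \<otimes> p) \<le> wl h + wl p" using wl_mult gh p by auto
  have "nd \<one> h + nd p (h \<otimes> p) \<le> nd \<one> p + nd h (h \<otimes> p) + q \<or>
      nd \<one> h + nd p (h \<otimes> p) \<le> nd \<one> (h \<otimes> p) + nd h p + q"
    by (rule four_point_belowD[OF four _ gh(2) p _ one_closed])
      (use gh p N mid hp in \<open>auto simp: nd_one\<close>)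
  then have "wl h + nd p (h \<otimes> p) \<le> wl p + wl p + q \<or> wl h + nd p (h \<otimes> p) \<le> 2 * wl p + 12 * q + q"
    using ph php nd_sym[of h p] gh p nd_mult[of h p] by (auto simp: nd_one)
  then show ?thesis using mid(1) diff by linarith
qed

text \<open>Shorter words are padded with \<one>, so that words of length exactly \<open>m\<close>
  over one more letter are counted.\<close>

lemma finite_ball: "finite {x \<in> carrier G. wl x \<le> m}"
  and card_ball: "card {x \<in> carrier G. wl x \<le> m} \<le> (card letters + 1) ^ m"
proof -
  have sub: "{x \<in> carrier G. wl x \<le> m} \<subseteq> word_val ` {ws. set ws \<subseteq> insert \<one> letters \<and> length ws = m}"
  proof
    fix x assume "x \<in> {x \<in> carrier G. wl x \<le> m}"
    then have x: "x \<in> carrier G" "wl x \<le> m" by auto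
    obtain ws where ws: "length ws = wl x" "set ws \<subseteq> letters" "word_val ws = x" using wl_word[OF x(1)] by blast
    define vs where "vs = ws @ replicate (m - wl x) \<one>"
    have "word_val (replicate k \<one>) = \<one>" for k by (induction k) auto
    then have "word_val vs = x"
      unfolding vs_def using ws x letters_carrier
      by (subst word_val_append) (auto simp: set_replicate_conv_if)
    moreover have "set vs \<subseteq> insert \<one> letters" "length vs = m" using ws x by (auto simp: vs_def)
    ultimately show "x \<in> word_val ` {ws. set ws \<subseteq> insert \<one> letters \<and> length ws = m}" by blast
  qed
  have fin: "finite {ws. set ws \<subseteq> insert \<one> letters \<and> length ws = m}"
    by (rule finite_lists_length_eq) (simp add: finite_letters)
  then show "finite {x \<in> carrier G. wl x \<le> m}" using finite_subset[OF sub] by blast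
  have "card {x \<in> carrier G. wl x \<le> m} \<le> card {ws. set ws \<subseteq> insert \<one> letters \<and> length ws = m}"
    using surj_card_le[OF fin sub] .
  also have "\<dots> = card (insert \<one> letters) ^ m"
    using card_lists_length_eq[of "insert \<one> letters" m] finite_letters by simp
  also have "\<dots> \<le> (card letters + 1) ^ m"
    by (rule power_mono) (auto simp: card_insert_if finite_letters)
  finally show "card {x \<in> carrier G. wl x \<le> m} \<le> (card letters + 1) ^ m" .
qed

text \<open>All elements of the layer almost fix the midpoint \<open>p\<close> of a geodesic from
  \<open>\<one>\<close> to one of them, \<open>g\<close>. Conjugation by \<open>p\<close> therefore
  sends the layer injectively into a ball of radius \<open>14 * q\<close>. The bound on
  \<open>N\<close> leaves room for the powers of \<open>inv g \<otimes> h\<close>, whose length is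
  at most \<open>2 * r\<close>.\<close>

lemma torsion_sphere_card:
  assumes four: "four_point_below q N" and H: "subgroup H G"
    and tors: "\<And>h. h \<in> H \<Longrightarrow> h [^] (n::nat) = \<one>" "1 \<le> n" and "1 \<le> q" and N: "10 * n * r \<le> N"
  shows "card {h \<in> H. wl h \<le> r \<and> wl h div q = i} \<le> (card letters + 1) ^ (14 * q)" (is "card ?C \<le> _")
proof (cases "?C = {}")
  case False
  then obtain g where g: "g \<in> H" "wl g \<le> r" "wl g div q = i" by blast
  have Hc: "h \<in> carrier G" if "h \<in> H" for h using that subgroup.mem_carrier[OF H] by blast
  have "10 * r \<le> 10 * n * r" using tors(2) by simp
  then have rN: "10 * r \<le> N" using N by linarith
  have sq: "wl (x \<otimes> x) \<le> wl x + q" if "x \<in> H" "wl x \<le> 2 * r" for x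
  proof -
    have "n * wl x \<le> n * (2 * r)" using that(2) by simp
    also have "\<dots> \<le> 10 * n * r" by simp
    finally have "n * wl x \<le> N" using N by linarith
    then show ?thesis
      using torsion_square_length[OF four Hc[OF that(1)] tors(1)[OF that(1)] tors(2)] Hc[OF that(1)]
      by (simp add: numeral_2_eq_2)
  qed
  have close: "nd g h \<le> wl g + 4 * q"
    if h: "h \<in> H" "wl h \<le> r" "wl g \<le> wl h + q" "wl h \<le> wl g + q" for h
  proof (rule torsion_pair_close[OF four])
    have gh: "inv g \<otimes> h \<in> H" using g(1) h(1) H by (simp add: subgroup.m_closed subgroup.m_inv_closed)
    have "wl (inv g \<otimes> h) \<le> 2 * r" using wl_mult[of "inv g" h] Hc g h by auto
    then show "wl (x \<otimes> x) \<le> wl x + q" if "x \<in> {g, h, inv g \<otimes> h}" for x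
      using that sq gh g h by auto
  qed (use g h Hc rN in auto)
  obtain ws where ws: "length ws = wl g" "set ws \<subseteq> letters" "word_val ws = g"
    using wl_word[OF Hc[OF g(1)]] by blast
  define a where "a = wl g div 2"
  define p p' where "p = word_val (take a ws)" and "p' = word_val (drop a ws)"
  have set: "set (take a ws) \<subseteq> letters" "set (drop a ws) \<subseteq> letters"
    using ws(2) set_take_subset[of a ws] set_drop_subset[of a ws] by auto
  then have pc: "p \<in> carrier G" "p' \<in> carrier G"
    unfolding p_def p'_def using letters_carrier by (blast intro: word_val_closed)+
  have gpp: "g = p \<otimes> p'"
    unfolding p_def p'_def using word_val_append[of "take a ws" "drop a ws"] set letters_carrier ws(3) by auto
  have le: "wl p \<le> a" "wl p' \<le> wl g - a" "wl g \<le> wl p + wl p'"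
    using wl_le[OF set(1), folded p_def] wl_le[OF set(2), folded p'_def] wl_mult[OF pc, folded gpp] ws(1)
    by (auto simp: a_def)
  then have mid: "wl p = wl g div 2" "nd p g = wl g - wl g div 2"
    using nd_mult[OF pc, folded gpp] by (auto simp: a_def)
  have "inv p \<otimes> h \<otimes> p \<in> {x \<in> carrier G. wl x \<le> 14 * q}" if "h \<in> ?C" for h
  proof -
    have h: "h \<in> H" "wl h \<le> r" "wl h div q = wl g div q" using that g by auto
    have "wl h = wl g div q * q + wl h mod q" "wl g = wl g div q * q + wl g mod q"
      "wl h mod q < q" "wl g mod q < q"
      using h(3) \<open>1 \<le> q\<close> by (metis div_mult_mod_eq, simp_all)
    then have d: "wl g \<le> wl h + q" "wl h \<le> wl g + q" by linarith+
    have hi: "inv h \<in> H" "wl (inv h) = wl h" using h(1) Hc H by (auto simp: subgroup.m_inv_closed)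
    have "nd p (h \<otimes> p) \<le> 14 * q"
      by (rule torsion_pair_midpoint[OF four _ _ pc(1) mid close close])
        (use g h Hc d hi rN \<open>1 \<le> q\<close> in auto)
    then show ?thesis using pc(1) Hc[OF h(1)] by (simp add: nd_def m_assoc)
  qed
  then have "(\<lambda>h. inv p \<otimes> h \<otimes> p) ` ?C \<subseteq> {x \<in> carrier G. wl x \<le> 14 * q}" by blast
  moreover have "inj_on (\<lambda>h. inv p \<otimes> h \<otimes> p) ?C"
  proof (rule inj_onI)
    fix h h' assume "h \<in> ?C" "h' \<in> ?C" "inv p \<otimes> h \<otimes> p = inv p \<otimes> h' \<otimes> p"
    then show "h = h'" using pc(1) Hc by auto
  qed
  ultimately have "card ?C \<le> card {x \<in> carrier G. wl x \<le> 14 * q}"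
    using card_inj_on_le finite_ball by blast
  then show ?thesis using card_ball[of "14 * q"] by linarith
next
  case True
  show ?thesis unfolding True by simp
qed

lemma torsion_ball_card:
  assumes "four_point_below q N" "subgroup H G" "\<And>h. h \<in> H \<Longrightarrow> h [^] (n::nat) = \<one>" "1 \<le> n" "1 \<le> q"
    "10 * n * r \<le> N"
  shows "card {h \<in> H. wl h \<le> r} \<le> (r div q + 1) * (card letters + 1) ^ (14 * q)"
proof -
  have "{h \<in> H. wl h \<le> r} = (\<Union>i\<in>{..r div q}. {h \<in> H. wl h \<le> r \<and> wl h div q = i})"
    using div_le_mono by auto
  then have "card {h \<in> H. wl h \<le> r} \<le> (\<Sum>i\<in>{..r div q}. card {h \<in> H. wl h \<le> r \<and> wl h div q = i})"
    using card_UN_le[of "{..r div q}" "\<lambda>i. {h \<in> H. wl h \<le> r \<and> wl h div q = i}"] by simp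
  also have "\<dots> \<le> (\<Sum>i\<in>{..r div q}. (card letters + 1) ^ (14 * q))"
    by (rule sum_mono) (use torsion_sphere_card[OF assms] in simp)
  finally show ?thesis by simp
qed

text \<open>Growth is measured with any finite generating set, whereas the local condition is known
  for \<open>S\<close>.\<close>

lemma word_length_comparison:
  assumes "finite_generating_set G T"
  shows "\<exists>C\<ge>1. \<forall>x\<in>carrier G. wl x \<le> C * word_length G T x"
proof -
  interpret T: word_metric_group G T by unfold_locales fact
  define C where "C = Max (insert 1 (wl ` T.letters))"
  have C: "1 \<le> C" "\<And>x. x \<in> T.letters \<Longrightarrow> wl x \<le> C"
    unfolding C_def using T.finite_letters by auto
  have "set ws \<subseteq> T.letters \<Longrightarrow> wl (word_val ws) \<le> C * length ws" for ws
  proof (induction ws)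
    case (Cons a ws)
    have "set (a # ws) \<subseteq> carrier G" using Cons.prems T.letters_carrier by blast
    then have "wl (word_val (a # ws)) \<le> wl a + wl (word_val ws)"
      using wl_mult[of a "word_val ws"] word_val_closed[of ws] by simp
    then show ?case using Cons C(2)[of a] by simp
  qed simp
  then show ?thesis using C(1) T.wl_word by metis
qed

text \<open>With \<open>d ^ k0 \<ge> 2 * s ^ 14\<close> the growth \<open>d ^ (k0 * q)\<close> at
  radius \<open>k0 * q\<close> exceeds \<open>s ^ (14 * q)\<close> by a factor of at least
  \<open>2 ^ q\<close>, while the number of layers, \<open>C * k0 + 1\<close>, does not depend on
  \<open>q\<close>. The constant \<open>C\<close> compares \<open>T\<close> with \<open>S\<close>;
  the ratio \<open>10 * n * C * k0\<close> is fixed before \<open>q\<close> is chosen.\<close>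

lemma torsion_growth:
  assumes four: "\<And>k Q. \<exists>q\<ge>Q. four_point_below q (k * q)"
    and H: "bounded_torsion_subgroup H G" and T: "finite_generating_set G T"
  shows "\<not> exponential_relative_growth H G T"
proof
  assume "exponential_relative_growth H G T"
  then obtain d n0 where d: "d > 1" "\<And>m. n0 \<le> m \<Longrightarrow> d ^ m \<le> real (relative_growth H G T m)"
    unfolding exponential_relative_growth_def eventually_sequentially by blast
  obtain n :: nat where n: "1 \<le> n" "\<And>h. h \<in> H \<Longrightarrow> h [^] n = \<one>" and sub: "subgroup H G"
    using H unfolding bounded_torsion_subgroup_def by blast
  obtain C where C: "1 \<le> C" "\<And>x. x \<in> carrier G \<Longrightarrow> wl x \<le> C * word_length G T x"
    using word_length_comparison[OF T] by blast
  define s where "s = card letters + 1"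
  obtain k0 where "2 * real s ^ 14 < d ^ k0" using real_arch_pow[OF d(1)] by blast
  then have k0: "2 * real s ^ 14 \<le> d ^ k0" by simp
  obtain q where q: "max n0 (C * k0 + 2) \<le> q" "four_point_below q ((10 * n * C * k0) * q)" using four by blast
  have k0': "k0 \<noteq> 0"
  proof
    assume "k0 = 0"
    moreover have "1 \<le> real s ^ 14" by (rule one_le_power) (simp add: s_def)
    ultimately show False using k0 by simp
  qed
  define r where "r = C * k0 * q"
  have "relative_growth H G T (k0 * q) \<le> card {h \<in> H. wl h \<le> r}"
    unfolding relative_growth_def
  proof (rule card_mono)
    have "{h \<in> H. wl h \<le> r} \<subseteq> {x \<in> carrier G. wl x \<le> r}"
      using subgroup.subset[OF sub] by blast
    then show "finite {h \<in> H. wl h \<le> r}" using finite_ball finite_subset by blast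
    show "{g \<in> carrier G. word_dist G T \<one> g \<le> real (k0 * q)} \<inter> H \<subseteq> {h \<in> H. wl h \<le> r}"
    proof
      fix g assume "g \<in> {g \<in> carrier G. word_dist G T \<one> g \<le> real (k0 * q)} \<inter> H"
      then have g: "g \<in> carrier G" "g \<in> H" "real (word_length G T g) \<le> real (k0 * q)"
        by (auto simp: word_dist_def)
      then have "C * word_length G T g \<le> r" unfolding r_def by (simp add: mult.assoc del: of_nat_mult)
      then show "g \<in> {h \<in> H. wl h \<le> r}" using C(2)[OF g(1)] g(2) by auto
    qed
  qed
  also have "\<dots> \<le> (r div q + 1) * s ^ (14 * q)"
    unfolding s_def by (rule torsion_ball_card[OF q(2) sub n(2,1)]) (use q(1) in \<open>auto simp: r_def\<close>)
  also have "r div q + 1 = C * k0 + 1" using q(1) by (simp add: r_def)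
  also have "(C * k0 + 1) * s ^ (14 * q) < 2 ^ q * s ^ (14 * q)"
  proof (rule mult_less_mono1)
    show "C * k0 + 1 < 2 ^ q" using q(1) less_exp[of q] by linarith
  qed (simp add: s_def)
  also have "2 ^ q * s ^ (14 * q) = (2 * s ^ 14) ^ q" by (simp add: power_mult_distrib flip: power_mult)
  finally have "real (relative_growth H G T (k0 * q)) < real ((2 * s ^ 14) ^ q)" by (simp only: of_nat_less_iff)
  also have "\<dots> = (2 * real s ^ 14) ^ q" by simp
  also have "\<dots> \<le> (d ^ k0) ^ q" by (rule power_mono[OF k0]) simp
  also have "\<dots> = d ^ (k0 * q)" by (simp add: power_mult)
  also have "\<dots> \<le> real (relative_growth H G T (k0 * q))"
  proof (rule d(2))
    have "q \<le> k0 * q" using k0' by simp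
    then show "n0 \<le> k0 * q" using q(1) by linarith
  qed
  finally show False by simp
qed

end

section \<open>Real trees satisfy the four point condition\<close>

lemma (in Metric_space) pathin_Lipschitz:
  assumes M: "\<And>s. s \<in> {0..1} \<Longrightarrow> p s \<in> M"
    and L: "\<And>s t. s \<in> {0..1} \<Longrightarrow> t \<in> {0..1} \<Longrightarrow> d (p s) (p t) \<le> L * \<bar>s - t\<bar>"
  shows "pathin mtopology p"
  unfolding pathin_def continuous_map_to_metric
proof (intro ballI allI impI)
  fix s :: real and e :: real assume "s \<in> topspace (top_of_set {0..1})" and "0 < e"
  then have s: "s \<in> {0..1}" by simp
  define L' where "L' = max L 1"
  have L': "1 \<le> L'" "L \<le> L'" by (auto simp: L'_def)
  show "\<exists>U. openin (top_of_set {0..1}) U \<and> s \<in> U \<and> (\<forall>y\<in>U. p y \<in> mball (p s) e)"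
  proof (intro exI[of _ "{0..1} \<inter> ball s (e / L')"] conjI ballI)
    show "openin (top_of_set {0..1}) ({0..1} \<inter> ball s (e / L'))" by (simp add: openin_open_Int)
    show "s \<in> {0..1} \<inter> ball s (e / L')" using s \<open>0 < e\<close> L' by simp
    fix t assume t: "t \<in> {0..1} \<inter> ball s (e / L')"
    then have "d (p s) (p t) \<le> L * \<bar>s - t\<bar>" using L s by blast
    also have "\<dots> \<le> L' * \<bar>s - t\<bar>" using L' by (simp add: mult_right_mono)
    also have "\<dots> < L' * (e / L')" using t L' by (intro mult_strict_left_mono) (auto simp: dist_real_def)
    also have "\<dots> = e" using L' by simp
    finally show "p t \<in> mball (p s) e" using M s t by simp
  qed
qed

definition geodesic_path :: "'a set \<Rightarrow> ('a \<Rightarrow> 'a \<Rightarrow> real) \<Rightarrow> real \<Rightarrow> (real \<Rightarrow> 'a) \<Rightarrow> bool" where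
  "geodesic_path M d l c \<longleftrightarrow> (\<forall>s\<in>{0..l}. c s \<in> M) \<and> (\<forall>s\<in>{0..l}. \<forall>t\<in>{0..l}. d (c s) (c t) = \<bar>s - t\<bar>)"

lemma R_tree_geodesic:
  assumes "R_tree M d" "x \<in> M" "y \<in> M"
  shows "\<exists>c. geodesic_path M d (d x y) c \<and> c 0 = x \<and> c (d x y) = y"
proof -
  have "\<forall>x\<in>M. \<forall>y\<in>M. \<exists>c. c 0 = x \<and> c (d x y) = y \<and> c ` {0..d x y} \<subseteq> M \<and>
      (\<forall>s\<in>{0..d x y}. \<forall>t\<in>{0..d x y}. d (c s) (c t) = \<bar>s - t\<bar>)"
    using assms(1) unfolding R_tree_def geodesic_space_def by (elim conjE)
  from bspec[OF bspec[OF this assms(2)] assms(3)]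
  obtain c where c: "c 0 = x" "c (d x y) = y" "c ` {0..d x y} \<subseteq> M"
    "\<forall>s\<in>{0..d x y}. \<forall>t\<in>{0..d x y}. d (c s) (c t) = \<bar>s - t\<bar>" by (elim exE conjE)
  have "geodesic_path M d (d x y) c" unfolding geodesic_path_def using c(3,4) by auto
  then show ?thesis using c(1,2) by blast
qed

lemma geodesic_path_mono: "geodesic_path M d l c \<Longrightarrow> k \<le> l \<Longrightarrow> geodesic_path M d k c"
  by (auto simp: geodesic_path_def)

lemma arc_between_rescale:
  assumes "Metric_space M d" "0 < l" "\<And>s. s \<in> {0..l} \<Longrightarrow> c s \<in> M" "inj_on c {0..l}"
    and L: "\<And>s t. s \<in> {0..l} \<Longrightarrow> t \<in> {0..l} \<Longrightarrow> d (c s) (c t) \<le> \<bar>s - t\<bar>"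
  shows "arc_between M d (c 0) (c l) (\<lambda>s. c (l * s))"
    and "(\<lambda>s. c (l * s)) ` {0..1} = c ` {0..l}"
proof -
  interpret Metric_space M d by fact
  have im: "(\<lambda>s. l * s) ` {0..1} = {0..l}" using \<open>0 < l\<close> by (simp add: image_mult_atLeastAtMost)
  then show "(\<lambda>s. c (l * s)) ` {0..1} = c ` {0..l}" by (metis (no_types, lifting) image_cong image_image)
  have mem: "l * s \<in> {0..l}" if "s \<in> {0..1}" for s using im that by blast
  have "pathin mtopology (\<lambda>s. c (l * s))"
  proof (rule pathin_Lipschitz)
    show "d (c (l * s)) (c (l * t)) \<le> l * \<bar>s - t\<bar>" if "s \<in> {0..1}" "t \<in> {0..1}" for s t
      using L[OF mem[OF that(1)] mem[OF that(2)]] \<open>0 < l\<close>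
      by (metis abs_mult abs_of_pos right_diff_distrib)
  qed (use mem assms(3) in blast)
  moreover have "inj_on (\<lambda>s. c (l * s)) {0..1}"
  proof (rule inj_onI)
    fix s t assume "s \<in> {0..1}" "t \<in> {0..1}" "c (l * s) = c (l * t)"
    then have "l * s = l * t" using inj_onD[OF assms(4)] mem by blast
    then show "s = t" using \<open>0 < l\<close> by simp
  qed
  ultimately show "arc_between M d (c 0) (c l) (\<lambda>s. c (l * s))" by (simp add: arc_between_def)
qed

lemma R_tree_unique_image:
  assumes T: "R_tree M d" and "0 < l" "0 < k"
    and c: "\<And>s. s \<in> {0..l} \<Longrightarrow> c s \<in> M" "inj_on c {0..l}"
      "\<And>s t. s \<in> {0..l} \<Longrightarrow> t \<in> {0..l} \<Longrightarrow> d (c s) (c t) \<le> \<bar>s - t\<bar>"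
    and e: "\<And>s. s \<in> {0..k} \<Longrightarrow> e s \<in> M" "inj_on e {0..k}"
      "\<And>s t. s \<in> {0..k} \<Longrightarrow> t \<in> {0..k} \<Longrightarrow> d (e s) (e t) \<le> \<bar>s - t\<bar>"
    and eq: "c 0 = e 0" "c l = e k"
  shows "c ` {0..l} = e ` {0..k}"
proof -
  have MS: "Metric_space M d" using T by (simp add: R_tree_def geodesic_space_def)
  note 1 = arc_between_rescale[OF MS \<open>0 < l\<close> c] and 2 = arc_between_rescale[OF MS \<open>0 < k\<close> e]
  have "c 0 \<in> M" "c l \<in> M" using c(1) \<open>0 < l\<close> by auto
  then have "(\<lambda>s. c (l * s)) ` {0..1} = (\<lambda>s. e (k * s)) ` {0..1}"
    using T 1(1) 2(1) unfolding R_tree_def eq by blast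
  then show ?thesis using 1(2) 2(2) by simp
qed

lemma geodesic_path_inj:
  "geodesic_path M d l c \<Longrightarrow> Metric_space M d \<Longrightarrow> inj_on c {0..l}"
  by (rule inj_onI) (metis Metric_space.zero abs_eq_0 eq_iff_diff_eq_0 geodesic_path_def)

lemma geodesic_path_Lipschitz:
  "geodesic_path M d l c \<Longrightarrow> s \<in> {0..l} \<Longrightarrow> t \<in> {0..l} \<Longrightarrow> d (c s) (c t) \<le> \<bar>s - t\<bar>"
  by (simp add: geodesic_path_def)

text \<open>Let \<open>r\<close> be the last time at which \<open>c\<close> and \<open>e\<close> agree.  Running \<open>c\<close> backwards to \<open>c r\<close> and then along \<open>e\<close>
  gives an arc, so the geodesic between the end points passes through \<open>c r\<close>.\<close>

lemma R_tree_tripod: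
  assumes T: "R_tree M d" and c: "geodesic_path M d a c" and e: "geodesic_path M d b e"
    and "0 \<le> a" "0 \<le> b" "c 0 = e 0"
    and s: "0 \<le> s" "2 * s \<le> a + b - d (c a) (e b)"
  shows "c s = e s"
proof -
  have MS: "Metric_space M d" using T by (simp add: R_tree_def geodesic_space_def)
  then interpret Metric_space M d .
  have cM: "t \<in> {0..a} \<Longrightarrow> c t \<in> M" and eM: "t \<in> {0..b} \<Longrightarrow> e t \<in> M" for t
    using c e by (auto simp: geodesic_path_def)
  have dc: "t \<in> {0..a} \<Longrightarrow> u \<in> {0..a} \<Longrightarrow> d (c t) (c u) = \<bar>t - u\<bar>"
    and de: "t \<in> {0..b} \<Longrightarrow> u \<in> {0..b} \<Longrightarrow> d (e t) (e u) = \<bar>t - u\<bar>" for t u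
    using c e by (auto simp: geodesic_path_def)
  have same: "t = u" if "t \<in> {0..a}" "u \<in> {0..b}" "c t = e u" for t u
    using dc[of 0 t] de[of 0 u] that \<open>c 0 = e 0\<close> \<open>0 \<le> a\<close> \<open>0 \<le> b\<close> by auto
  define A where "A = {t. 0 \<le> t \<and> t \<le> min a b \<and> c t = e t}"
  define r where "r = Sup A"
  have A: "0 \<in> A" "bdd_above A" using assms(4-6) unfolding A_def bdd_above_def by auto
  have r: "0 \<le> r" "r \<le> min a b"
    using cSup_upper[OF A] cSup_least[of A "min a b"] A(1) unfolding r_def A_def by auto
  have above: "t \<le> r" if "t \<in> A" for t using cSup_upper[OF that A(2)] by (simp add: r_def)
  \<comment> \<open>The supremum is attained because both paths are 1-Lipschitz.\<close>
  have cr: "c r = e r"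
  proof (rule ccontr)
    assume "c r \<noteq> e r"
    then have pos: "0 < d (c r) (e r)" using cM[of r] eM[of r] r by auto
    obtain t where t: "t \<in> A" "r - d (c r) (e r) / 4 < t"
      using less_cSupD[of A "r - d (c r) (e r) / 4"] A pos unfolding r_def by force
    have "d (c r) (e r) \<le> d (c r) (c t) + d (e t) (e r)"
      using triangle[of "c r" "c t" "e r"] cM eM r t by (auto simp: A_def)
    also have "\<dots> = 2 * (r - t)" using dc[of r t] de[of t r] r t above[OF t(1)] by (auto simp: A_def)
    finally show False using t(2) pos by simp
  qed
  \<comment> \<open>Where the paths meet, their parameters agree, being the distance to the common
    origin. So the two legs beyond \<open>r\<close> are disjoint, which makes the path
    \<open>h\<close> below injective.\<close>
  have beyond: "u \<le> r" if "t \<in> {0..a}" "u \<in> {0..b}" "c t = e u" for t u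
    using same[OF that] that above[of u] by (auto simp: A_def)
  have dyz: "d (c a) (e b) = a + b - 2 * r"
  proof (cases "r < a \<and> r < b")
    case False
    then consider "r = a" | "r = b" using r by linarith
    then show ?thesis
    proof cases
      case 1 then show ?thesis using de[of a b] cr r by auto
    next
      case 2 then show ?thesis using dc[of a b] cr r by auto
    qed
  next
    case True
    define l where "l = (a - r) + (b - r)"
    define h where "h u = (if u \<le> a - r then c (a - u) else e (u - (a - r) + r))" for u
    have hM: "h u \<in> M" if "u \<in> {0..l}" for u using that cM eM r by (auto simp: h_def l_def)
    have cross: "d (c v) (e w) \<le> (v - r) + (w - r)" if "v \<in> {r..a}" "w \<in> {r..b}" for v w
      using triangle[of "c v" "c r" "e w"] dc[of v r] de[of r w] cM[of v] cM[of r] eM[of w] that r cr by auto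
    have hL: "d (h u) (h v) \<le> \<bar>u - v\<bar>" if "u \<in> {0..l}" "v \<in> {0..l}" for u v
    proof -
      consider "u \<le> a - r" "v \<le> a - r" | "u > a - r" "v > a - r" | "u \<le> a - r" "v > a - r" | "u > a - r" "v \<le> a - r"
        by linarith
      then show ?thesis
      proof cases
        case 1 then show ?thesis using that r dc[of "a - u" "a - v"] by (auto simp: h_def)
      next
        case 2 then show ?thesis
          using that r de[of "u - (a - r) + r" "v - (a - r) + r"] by (auto simp: h_def l_def)
      next
        case 3 then show ?thesis
          using that r cross[of "a - u" "v - (a - r) + r"] by (auto simp: h_def l_def)
      next
        case 4 then show ?thesis
          using that r cross[of "a - v" "u - (a - r) + r"] commute[of "h u" "h v"] by (auto simp: h_def l_def)
      qed
    qed
    have hinj: "inj_on h {0..l}"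
    proof (rule linorder_inj_onI)
      fix u v :: real assume uv: "u < v" "u \<in> {0..l}" "v \<in> {0..l}"
      show "h u \<noteq> h v"
      proof
        assume eq: "h u = h v"
        consider "v \<le> a - r" | "u > a - r" | "u \<le> a - r" "v > a - r" using uv by linarith
        then show False
        proof cases
          case 1
          then show ?thesis using eq uv r dc[of "a - u" "a - v"] mdist_zero[of "c (a - u)"] cM[of "a - u"] cM[of "a - v"] by (auto simp: h_def)
        next
          case 2
          then show ?thesis using eq uv r de[of "u - (a - r) + r" "v - (a - r) + r"] eM[of "v - (a - r) + r"] by (auto simp: h_def l_def)
        next
          case 3
          then show ?thesis using eq uv r beyond[of "a - u" "v - (a - r) + r"] by (auto simp: h_def l_def)
        qed
      qed
    qed auto
    have ends: "h 0 = c a" "h l = e b" using True r by (auto simp: h_def l_def)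
    have "0 < l" using True by (simp add: l_def)
    then have ne: "c a \<noteq> e b" using hinj ends by (metis atLeastAtMost_iff inj_on_eq_iff less_eq_real_def less_irrefl order_refl)
    have yz: "c a \<in> M" "e b \<in> M" using cM eM \<open>0 \<le> a\<close> \<open>0 \<le> b\<close> by auto
    then obtain k where k: "geodesic_path M d (d (c a) (e b)) k" "k 0 = c a" "k (d (c a) (e b)) = e b"
      using R_tree_geodesic[OF T] by blast
    have "0 < d (c a) (e b)" using ne yz by simp
    then have "h ` {0..l} = k ` {0..d (c a) (e b)}"
      using hM hinj hL k ends geodesic_path_inj[OF k(1) MS] geodesic_path_Lipschitz[OF k(1)] \<open>0 < l\<close>
      by (intro R_tree_unique_image[OF T]) (auto simp: geodesic_path_def)
    moreover have "c r = h (a - r)" "a - r \<in> {0..l}" using True by (auto simp: h_def l_def)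
    ultimately obtain w where w: "w \<in> {0..d (c a) (e b)}" "c r = k w" by blast
    have "d (c a) (c r) = w" "d (c r) (e b) = d (c a) (e b) - w"
    proof -
      have kd: "d (k t) (k u) = \<bar>t - u\<bar>" if "t \<in> {0..d (c a) (e b)}" "u \<in> {0..d (c a) (e b)}" for t u
        using k(1) that unfolding geodesic_path_def by blast
      show "d (c a) (c r) = w" using kd[of 0 w] w unfolding w(2) k(2) by simp
      show "d (c r) (e b) = d (c a) (e b) - w"
        using kd[of w "d (c a) (e b)"] w unfolding w(2) k(3) by simp
    qed
    moreover have "d (c a) (c r) = a - r" "d (c r) (e b) = b - r"
      using dc[of a r] de[of r b] r cr by auto
    ultimately show ?thesis by linarith
  qed
  \<comment> \<open>The end points are \<open>a + b - 2 * r\<close> apart, so the hypothesis on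
    \<open>s\<close> says \<open>s \<le> r\<close>. Up to \<open>r\<close> the two geodesics have
    the same ends, hence the same image, and on it the parameter is the distance to the
    origin.\<close>
  then have sr: "s \<le> r" using s by linarith
  show ?thesis
  proof (cases "r = 0")
    case False
    then have "0 < r" using r by simp
    have ce: "geodesic_path M d r c" "geodesic_path M d r e"
      using r geodesic_path_mono[OF c, of r] geodesic_path_mono[OF e, of r] by auto
    have "c ` {0..r} = e ` {0..r}"
      by (rule R_tree_unique_image[OF T \<open>0 < r\<close> \<open>0 < r\<close> _ geodesic_path_inj[OF ce(1) MS] geodesic_path_Lipschitz[OF ce(1)]
            _ geodesic_path_inj[OF ce(2) MS] geodesic_path_Lipschitz[OF ce(2)] \<open>c 0 = e 0\<close> cr])
        (use cM eM r in auto)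
    then obtain u where "u \<in> {0..r}" "c s = e u" using sr s by (metis atLeastAtMost_iff imageE imageI)
    then show ?thesis using same[of s u] sr s r by auto
  qed (use sr s \<open>c 0 = e 0\<close> in auto)
qed

text \<open>By \<open>R_tree_tripod\<close> the geodesics from \<open>w\<close> to \<open>x\<close>,
  \<open>y\<close> and \<open>z\<close> pass through the same point at time \<open>t\<close>, the
  smaller of the two products; joining \<open>x\<close> to \<open>z\<close> through this point
  bounds \<open>d x z\<close>.\<close>

lemma R_tree_Gromov_product:
  assumes T: "R_tree M d" and M: "w \<in> M" "x \<in> M" "y \<in> M" "z \<in> M"
  shows "min (Gromov_product d w x y) (Gromov_product d w y z) \<le> Gromov_product d w x z"
proof -
  interpret Metric_space M d using T by (simp add: R_tree_def geodesic_space_def)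
  define t where "t = min (Gromov_product d w x y) (Gromov_product d w y z)"
  have t: "2 * t \<le> d w x + d w y - d x y" "2 * t \<le> d w y + d w z - d y z"
    unfolding t_def Gromov_product_def by (simp_all add: commute min_def)
  have t0: "0 \<le> t" "t \<le> d w x" "t \<le> d w z"
    using triangle[of x w y] triangle[of y w z] triangle[of w x y] triangle[of w z y] M t
    unfolding t_def Gromov_product_def by (simp_all add: commute min_def)
  obtain cx where cx: "geodesic_path M d (d w x) cx" "cx 0 = w" "cx (d w x) = x" using R_tree_geodesic[OF T M(1,2)] by blast
  obtain cy where cy: "geodesic_path M d (d w y) cy" "cy 0 = w" "cy (d w y) = y" using R_tree_geodesic[OF T M(1,3)] by blast
  obtain cz where cz: "geodesic_path M d (d w z) cz" "cz 0 = w" "cz (d w z) = z" using R_tree_geodesic[OF T M(1,4)] by blast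
  have "cx t = cy t" by (rule R_tree_tripod[OF T cx(1) cy(1)]) (use cx cy t t0 in auto)
  moreover have "cy t = cz t" by (rule R_tree_tripod[OF T cy(1) cz(1)]) (use cy cz t t0 in auto)
  ultimately have eq: "cx t = cz t" by simp
  have "d x (cx t) = d w x - t" "d z (cz t) = d w z - t"
    using cx cz t0 unfolding geodesic_path_def by (metis abs_of_nonneg atLeastAtMost_iff diff_ge_0_iff_ge nonneg order_refl)+
  moreover have "cx t \<in> M" using cx(1) t0 by (auto simp: geodesic_path_def)
  ultimately have "d x z \<le> d w x - t + (d w z - t)"
    using triangle[of x "cx t" z] M eq commute[of z "cz t"] by auto
  then show ?thesis unfolding t_def[symmetric] by (simp add: Gromov_product_def commute)
qed

lemma R_tree_four_point:
  assumes "R_tree M d" "x \<in> M" "y \<in> M" "z \<in> M" "w \<in> M"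
  shows "d x y + d z w \<le> d x z + d y w \<or> d x y + d z w \<le> d x w + d y z"
proof -
  interpret Metric_space M d using assms(1) by (simp add: R_tree_def geodesic_space_def)
  show ?thesis
    using R_tree_Gromov_product[OF assms(1,5,2,4,3)] by (auto simp: Gromov_product_def min_def commute split: if_splits)
qed

section \<open>Asymptotic cones\<close>

lemma nonprincipal_eventually_ge:
  fixes \<omega> :: "nat filter"
  assumes "nonprincipal_ultrafilter \<omega>"
  shows "eventually (\<lambda>n. n0 \<le> n) \<omega>"
proof (induction n0)
  case (Suc n0)
  have "eventually (\<lambda>n. n \<noteq> n0) \<omega>" using assms unfolding nonprincipal_ultrafilter_def by blast
  with Suc show ?case by eventually_elim auto
qed simp

text \<open>Compactness of an interval gives a cluster point, and along an ultrafilter a cluster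
  point is a limit.\<close>

lemma ultrafilter_bounded_tendsto:
  fixes f :: "'a \<Rightarrow> real"
  assumes "nonprincipal_ultrafilter \<omega>" "\<And>n. \<bar>f n\<bar> \<le> C"
  shows "\<exists>l. (f \<longlongrightarrow> l) \<omega>"
proof -
  have ne: "filtermap f \<omega> \<noteq> bot" using assms(1) by (simp add: nonprincipal_ultrafilter_def filtermap_bot_iff)
  have "f n \<in> {-C..C}" for n using assms(2)[of n] by (auto simp: abs_le_iff)
  then have "eventually (\<lambda>x. x \<in> {-C..C}) (filtermap f \<omega>)" by (simp add: eventually_filtermap)
  then obtain l where l: "inf (nhds l) (filtermap f \<omega>) \<noteq> bot"
    using ne compact_Icc[of "-C" C] unfolding compact_filter by blast
  have "(f \<longlongrightarrow> l) \<omega>"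
  proof (rule topological_tendstoI, rule ccontr)
    fix V assume V: "open V" "l \<in> V" and "\<not> eventually (\<lambda>n. f n \<in> V) \<omega>"
    then have "eventually (\<lambda>x. x \<notin> V) (filtermap f \<omega>)"
      using assms(1) unfolding nonprincipal_ultrafilter_def eventually_filtermap by blast
    moreover have "eventually (\<lambda>x. x \<in> V) (nhds l)" using V by (auto simp: eventually_nhds)
    ultimately have "eventually (\<lambda>x. False) (inf (nhds l) (filtermap f \<omega>))"
      unfolding eventually_inf by blast
    then show False using l by (simp add: trivial_limit_def)
  qed
  then show ?thesis by blast
qed

context word_metric_group
begin

text \<open>Prefixes of a shortest word give the upper bounds \<open>j - i\<close>; the triangle
  inequality between the ends turns them into equalities.\<close>

lemma ex_geodesic:
  assumes "x \<in> carrier G" "y \<in> carrier G"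
  shows "\<exists>\<gamma> :: nat \<Rightarrow> 'a. \<gamma> 0 = x \<and> \<gamma> (nd x y) = y \<and> (\<forall>i. \<gamma> i \<in> carrier G) \<and>
    (\<forall>i j. i \<le> j \<longrightarrow> j \<le> nd x y \<longrightarrow> nd (\<gamma> i) (\<gamma> j) = j - i)"
proof -
  obtain ws where ws: "length ws = nd x y" "set ws \<subseteq> letters" "word_val ws = inv x \<otimes> y"
    using wl_word[of "inv x \<otimes> y"] assms by (auto simp: nd_def)
  define \<gamma> where "\<gamma> i = x \<otimes> word_val (take i ws)" for i
  have sub: "set (take i ws) \<subseteq> letters" "set (drop i ws) \<subseteq> letters" for i
    using ws(2) set_take_subset[of i ws] set_drop_subset[of i ws] by auto
  have c: "word_val vs \<in> carrier G" if "set vs \<subseteq> letters" for vs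
    using that letters_carrier word_val_closed by blast
  have le: "nd (\<gamma> i) (\<gamma> j) \<le> j - i" if "i \<le> j" for i j
  proof -
    have "take j ws = take i ws @ take (j - i) (drop i ws)" using that by (metis le_add_diff_inverse take_add)
    moreover have s: "set (take (j - i) (drop i ws)) \<subseteq> letters"
      using sub(2)[of i] set_take_subset[of "j - i" "drop i ws"] by blast
    ultimately have "word_val (take j ws) = word_val (take i ws) \<otimes> word_val (take (j - i) (drop i ws))"
      using word_val_append[OF order_trans[OF sub(1) letters_carrier] order_trans[OF s letters_carrier]] by metis
    then have "\<gamma> j = \<gamma> i \<otimes> word_val (take (j - i) (drop i ws))"
      using assms(1) c[OF sub(1)] c[OF s] by (simp add: \<gamma>_def m_assoc)
    then have "nd (\<gamma> i) (\<gamma> j) = wl (word_val (take (j - i) (drop i ws)))"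
      using nd_mult[of "\<gamma> i" "word_val (take (j - i) (drop i ws))"] c[OF s] c[OF sub(1)] assms(1)
      by (simp add: \<gamma>_def)
    also have "\<dots> \<le> j - i" using wl_le[OF s] by simp
    finally show ?thesis .
  qed
  have gc: "\<gamma> i \<in> carrier G" for i using c[OF sub(1)] assms(1) by (simp add: \<gamma>_def)
  have g0: "\<gamma> 0 = x" using assms(1) by (simp add: \<gamma>_def)
  have gn: "\<gamma> (nd x y) = y" using assms ws m_assoc[of x "inv x" y] by (simp add: \<gamma>_def)
  have "nd (\<gamma> i) (\<gamma> j) = j - i" if "i \<le> j" "j \<le> nd x y" for i j
    using le[of 0 i] le[OF that(1)] le[OF that(2)] nd_tri[of x "\<gamma> i" y] nd_tri[of "\<gamma> i" "\<gamma> j" y]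
      gc assms that g0 gn by auto
  then show ?thesis using g0 gn gc by blast
qed

end

locale asymptotic = word_metric_group G S for G :: "('a, 'b) monoid_scheme" (structure) and S +
  fixes \<omega> :: "nat filter" and dd :: "nat \<Rightarrow> real"
  assumes ultra: "nonprincipal_ultrafilter \<omega>" and scaling: "scaling_sequence dd"
begin

abbreviation "adm \<equiv> admissible_seqs G S dd"
abbreviation "Cone \<equiv> asymptotic_cone G S \<omega> dd"
abbreviation "cdist \<equiv> cone_dist G S \<omega> dd"

definition sd :: "(nat \<Rightarrow> 'a) \<Rightarrow> (nat \<Rightarrow> 'a) \<Rightarrow> nat \<Rightarrow> real" where
  "sd g h n = real (nd (g n) (h n)) / dd n"

text \<open>A pseudometric on admissible sequences whose metric quotient is the cone: computations
  are made with sequences and transferred by \<open>cdist_cls\<close>.\<close>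

definition \<rho> :: "(nat \<Rightarrow> 'a) \<Rightarrow> (nat \<Rightarrow> 'a) \<Rightarrow> real" where
  "\<rho> g h = Lim \<omega> (sd g h)"

definition cls :: "(nat \<Rightarrow> 'a) \<Rightarrow> (nat \<Rightarrow> 'a) set" where
  "cls g = cone_rel G S \<omega> dd `` {g}"

lemma \<omega>_not_bot: "\<omega> \<noteq> bot" using ultra by (simp add: nonprincipal_ultrafilter_def)

lemma dd_pos: "0 < dd n" using scaling by (simp add: scaling_sequence_def)

lemma dd_at_top: "filterlim dd at_top \<omega>"
  unfolding filterlim_at_top
proof
  fix Z
  have "\<exists>n0. Z \<le> dd n0"
  proof (rule ccontr)
    assume "\<not> ?thesis"
    then have "bdd_above (range dd)" by (intro bdd_aboveI[of _ Z]) (auto simp: not_le less_imp_le)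
    then show False using scaling by (simp add: scaling_sequence_def)
  qed
  then obtain n0 where "Z \<le> dd n0" by blast
  then have "Z \<le> dd n" if "n0 \<le> n" for n
    using that scaling unfolding scaling_sequence_def mono_def by (meson order_trans)
  then show "eventually (\<lambda>n. Z \<le> dd n) \<omega>"
    by (rule eventually_mono[OF nonprincipal_eventually_ge[OF ultra]])
qed

lemma inverse_dd: "((\<lambda>n. 1 / dd n) \<longlongrightarrow> 0) \<omega>"
  using tendsto_inverse_0_at_top[OF dd_at_top] by (simp add: inverse_eq_divide)

lemma adm_iff: "g \<in> adm \<longleftrightarrow> (\<forall>n. g n \<in> carrier G) \<and> (\<exists>C. \<forall>n. real (wl (g n)) \<le> C * dd n)"
proof -
  have "word_dist G S \<one> (g n) / dd n \<le> C \<longleftrightarrow> real (wl (g n)) \<le> C * dd n" if "g n \<in> carrier G" for n C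
    using that dd_pos[of n] by (simp add: word_dist_nd nd_one pos_divide_le_eq)
  then show ?thesis
    unfolding admissible_seqs_def mem_Collect_eq by (intro conj_cong ex_cong1 all_cong1) auto
qed

lemma adm_carrier: "g \<in> adm \<Longrightarrow> g n \<in> carrier G" by (simp add: adm_iff)

lemma adm_bound: "g \<in> adm \<Longrightarrow> \<exists>C. \<forall>n. real (wl (g n)) \<le> C * dd n" by (simp add: adm_iff)

lemma admI:
  assumes "\<And>n. g n \<in> carrier G" "\<And>n. real (wl (g n)) \<le> C * dd n" shows "g \<in> adm"
  using assms by (auto simp: adm_iff)

lemma sd_nonneg: "0 \<le> sd g h n" using dd_pos[of n] by (simp add: sd_def)

lemma sd_bounded: assumes "g \<in> adm" "h \<in> adm" shows "\<exists>C. \<forall>n. sd g h n \<le> C"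
proof -
  obtain A where A: "\<And>n. real (wl (g n)) \<le> A * dd n" using adm_bound[OF assms(1)] by blast
  obtain B where B: "\<And>n. real (wl (h n)) \<le> B * dd n" using adm_bound[OF assms(2)] by blast
  have "sd g h n \<le> A + B" for n
  proof -
    have "nd (g n) (h n) \<le> wl (g n) + wl (h n)"
      using nd_tri[of "g n" \<one> "h n"] nd_sym[of "g n" \<one>] adm_carrier[OF assms(1)] adm_carrier[OF assms(2)]
      by (simp add: nd_one)
    then have "real (nd (g n) (h n)) \<le> (A + B) * dd n" using A[of n] B[of n] by (simp add: distrib_right)
    then show ?thesis using dd_pos[of n] by (simp add: sd_def pos_divide_le_eq)
  qed
  then show ?thesis by blast
qed

lemma \<rho>_tendsto: assumes "g \<in> adm" "h \<in> adm" shows "(sd g h \<longlongrightarrow> \<rho> g h) \<omega>"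
proof -
  obtain C where "\<And>n. sd g h n \<le> C" using sd_bounded[OF assms] by blast
  then have "\<And>n. \<bar>sd g h n\<bar> \<le> C" using sd_nonneg by simp
  then obtain l where "(sd g h \<longlongrightarrow> l) \<omega>" using ultrafilter_bounded_tendsto[OF ultra] by blast
  then show ?thesis using tendsto_Lim[OF \<omega>_not_bot, of "sd g h" l] by (simp add: \<rho>_def)
qed

lemma \<rho>_eqI: "(sd g h \<longlongrightarrow> l) \<omega> \<Longrightarrow> \<rho> g h = l"
  using tendsto_Lim[OF \<omega>_not_bot] by (simp add: \<rho>_def)

lemma \<rho>_nonneg: "g \<in> adm \<Longrightarrow> h \<in> adm \<Longrightarrow> 0 \<le> \<rho> g h"
  by (rule tendsto_lowerbound[OF \<rho>_tendsto]) (auto simp: sd_nonneg \<omega>_not_bot)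

lemma \<rho>_self: "g \<in> adm \<Longrightarrow> \<rho> g g = 0"
  by (rule \<rho>_eqI) (simp add: sd_def[abs_def] adm_carrier)

lemma \<rho>_sym: "g \<in> adm \<Longrightarrow> h \<in> adm \<Longrightarrow> \<rho> g h = \<rho> h g"
  using nd_sym adm_carrier by (simp add: \<rho>_def sd_def[abs_def])

lemma \<rho>_tri: assumes "g \<in> adm" "h \<in> adm" "k \<in> adm" shows "\<rho> g k \<le> \<rho> g h + \<rho> h k"
proof (rule tendsto_le[OF \<omega>_not_bot tendsto_add[OF \<rho>_tendsto \<rho>_tendsto] \<rho>_tendsto])
  have "sd g k n \<le> sd g h n + sd h k n" for n
    using nd_tri[of "g n" "h n" "k n"] assms dd_pos[of n] adm_carrier
    unfolding sd_def add_divide_distrib[symmetric]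
    by (intro divide_right_mono) (auto simp flip: of_nat_add)
  then show "eventually (\<lambda>n. sd g k n \<le> sd g h n + sd h k n) \<omega>" by simp
qed (use assms in auto)

lemma cone_rel_iff: "(g, h) \<in> cone_rel G S \<omega> dd \<longleftrightarrow> g \<in> adm \<and> h \<in> adm \<and> \<rho> g h = 0"
proof -
  have "(\<lambda>n. word_dist G S (g n) (h n) / dd n) = sd g h" by (simp add: sd_def[abs_def] word_dist_nd)
  then show ?thesis using \<rho>_tendsto[of g h] \<rho>_eqI[of g h] by (auto simp: cone_rel_def)
qed

lemma mem_cls: "h \<in> cls g \<longleftrightarrow> g \<in> adm \<and> h \<in> adm \<and> \<rho> g h = 0"
  by (simp add: cls_def cone_rel_iff)

lemma cls_self: "g \<in> adm \<Longrightarrow> g \<in> cls g" by (simp add: mem_cls \<rho>_self)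

lemma \<rho>_cong:
  assumes "g' \<in> cls g" "h' \<in> cls h" shows "\<rho> g' h' = \<rho> g h"
proof -
  have a: "g \<in> adm" "g' \<in> adm" "\<rho> g g' = 0" "h \<in> adm" "h' \<in> adm" "\<rho> h h' = 0"
    using assms by (auto simp: mem_cls)
  show ?thesis
    using \<rho>_tri[of g' g h'] \<rho>_tri[of g h h'] \<rho>_tri[of g g' h] \<rho>_tri[of g' h' h] a
      \<rho>_sym[of g g'] \<rho>_sym[of h h'] by auto
qed

lemma cls_eq_iff: assumes "g \<in> adm" "h \<in> adm" shows "cls g = cls h \<longleftrightarrow> \<rho> g h = 0"
proof
  assume "cls g = cls h"
  then show "\<rho> g h = 0" using cls_self[OF assms(2)] by (simp add: mem_cls flip: \<open>cls g = cls h\<close>)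
next
  assume 0: "\<rho> g h = 0"
  then have "h \<in> cls g" "g \<in> cls h" using assms \<rho>_sym[of g h] by (auto simp: mem_cls)
  then show "cls g = cls h"
    using \<rho>_cong[of h g] \<rho>_cong[of g h] cls_self unfolding set_eq_iff mem_cls[of _ g] mem_cls[of _ h]
    using assms by (metis mem_cls)
qed

lemma Cone_eq: "Cone = cls ` adm"
  by (auto simp: asymptotic_cone_def quotient_def cls_def)

lemma cdist_cls: assumes "g \<in> adm" "h \<in> adm" shows "cdist (cls g) (cls h) = \<rho> g h"
proof -
  have e: "(\<lambda>n. word_dist G S (g n) (h n) / dd n) = sd g h" for g h
    by (simp add: sd_def[abs_def] word_dist_nd)
  have "(THE r. \<exists>g'\<in>cls g. \<exists>h'\<in>cls h. (sd g' h' \<longlongrightarrow> r) \<omega>) = \<rho> g h"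
  proof (rule the_equality)
    show "\<exists>g'\<in>cls g. \<exists>h'\<in>cls h. (sd g' h' \<longlongrightarrow> \<rho> g h) \<omega>"
      using cls_self assms \<rho>_tendsto by blast
    show "r = \<rho> g h" if "\<exists>g'\<in>cls g. \<exists>h'\<in>cls h. (sd g' h' \<longlongrightarrow> r) \<omega>" for r
      using that \<rho>_cong \<rho>_eqI by metis
  qed
  moreover have "cls g \<in> Cone" "cls h \<in> Cone" using assms by (auto simp: Cone_eq)
  ultimately show ?thesis by (simp add: cone_dist_def e)
qed

lemma cdist_outside: "X \<notin> Cone \<or> Y \<notin> Cone \<Longrightarrow> cdist X Y = 0"
  by (auto simp: cone_dist_def)

lemma Metric_space_Cone: "Metric_space Cone cdist"
proof
  show "0 \<le> cdist X Y" for X Y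
  proof (cases "X \<in> Cone \<and> Y \<in> Cone")
    case True
    then show ?thesis by (auto simp: Cone_eq cdist_cls \<rho>_nonneg)
  qed (use cdist_outside in auto)
  show "cdist X Y = cdist Y X" for X Y
  proof (cases "X \<in> Cone \<and> Y \<in> Cone")
    case True
    then show ?thesis by (auto simp: Cone_eq cdist_cls \<rho>_sym)
  qed (use cdist_outside in auto)
  show "cdist X Y = 0 \<longleftrightarrow> X = Y" if "X \<in> Cone" "Y \<in> Cone" for X Y
    using that by (auto simp: Cone_eq cdist_cls simp flip: cls_eq_iff)
  show "cdist X Z \<le> cdist X Y + cdist Y Z" if "X \<in> Cone" "Y \<in> Cone" "Z \<in> Cone" for X Y Z
    using that by (auto simp: Cone_eq cdist_cls \<rho>_tri)
qed

lemma floor_scaled_tendsto: assumes "0 \<le> s" shows "((\<lambda>n. real (nat \<lfloor>s * dd n\<rfloor>) / dd n) \<longlongrightarrow> s) \<omega>"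
proof -
  have b: "s - 1 / dd n \<le> real (nat \<lfloor>s * dd n\<rfloor>) / dd n" "real (nat \<lfloor>s * dd n\<rfloor>) / dd n \<le> s" for n
  proof -
    have "0 \<le> s * dd n" using assms dd_pos[of n] by simp
    then have "s * dd n - 1 \<le> real (nat \<lfloor>s * dd n\<rfloor>)" "real (nat \<lfloor>s * dd n\<rfloor>) \<le> s * dd n" by linarith+
    then show "s - 1 / dd n \<le> real (nat \<lfloor>s * dd n\<rfloor>) / dd n" "real (nat \<lfloor>s * dd n\<rfloor>) / dd n \<le> s"
      using dd_pos[of n] by (simp_all add: pos_le_divide_eq pos_divide_le_eq left_diff_distrib)
  qed
  have "((\<lambda>n. s - 1 / dd n) \<longlongrightarrow> s) \<omega>" using tendsto_diff[OF tendsto_const inverse_dd, of s] by simp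
  then show ?thesis by (rule tendsto_sandwich[rotated 2, OF _ tendsto_const]) (use b in auto)
qed

text \<open>A limit of discrete geodesics: the point at time \<open>s\<close> is the class of the
  sequence of points at time \<open>nat \<lfloor>s * dd n\<rfloor>\<close> on geodesics from
  \<open>g n\<close> to \<open>h n\<close>.\<close>

lemma geodesic_Cone:
  assumes g: "g \<in> adm" and h: "h \<in> adm"
  shows "\<exists>c. c 0 = cls g \<and> c (\<rho> g h) = cls h \<and> c ` {0..\<rho> g h} \<subseteq> Cone \<and>
    (\<forall>s\<in>{0..\<rho> g h}. \<forall>t\<in>{0..\<rho> g h}. cdist (c s) (c t) = \<bar>s - t\<bar>)"
proof -
  define l where "l n = nd (g n) (h n)" for n
  have "\<forall>n. \<exists>\<gamma> :: nat \<Rightarrow> 'a. \<gamma> 0 = g n \<and> \<gamma> (l n) = h n \<and> (\<forall>i. \<gamma> i \<in> carrier G) \<and>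
    (\<forall>i j. i \<le> j \<longrightarrow> j \<le> l n \<longrightarrow> nd (\<gamma> i) (\<gamma> j) = j - i)"
    unfolding l_def using ex_geodesic adm_carrier g h by blast
  then obtain \<gamma> where \<gamma>: "\<And>n. \<gamma> n 0 = g n" "\<And>n. \<gamma> n (l n) = h n" "\<And>n i. \<gamma> n i \<in> carrier G"
    "\<And>n i j. i \<le> j \<Longrightarrow> j \<le> l n \<Longrightarrow> nd (\<gamma> n i) (\<gamma> n j) = j - i" by metis
  have nd\<gamma>: "real (nd (\<gamma> n i) (\<gamma> n j)) = \<bar>real i - real j\<bar>" if "i \<le> l n" "j \<le> l n" for n i j
    using \<gamma>(4)[of i j n] \<gamma>(4)[of j i n] nd_sym[OF \<gamma>(3) \<gamma>(3), of n i n j] that by (cases "i \<le> j") auto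
  \<comment> \<open>Cutting at \<open>l n\<close> keeps the index in the range where
    \<open>\<gamma> n\<close> is geodesic. In the limit it replaces \<open>s\<close> by
    \<open>min s (\<rho> g h)\<close>, which is \<open>s\<close> on the interval concerned.\<close>
  define m where "m s n = min (nat \<lfloor>s * dd n\<rfloor>) (l n)" for s n
  define p where "p s n = \<gamma> n (m s n)" for s n
  have ml: "m s n \<le> l n" for s n by (simp add: m_def)
  have p_adm: "p s \<in> adm" for s
  proof -
    obtain A where A: "\<And>n. real (wl (g n)) \<le> A * dd n" using adm_bound[OF g] by blast
    obtain B where B: "\<And>n. sd g h n \<le> B" using sd_bounded[OF g h] by blast
    have "real (wl (p s n)) \<le> (A + B) * dd n" for n
    proof -
      have "real (nd \<one> (p s n)) \<le> real (nd \<one> (g n)) + real (nd (g n) (p s n))"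
        using nd_tri[of \<one> "g n" "p s n"] adm_carrier[OF g] \<gamma>(3) by (simp add: p_def flip: of_nat_add)
      also have "real (nd (g n) (p s n)) \<le> real (l n)"
        using nd\<gamma>[of 0 n "m s n"] ml[of s n] by (simp add: p_def \<gamma>(1))
      also have "real (l n) \<le> B * dd n" using B[of n] dd_pos[of n] by (simp add: sd_def l_def pos_divide_le_eq)
      finally show ?thesis using A[of n] adm_carrier[OF g] \<gamma>(3) by (simp add: nd_one p_def distrib_right)
    qed
    then show ?thesis by (rule admI[rotated]) (simp add: p_def \<gamma>(3))
  qed
  have l_lim: "((\<lambda>n. real (l n) / dd n) \<longlongrightarrow> \<rho> g h) \<omega>"
    using \<rho>_tendsto[OF g h] by (simp add: sd_def[abs_def] l_def)
  have m_lim: "((\<lambda>n. real (m s n) / dd n) \<longlongrightarrow> min s (\<rho> g h)) \<omega>" if "0 \<le> s" for s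
  proof -
    have "real (m s n) / dd n = min (real (nat \<lfloor>s * dd n\<rfloor>) / dd n) (real (l n) / dd n)" for n
      using dd_pos[of n] by (simp add: m_def min_def divide_le_cancel)
    then show ?thesis using tendsto_min[OF floor_scaled_tendsto[OF that] l_lim] by simp
  qed
  have p_dist: "\<rho> (p s) (p t) = \<bar>s - t\<bar>" if "s \<in> {0..\<rho> g h}" "t \<in> {0..\<rho> g h}" for s t
  proof (rule \<rho>_eqI)
    have "sd (p s) (p t) n = \<bar>real (m s n) / dd n - real (m t n) / dd n\<bar>" for n
      using nd\<gamma>[OF ml ml, of n s t] dd_pos[of n]
      by (simp add: sd_def p_def flip: diff_divide_distrib)
    then have "sd (p s) (p t) = (\<lambda>n. \<bar>real (m s n) / dd n - real (m t n) / dd n\<bar>)" by (rule ext)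
    then show "(sd (p s) (p t) \<longlongrightarrow> \<bar>s - t\<bar>) \<omega>"
      using tendsto_rabs[OF tendsto_diff[OF m_lim m_lim], of s t] that by (simp add: min_def)
  qed
  have "\<rho> (p (\<rho> g h)) h = 0"
  proof (rule \<rho>_eqI)
    have "sd (p (\<rho> g h)) h n = \<bar>real (m (\<rho> g h) n) / dd n - real (l n) / dd n\<bar>" for n
      using nd\<gamma>[OF ml order_refl, of n "\<rho> g h"] dd_pos[of n]
      by (simp add: sd_def p_def \<gamma>(2) flip: diff_divide_distrib)
    then have "sd (p (\<rho> g h)) h = (\<lambda>n. \<bar>real (m (\<rho> g h) n) / dd n - real (l n) / dd n\<bar>)" by (rule ext)
    then show "(sd (p (\<rho> g h)) h \<longlongrightarrow> 0) \<omega>"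
      using tendsto_rabs[OF tendsto_diff[OF m_lim[of "\<rho> g h"] l_lim]] \<rho>_nonneg[OF g h] by simp
  qed
  then have "cls (p (\<rho> g h)) = cls h" using cls_eq_iff[OF p_adm h] by simp
  moreover have "p 0 = g" by (simp add: p_def[abs_def] m_def \<gamma>(1))
  ultimately show ?thesis
    using p_dist p_adm by (intro exI[of _ "\<lambda>s. cls (p s)"]) (auto simp: cdist_cls Cone_eq)
qed

lemma geodesic_space_Cone: "geodesic_space Cone cdist"
  unfolding geodesic_space_def
proof (intro conjI ballI)
  fix X Y assume "X \<in> Cone" "Y \<in> Cone"
  then obtain g h where gh: "g \<in> adm" "h \<in> adm" "X = cls g" "Y = cls h" by (auto simp: Cone_eq)
  show "\<exists>c. c 0 = X \<and> c (cdist X Y) = Y \<and> c ` {0..cdist X Y} \<subseteq> Cone \<and>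
    (\<forall>s\<in>{0..cdist X Y}. \<forall>t\<in>{0..cdist X Y}. cdist (c s) (c t) = \<bar>s - t\<bar>)"
    using geodesic_Cone[OF gh(1,2)] by (simp add: gh cdist_cls)
qed (rule Metric_space_Cone)

text \<open>If the condition failed with error \<open>q n\<close> for all large \<open>dd n\<close>,
  the violating points, translated so that the centre is \<open>\<one>\<close>, would form
  admissible sequences, as \<open>q n \<le> 2 * dd n\<close>. Division by \<open>dd n\<close> turns
  the excess \<open>q n\<close> into at least 1, and the limits would contradict the four point
  condition of a tree.\<close>

lemma R_tree_Cone_four_point:
  assumes T: "R_tree Cone cdist"
  shows "\<exists>q\<ge>Q. four_point_below q (k * q)"
proof -
  define q where "q n = nat \<lceil>dd n\<rceil>" for n
  have "\<exists>n. max 1 (real Q) \<le> dd n \<and> four_point_below (q n) (k * q n)"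
  proof (rule ccontr)
    assume no: "\<not> ?thesis"
    define large where "large n \<longleftrightarrow> max 1 (real Q) \<le> dd n" for n
    define viol where "viol n x y z w \<longleftrightarrow> x \<in> carrier G \<and> y \<in> carrier G \<and> z \<in> carrier G \<and> w \<in> carrier G \<and>
      wl x \<le> k * q n \<and> wl y \<le> k * q n \<and> wl z \<le> k * q n \<and> wl w \<le> k * q n \<and>
      nd x z + nd y w + q n < nd x y + nd z w \<and> nd x w + nd y z + q n < nd x y + nd z w" for n x y z w
    have "\<exists>x y z w. viol n x y z w" if "large n" for n
    proof -
      have "\<not> four_point_below (q n) (k * q n)" using no that by (auto simp: large_def)
      then obtain c x y z w where *: "c \<in> carrier G" "x \<in> carrier G" "y \<in> carrier G" "z \<in> carrier G" "w \<in> carrier G"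
        "nd c x \<le> k * q n" "nd c y \<le> k * q n" "nd c z \<le> k * q n" "nd c w \<le> k * q n"
        "\<not> (nd x y + nd z w \<le> nd x z + nd y w + q n \<or> nd x y + nd z w \<le> nd x w + nd y z + q n)"
        unfolding four_point_below_def by blast
      then have "viol n (inv c \<otimes> x) (inv c \<otimes> y) (inv c \<otimes> z) (inv c \<otimes> w)"
        by (auto simp: viol_def not_le nd_left simp flip: nd_def)
      then show ?thesis by blast
    qed
    then obtain x y z w where v: "\<And>n. large n \<Longrightarrow> viol n (x n) (y n) (z n) (w n)" by metis
    \<comment> \<open>The value \<one> at indices without a chosen violation keeps the sequences
      admissible; these indices are negligible for \<omega>.\<close>
    define cut where "cut f n = (if large n then f n else \<one>)" for f :: "nat \<Rightarrow> 'a" and n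
    have q: "real (q n) \<le> 2 * dd n" if "large n" for n
      using that by (simp add: q_def large_def) linarith
    have cut_adm: "cut f \<in> adm" if "\<And>n. large n \<Longrightarrow> f n \<in> carrier G \<and> wl (f n) \<le> k * q n" for f
    proof (rule admI)
      show "cut f n \<in> carrier G" for n using that by (simp add: cut_def)
      show "real (wl (cut f n)) \<le> (2 * real k) * dd n" for n
      proof (cases "large n")
        case True
        then have "real (wl (f n)) \<le> real (k * q n)" using that by (simp del: of_nat_mult)
        also have "\<dots> \<le> real k * (2 * dd n)" using q[OF True] by (simp add: mult_left_mono)
        finally show ?thesis using True by (simp add: cut_def)
      qed (use dd_pos[of n] in \<open>simp add: cut_def\<close>)
    qed
    have adm: "cut x \<in> adm" "cut y \<in> adm" "cut z \<in> adm" "cut w \<in> adm"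
      using v by (auto intro!: cut_adm simp: viol_def)
    have ev: "eventually large \<omega>" using dd_at_top unfolding filterlim_at_top large_def by blast
    have gap: "sd a1 a2 n + sd b1 b2 n + 1 \<le> sd c1 c2 n + sd e1 e2 n"
      if "large n" "nd (a1 n) (a2 n) + nd (b1 n) (b2 n) + q n < nd (c1 n) (c2 n) + nd (e1 n) (e2 n)"
      for n a1 a2 b1 b2 c1 c2 e1 e2
    proof -
      have "dd n \<le> real (q n)" using that(1) by (simp add: q_def large_def)
      moreover have "real (nd (a1 n) (a2 n)) + nd (b1 n) (b2 n) + q n \<le> real (nd (c1 n) (c2 n)) + nd (e1 n) (e2 n)"
        using that(2) by linarith
      ultimately have "(real (nd (a1 n) (a2 n)) + nd (b1 n) (b2 n) + dd n) / dd n \<le> (real (nd (c1 n) (c2 n)) + nd (e1 n) (e2 n)) / dd n"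
        using dd_pos[of n] by (intro divide_right_mono) auto
      then show ?thesis using dd_pos[of n] by (simp add: sd_def add_divide_distrib)
    qed
    have "\<rho> (cut x) (cut z) + \<rho> (cut y) (cut w) + 1 \<le> \<rho> (cut x) (cut y) + \<rho> (cut z) (cut w)"
      by (rule tendsto_le[OF \<omega>_not_bot tendsto_add[OF \<rho>_tendsto \<rho>_tendsto] tendsto_add[OF tendsto_add[OF \<rho>_tendsto \<rho>_tendsto] tendsto_const]])
        (use adm in auto, rule eventually_mono[OF ev], use v in \<open>auto intro!: gap simp: viol_def cut_def\<close>)
    moreover have "\<rho> (cut x) (cut w) + \<rho> (cut y) (cut z) + 1 \<le> \<rho> (cut x) (cut y) + \<rho> (cut z) (cut w)"
      by (rule tendsto_le[OF \<omega>_not_bot tendsto_add[OF \<rho>_tendsto \<rho>_tendsto] tendsto_add[OF tendsto_add[OF \<rho>_tendsto \<rho>_tendsto] tendsto_const]])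
        (use adm in auto, rule eventually_mono[OF ev], use v in \<open>auto intro!: gap simp: viol_def cut_def\<close>)
    moreover have "cls (cut x) \<in> Cone" "cls (cut y) \<in> Cone" "cls (cut z) \<in> Cone" "cls (cut w) \<in> Cone"
      using adm by (auto simp: Cone_eq)
    note R_tree_four_point[OF T this]
    ultimately show False using adm by (simp add: cdist_cls)
  qed
  then obtain n where n: "max 1 (real Q) \<le> dd n" "four_point_below (q n) (k * q n)" by blast
  have "Q \<le> q n" using n(1) by (simp add: q_def) linarith
  then show ?thesis using n(2) by blast
qed

end

section \<open>Undistorted subgroups\<close>

lemma (in Metric_space) arc_between_image:
  assumes "Metric_space M' d'" and F: "\<And>x. x \<in> M \<Longrightarrow> F x \<in> M'" "inj_on F M"
    and L: "0 < K" "\<And>x y. x \<in> M \<Longrightarrow> y \<in> M \<Longrightarrow> d' (F x) (F y) \<le> K * d x y"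
    and p: "arc_between M d x y p"
  shows "arc_between M' d' (F x) (F y) (F \<circ> p)"
proof -
  interpret M': Metric_space M' d' by fact
  have pM: "p ` {0..1} \<subseteq> M"
    using p path_image_subset_topspace unfolding arc_between_def by fastforce
  have "continuous_map mtopology M'.mtopology F"
    unfolding M'.continuous_map_to_metric
  proof (intro ballI allI impI)
    fix x and e :: real assume x: "x \<in> topspace mtopology" and "0 < e"
    show "\<exists>U. openin mtopology U \<and> x \<in> U \<and> (\<forall>y\<in>U. F y \<in> M'.mball (F x) e)"
    proof (intro exI[of _ "mball x (e / K)"] conjI ballI)
      show "x \<in> mball x (e / K)" using x \<open>0 < e\<close> L(1) by simp
      fix y assume y: "y \<in> mball x (e / K)"
      then have "K * d x y < e" using L(1) by (simp add: pos_less_divide_eq mult.commute)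
      then show "F y \<in> M'.mball (F x) e" using L(2)[of x y] y F(1) by auto
    qed simp
  qed
  then have "pathin M'.mtopology (F \<circ> p)" using p unfolding arc_between_def by (metis pathin_compose)
  moreover have "inj_on (F \<circ> p) {0..1}"
    using p pM F(2) inj_on_subset unfolding arc_between_def by (metis comp_inj_on)
  ultimately show ?thesis using p by (simp add: arc_between_def)
qed

lemma R_tree_bilipschitz_subspace:
  assumes T: "R_tree M' d'" and geo: "geodesic_space M d"
    and F: "\<And>x. x \<in> M \<Longrightarrow> F x \<in> M'" "inj_on F M"
    and L: "0 < K" "\<And>x y. x \<in> M \<Longrightarrow> y \<in> M \<Longrightarrow> d' (F x) (F y) \<le> K * d x y"
  shows "R_tree M d"
  unfolding R_tree_def
proof (intro conjI geo ballI allI impI)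
  interpret Metric_space M d using geo by (simp add: geodesic_space_def)
  have M': "Metric_space M' d'" using T by (simp add: R_tree_def geodesic_space_def)
  fix x y p q assume xy: "x \<in> M" "y \<in> M" and pq: "arc_between M d x y p \<and> arc_between M d x y q"
  have "arc_between M' d' (F x) (F y) (F \<circ> p)" "arc_between M' d' (F x) (F y) (F \<circ> q)"
    using arc_between_image[OF M' F L] pq by blast+
  then have "F ` p ` {0..1} = F ` q ` {0..1}"
    using T F(1) xy unfolding R_tree_def image_comp by blast
  moreover have "p ` {0..1} \<subseteq> M" "q ` {0..1} \<subseteq> M"
    using pq path_image_subset_topspace unfolding arc_between_def by fastforce+
  ultimately show "p ` {0..1} = q ` {0..1}" using inj_on_image_eq_iff[OF F(2), of "p ` {0..1}" "q ` {0..1}"] by (simp only:)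
qed

text \<open>\<open>undistorted_subgroup\<close> brings its own generating sets. The one of
  \<open>G\<close> is exchanged here for the set \<open>S0\<close> from which the tree was built,
  and all constants are merged into \<open>K\<close>.\<close>

lemma undistorted_comparison:
  assumes "group G" and S0: "finite_generating_set G S0" and und: "undistorted_subgroup H G"
  shows "\<exists>T K. finite_generating_set (G\<lparr>carrier := H\<rparr>) T \<and> 0 < K \<and> (\<forall>x\<in>H. \<forall>y\<in>H.
    word_dist G S0 x y \<le> K * word_dist (G\<lparr>carrier := H\<rparr>) T x y + K \<and>
    word_dist (G\<lparr>carrier := H\<rparr>) T x y \<le> K * word_dist G S0 x y + K)"
proof -
  interpret group G by fact
  obtain S T L C where ST: "finite_generating_set G S" "finite_generating_set (G\<lparr>carrier := H\<rparr>) T"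
    and L: "1 \<le> L" "0 \<le> C" "\<And>x y. x \<in> H \<Longrightarrow> y \<in> H \<Longrightarrow>
      word_dist (G\<lparr>carrier := H\<rparr>) T x y / L - C \<le> word_dist G S x y \<and>
      word_dist G S x y \<le> L * word_dist (G\<lparr>carrier := H\<rparr>) T x y + C"
    using und unfolding undistorted_subgroup_def quasi_isometric_embedding_def by blast
  have Hc: "H \<subseteq> carrier G" using und subgroup.subset unfolding undistorted_subgroup_def by blast
  interpret A: word_metric_group G S0 by unfold_locales fact
  interpret B: word_metric_group G S by unfold_locales fact
  obtain C1 where C1: "1 \<le> C1" "\<And>x. x \<in> carrier G \<Longrightarrow> word_length G S0 x \<le> C1 * word_length G S x"
    using A.word_length_comparison[OF ST(1)] by blast
  obtain C2 where C2: "1 \<le> C2" "\<And>x. x \<in> carrier G \<Longrightarrow> word_length G S x \<le> C2 * word_length G S0 x"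
    using B.word_length_comparison[OF S0] by blast
  define K where "K = real C1 * L + real C1 * C + L * real C2 + L * C"
  have K: "0 < K" "real C1 * L \<le> K" "real C1 * C \<le> K" "L * real C2 \<le> K" "L * C \<le> K"
    using C1(1) C2(1) L(1,2) by (auto simp: K_def intro!: add_pos_nonneg add_nonneg_nonneg)
  have "word_dist G S0 x y \<le> K * word_dist (G\<lparr>carrier := H\<rparr>) T x y + K \<and>
    word_dist (G\<lparr>carrier := H\<rparr>) T x y \<le> K * word_dist G S0 x y + K" if xy: "x \<in> H" "y \<in> H" for x y
  proof
    let ?t = "word_dist (G\<lparr>carrier := H\<rparr>) T x y"
    have xyc: "inv\<^bsub>G\<^esub> x \<otimes>\<^bsub>G\<^esub> y \<in> carrier G" using xy Hc by auto
    have nn: "0 \<le> ?t" "0 \<le> word_dist G S0 x y" by (simp_all add: word_dist_def)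
    have 1: "word_dist G S0 x y \<le> real C1 * word_dist G S x y"
      using C1(2)[OF xyc] by (simp add: word_dist_def flip: of_nat_mult)
    have 2: "word_dist G S x y \<le> real C2 * word_dist G S0 x y"
      using C2(2)[OF xyc] by (simp add: word_dist_def flip: of_nat_mult)
    have "word_dist G S0 x y \<le> real C1 * (L * ?t + C)"
      using 1 L(3)[OF xy] C1(1) by (meson mult_left_mono of_nat_0_le_iff order_trans)
    also have "\<dots> = (real C1 * L) * ?t + real C1 * C" by (simp add: algebra_simps)
    also have "\<dots> \<le> K * ?t + K" using K nn by (intro add_mono mult_right_mono) auto
    finally show "word_dist G S0 x y \<le> K * ?t + K" .
    have "?t / L \<le> real C2 * word_dist G S0 x y + C" using 2 L(3)[OF xy] by linarith
    then have "?t \<le> (real C2 * word_dist G S0 x y + C) * L" using L(1) by (simp add: pos_divide_le_eq)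
    also have "\<dots> = (L * real C2) * word_dist G S0 x y + L * C" by (simp add: algebra_simps)
    also have "\<dots> \<le> K * word_dist G S0 x y + K" using K nn by (intro add_mono mult_right_mono) auto
    finally show "?t \<le> K * word_dist G S0 x y + K" .
  qed
  then show ?thesis using ST(2) K(1) by blast
qed

text \<open>Additive constants disappear after division by \<open>dd n\<close>, so with the same
  \<omega> and \<open>dd\<close> a quasi-isometric inclusion becomes bi-Lipschitz on the
  cones.\<close>

lemma undistorted_lacunary_hyperbolic:
  assumes "lacunary_hyperbolic G" "undistorted_subgroup H G"
  shows "lacunary_hyperbolic (G\<lparr>carrier := H\<rparr>)"
proof -
  define GH where "GH = G\<lparr>carrier := H\<rparr>"
  obtain S0 \<omega> dd where lac: "group G" "finite_generating_set G S0" "nonprincipal_ultrafilter \<omega>"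
    "scaling_sequence dd" "R_tree (asymptotic_cone G S0 \<omega> dd) (cone_dist G S0 \<omega> dd)"
    using assms(1) unfolding lacunary_hyperbolic_def by blast
  interpret group G by fact
  have sub: "subgroup H G" using assms(2) by (simp add: undistorted_subgroup_def)
  obtain T K where T: "finite_generating_set GH T" and K: "0 < K"
    "\<And>x y. x \<in> H \<Longrightarrow> y \<in> H \<Longrightarrow> word_dist G S0 x y \<le> K * word_dist GH T x y + K"
    "\<And>x y. x \<in> H \<Longrightarrow> y \<in> H \<Longrightarrow> word_dist GH T x y \<le> K * word_dist G S0 x y + K"
    using undistorted_comparison[OF lac(1,2) assms(2)] unfolding GH_def by blast
  have GH: "group GH" unfolding GH_def by (rule subgroup_imp_group[OF sub])
  interpret A: asymptotic G S0 \<omega> dd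
    by (intro asymptotic.intro word_metric_group.intro word_metric_group_axioms.intro asymptotic_axioms.intro) fact+
  interpret B: asymptotic GH T \<omega> dd
    by (intro asymptotic.intro word_metric_group.intro word_metric_group_axioms.intro asymptotic_axioms.intro) fact+
  have GHs: "carrier GH = H" "\<one>\<^bsub>GH\<^esub> = \<one>\<^bsub>G\<^esub>" by (simp_all add: GH_def)
  have Hc: "x \<in> carrier G" if "x \<in> H" for x using that subgroup.mem_carrier[OF sub] by blast
  have ndK: "real (A.nd x y) \<le> K * real (B.nd x y) + K" "real (B.nd x y) \<le> K * real (A.nd x y) + K"
    if "x \<in> H" "y \<in> H" for x y
    using K(2,3)[OF that] by (simp_all add: A.word_dist_nd B.word_dist_nd)
  have adm: "g \<in> A.adm" if gB: "g \<in> B.adm" for g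
  proof -
    obtain C where C: "\<And>n. real (B.wl (g n)) \<le> C * dd n" using B.adm_bound[OF gB] by blast
    have gH: "g n \<in> H" for n using B.adm_carrier[OF gB] by (simp add: GHs)
    \<comment> \<open>\<open>dd 0 \<le> dd n\<close> turns the additive constant \<open>K\<close>
      into a multiple of \<open>dd n\<close>.\<close>
    have "real (A.wl (g n)) \<le> (K * C + K / dd 0) * dd n" for n
    proof -
      have "dd 0 \<le> dd n" using A.scaling by (simp add: scaling_sequence_def mono_def)
      then have "K \<le> K / dd 0 * dd n" using A.dd_pos[of 0] K(1) by (simp add: pos_le_divide_eq mult_left_mono)
      moreover have "K * real (B.wl (g n)) \<le> K * (C * dd n)" using C K(1) by simp
      moreover have "real (A.wl (g n)) \<le> K * real (B.wl (g n)) + K"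
        using ndK(1)[of "\<one>\<^bsub>G\<^esub>" "g n"] gH subgroup.one_closed[OF sub] A.nd_one[OF Hc[OF gH]] B.nd_one[of "g n"]
        by (simp add: GHs)
      ultimately show ?thesis by (simp add: distrib_right)
    qed
    then show ?thesis using A.admI[of g] Hc gH by blast
  qed
  have le_limit: "((\<lambda>n. K * f n + K / dd n) \<longlongrightarrow> K * l) \<omega>" if "(f \<longlongrightarrow> l) \<omega>" for f l
    using tendsto_add[OF tendsto_mult_left[OF that, of K] tendsto_mult_left[OF A.inverse_dd, of K]] by simp
  have sdK: "A.sd g h n \<le> K * B.sd g h n + K / dd n" "B.sd g h n \<le> K * A.sd g h n + K / dd n"
    if "g \<in> B.adm" "h \<in> B.adm" for g h n
  proof -
    have "g n \<in> H" "h n \<in> H" using B.adm_carrier that by (simp_all add: GHs)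
    note nd = ndK[OF this]
    show "A.sd g h n \<le> K * B.sd g h n + K / dd n" "B.sd g h n \<le> K * A.sd g h n + K / dd n"
      using divide_right_mono[OF nd(1), of "dd n"] divide_right_mono[OF nd(2), of "dd n"] A.dd_pos[of n]
      by (simp_all add: A.sd_def B.sd_def add_divide_distrib)
  qed
  have \<rho>K: "A.\<rho> g h \<le> K * B.\<rho> g h" "B.\<rho> g h \<le> K * A.\<rho> g h" if "g \<in> B.adm" "h \<in> B.adm" for g h
  proof -
    show "A.\<rho> g h \<le> K * B.\<rho> g h"
      by (rule tendsto_le[OF A.\<omega>_not_bot le_limit[OF B.\<rho>_tendsto[OF that]] A.\<rho>_tendsto])
        (use that adm sdK in auto)
    show "B.\<rho> g h \<le> K * A.\<rho> g h"
      by (rule tendsto_le[OF A.\<omega>_not_bot le_limit[OF A.\<rho>_tendsto] B.\<rho>_tendsto[OF that]])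
        (use that adm sdK in auto)
  qed
  \<comment> \<open>The union of the classes, in the cone of \<open>G\<close>, of all members of
    \<open>X\<close>. Members at distance 0 in the cone of \<open>H\<close> are so in that of
    \<open>G\<close>, hence this is a single class, obtained without choosing a
    representative.\<close>
  define F where "F X = cone_rel G S0 \<omega> dd `` X" for X
  have F: "F (B.cls g) = A.cls g" if g: "g \<in> B.adm" for g
  proof -
    have "A.cls g' = A.cls g" if "g' \<in> B.cls g" for g'
    proof -
      have g': "g' \<in> B.adm" "B.\<rho> g g' = 0" using that by (auto simp: B.mem_cls)
      then have "A.\<rho> g g' \<le> 0" using \<rho>K(1)[OF g g'(1)] by simp
      then have "A.\<rho> g g' = 0" using A.\<rho>_nonneg[OF adm[OF g] adm[OF g'(1)]] by simp
      then show ?thesis using A.cls_eq_iff adm g g'(1) by blast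
    qed
    then have "(\<Union>g'\<in>B.cls g. A.cls g') = A.cls g" using B.cls_self[OF g] by blast
    then show ?thesis by (auto simp: F_def A.cls_def)
  qed
  have "R_tree B.Cone B.cdist"
  proof (rule R_tree_bilipschitz_subspace[OF lac(5) B.geodesic_space_Cone])
    show "F X \<in> A.Cone" if "X \<in> B.Cone" for X
      using that F adm by (auto simp: B.Cone_eq A.Cone_eq)
    show "inj_on F B.Cone"
    proof (rule inj_onI)
      fix X Y assume "X \<in> B.Cone" "Y \<in> B.Cone" "F X = F Y"
      then obtain g h where gh: "g \<in> B.adm" "h \<in> B.adm" "X = B.cls g" "Y = B.cls h" "A.cls g = A.cls h"
        using F by (auto simp: B.Cone_eq)
      then have "A.\<rho> g h = 0" using A.cls_eq_iff adm by blast
      then have "B.\<rho> g h = 0" using \<rho>K(2)[OF gh(1,2)] B.\<rho>_nonneg[OF gh(1,2)] by simp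
      then show "X = Y" using B.cls_eq_iff gh by blast
    qed
    show "0 < K" by fact
    show "A.cdist (F X) (F Y) \<le> K * B.cdist X Y" if "X \<in> B.Cone" "Y \<in> B.Cone" for X Y
      using that F \<rho>K(1) adm by (auto simp: B.Cone_eq A.cdist_cls B.cdist_cls)
  qed
  then show ?thesis
    unfolding lacunary_hyperbolic_def using GH T lac(3,4) GH_def by blast
qed

theorem theorem3p18:
  fixes G :: "('a, 'b) monoid_scheme"
  assumes "lacunary_hyperbolic G"
  shows "(\<forall>H. subgroup H G \<and> finitely_presented (G\<lparr>carrier := H\<rparr>) \<longrightarrow>
            (\<exists>(K :: nat monoid) L. hyperbolic_group K \<and> subgroup L K \<and>
               G\<lparr>carrier := H\<rparr> \<cong> K\<lparr>carrier := L\<rparr>)) \<and>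
         (\<forall>H. undistorted_subgroup H G \<longrightarrow> lacunary_hyperbolic (G\<lparr>carrier := H\<rparr>)) \<and>
         (\<forall>H S. bounded_torsion_subgroup H G \<and> finite_generating_set G S \<longrightarrow>
            \<not> exponential_relative_growth H G S)"
proof -
  obtain S \<omega> dd where G: "group G" "finite_generating_set G S" "nonprincipal_ultrafilter \<omega>"
    "scaling_sequence dd" "R_tree (asymptotic_cone G S \<omega> dd) (cone_dist G S \<omega> dd)"
    using assms unfolding lacunary_hyperbolic_def by blast
  interpret asymptotic G S \<omega> dd
    by (intro asymptotic.intro word_metric_group.intro word_metric_group_axioms.intro
        asymptotic_axioms.intro) fact+
  note four = R_tree_Cone_four_point[OF G(5)]
  show ?thesis
    using hyperbolic_overgroup[OF four] undistorted_lacunary_hyperbolic[OF assms]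
      torsion_growth[OF four] by blast
qed

end
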